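(* Let $d,n,p$ be positive integers and $\gamma>0$ with $n\ge d$ and $p\ge \max(17n,\,1/\gamma)$. Fix $\theta\in\mathbb{R}^d$ and a matrix $W\in\mathbb{R}^{p\times d}$ with $W^\top W=p\gamma I_d$. Let tasks A and B, the estimators $\hat\beta_A,\hat\beta_B,\hat\beta_{BA}$ and the task-A risk $R$ be as defined in the context. Then there is a universal constant $c>0$ such that, with probability at least $1-10e^{-cd}$ (over the draw of the training data and of $O$), $$R(\hat\beta_{BA})-R(\hat\beta_A)\le\left(66\sqrt{\frac{n}{p}}+\frac{12}{p\gamma}\right)\|\theta\|^2 .$$
   Context: Latent space model: $W\in\mathbb{R}^{p\times d}$ is fixed. A single example is generated by $z\sim\mathcal N(0,I_d)$, $u\sim\mathcal N(0,I_p)$ independent, $x=Wz+u\in\mathbb{R}^p$, $y=z^\top\theta\in\mathbb{R}$. Task A: $n$ i.i.d. examples $(x_i,y_i)$; $X_A\in\mathbb{R}^{n\times p}$ has rows $x_i^\top$ and $y=(y_1,\dots,y_n)^\top$. Let $O$ be a Haar-distributed random $p\times p$ orthogonal matrix independent of the data. Task B has data $(X_B,y)$ with $X_B=X_AO^\top$. For a matrix $M$, $\mathcal P_{M}$ denotes the orthogonal projection onto the range (column space) of $M$. Estimators (well defined since $X_A$ has rank $n$ almost surely when $n<p$): $\hat\beta_A=X_A^\top(X_AX_A^\top)^{-1}y$ (the minimum-norm interpolator of task A), $\hat\beta_B=X_B^\top(X_BX_B^\top)^{-1}y$, and $\hat\beta_{BA}=\hat\beta_A+\hat\beta_B-\mathcal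 P_{X_B^\top}\hat\beta_A$, which is the minimizer of $\|b-\hat\beta_A\|^2$ subject to $X_Bb=y$. Define $\Sigma=WW^\top+I_p$, $\beta=W(W^\top W+I_d)^{-1}\theta$, $\sigma^2=\theta^\top(W^\top W+I_d)^{-1}\theta$. The task-A risk of a parameter vector $b\in\mathbb{R}^p$ (for the linear predictor $x\mapsto x^\top b$) is $R(b)=\mathbb{E}_{(x,y)}[(x^\top b-y)^2]$ for a fresh example $(x,y)$ from the task-A distribution, which equals $\sigma^2+(b-\beta)^\top\Sigma(b-\beta)$. *)

theory Defs
  imports "HOL-Probability.Probability" "Jordan_Normal_Form.Gauss_Jordan_Elimination"
begin

definition gauss_fn :: "'i set \<Rightarrow> ('i \<Rightarrow> real) measure" where
  "gauss_fn S = PiM S (\<lambda>_. density lborel std_normal_density)"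

definition fmat :: "nat \<Rightarrow> nat \<Rightarrow> (nat \<times> nat \<Rightarrow> real) \<Rightarrow> real mat" where
  "fmat m k f = mat m k (\<lambda>(i,j). f (i,j))"

definition mat_fn :: "real mat \<Rightarrow> (nat \<times> nat \<Rightarrow> real)" where
  "mat_fn M = (\<lambda>ij\<in>{..<dim_row M} \<times> {..<dim_col M}. M $$ ij)"

definition orth_mat :: "nat \<Rightarrow> real mat \<Rightarrow> bool" where
  "orth_mat p Q \<longleftrightarrow> Q \<in> carrier_mat p p \<and> transpose_mat Q * Q = 1\<^sub>m p"

text \<open>H is a Haar (uniform) probability distribution on the orthogonal group O(p):
  a probability measure on p x p real matrices (as functions on index pairs, with the
  Borel product sigma-algebra), concentrated on orthogonal matrices, and invariant under
  left multiplication by every orthogonal matrix.  (By uniqueness of Haar measure on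
  the compact group O(p) this characterises the Haar distribution.)\<close>
definition haar_orth :: "nat \<Rightarrow> (nat \<times> nat \<Rightarrow> real) measure \<Rightarrow> bool" where
  "haar_orth p H \<longleftrightarrow>
     prob_space H \<and>
     sets H = sets (PiM ({..<p} \<times> {..<p}) (\<lambda>_. lborel)) \<and>
     (AE Om in H. orth_mat p (fmat p p Om)) \<and>
     (\<forall>Q. orth_mat p Q \<longrightarrow> distr H H (\<lambda>Om. mat_fn (Q * fmat p p Om)) = H)"

text \<open>Matrix inverse (zero matrix if singular; only used on invertible matrices).\<close>
definition minv :: "real mat \<Rightarrow> real mat" where
  "minv A = (case mat_inverse A of Some B \<Rightarrow> B | None \<Rightarrow> 0\<^sub>m (dim_row A) (dim_col A))"

definition colsp :: "real mat \<Rightarrow> real vec set" where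
  "colsp M = {M *\<^sub>v c | c. c \<in> carrier_vec (dim_col M)}"

definition proj_range :: "real mat \<Rightarrow> real vec \<Rightarrow> real vec" where
  "proj_range M v = (THE w. w \<in> colsp M \<and> (\<forall>u\<in>colsp M. (v - w) \<bullet> u = 0))"

definition minnorm :: "real mat \<Rightarrow> real vec \<Rightarrow> real vec" where
  "minnorm X y = transpose_mat X *\<^sub>v (minv (X * transpose_mat X) *\<^sub>v y)"

text \<open>Task A data: rows x_i = W z_i + u_i (Z is n x d, U is n x p), so X_A = Z W^T + U,
  and y = Z theta.\<close>
definition XA :: "nat \<Rightarrow> nat \<Rightarrow> nat \<Rightarrow> real mat \<Rightarrow> (nat \<times> nat \<Rightarrow> real) \<Rightarrow> (nat \<times> nat \<Rightarrow> real) \<Rightarrow> real mat" where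
  "XA d n p W Z U = fmat n d Z * transpose_mat W + fmat n p U"

definition yA :: "nat \<Rightarrow> nat \<Rightarrow> real vec \<Rightarrow> (nat \<times> nat \<Rightarrow> real) \<Rightarrow> real vec" where
  "yA d n \<theta> Z = fmat n d Z *\<^sub>v \<theta>"

definition beta_A :: "nat \<Rightarrow> nat \<Rightarrow> nat \<Rightarrow> real mat \<Rightarrow> real vec \<Rightarrow> (nat \<times> nat \<Rightarrow> real) \<Rightarrow> (nat \<times> nat \<Rightarrow> real) \<Rightarrow> real vec" where
  "beta_A d n p W \<theta> Z U = minnorm (XA d n p W Z U) (yA d n \<theta> Z)"

definition beta_B :: "nat \<Rightarrow> nat \<Rightarrow> nat \<Rightarrow> real mat \<Rightarrow> real vec \<Rightarrow> (nat \<times> nat \<Rightarrow> real) \<Rightarrow> (nat \<times> nat \<Rightarrow> real) \<Rightarrow> (nat \<times> nat \<Rightarrow> real) \<Rightarrow> real vec" where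
  "beta_B d n p W \<theta> Z U Om = minnorm (XA d n p W Z U * transpose_mat (fmat p p Om)) (yA d n \<theta> Z)"

definition beta_BA :: "nat \<Rightarrow> nat \<Rightarrow> nat \<Rightarrow> real mat \<Rightarrow> real vec \<Rightarrow> (nat \<times> nat \<Rightarrow> real) \<Rightarrow> (nat \<times> nat \<Rightarrow> real) \<Rightarrow> (nat \<times> nat \<Rightarrow> real) \<Rightarrow> real vec" where
  "beta_BA d n p W \<theta> Z U Om =
     beta_A d n p W \<theta> Z U + beta_B d n p W \<theta> Z U Om
     - proj_range (transpose_mat (XA d n p W Z U * transpose_mat (fmat p p Om))) (beta_A d n p W \<theta> Z U)"

definition risk :: "nat \<Rightarrow> nat \<Rightarrow> real mat \<Rightarrow> real vec \<Rightarrow> real vec \<Rightarrow> real" where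
  "risk d p W \<theta> b =
     (\<integral>zu. (((W *\<^sub>v vec d (fst zu) + vec p (snd zu)) \<bullet> b) - vec d (fst zu) \<bullet> \<theta>)\<^sup>2
        \<partial>(gauss_fn {..<d} \<Otimes>\<^sub>M gauss_fn {..<p}))"

definition data_space :: "nat \<Rightarrow> nat \<Rightarrow> nat \<Rightarrow> (nat \<times> nat \<Rightarrow> real) measure
     \<Rightarrow> (((nat \<times> nat \<Rightarrow> real) \<times> (nat \<times> nat \<Rightarrow> real)) \<times> (nat \<times> nat \<Rightarrow> real)) measure" where
  "data_space d n p H =
     (gauss_fn ({..<n} \<times> {..<d}) \<Otimes>\<^sub>M gauss_fn ({..<n} \<times> {..<p})) \<Otimes>\<^sub>M H"

end

(*
  Write b for the task-A interpolator and q for the projection of b onto the row space of task B.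
  Since X_B = X_A O^T, the task-B interpolator is O b, so the sequential estimator is b + O b - q,
  with b - q orthogonal to O b.  The risk is |W^T b - theta|^2 + |b|^2, hence the increment is
  controlled by sqrt(p gamma) |b|, by |W^T O b| and by |q|.

  |W^T O b| and |q| are correlations of a Haar-rotated vector with a fixed subspace of dimension at
  most n.  By left invariance of the Haar measure the vector may be averaged over a Gaussian one, and the
  rotation then drops out: what remains is a chi-square tail for a Gaussian vector and a fixed subspace.

  The norm of b is controlled in the same way.  From b = X^T c and X b = Z theta one gets
  b = (|b|^2 / |theta|^2) W theta + W a + U^T c with a orthogonal to theta, so |b|^2 <= |theta|^2 / (t p gamma)
  as soon as the squared distance of W theta to the span of the rows of U and of the W a is at least
  t |W theta|^2.  The law of U is invariant under reflections of the rows, so W theta may again be replaced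
  by a Gaussian vector, after projecting out the W a.

  If X X^T is singular, minv is 0 and all estimators vanish, so that case is harmless.
*)
theory Submission
  imports Defs "Jordan_Normal_Form.Determinant"
begin

text \<open>Two obstacles shape the proof. Haar measure is given by left invariance alone: this
  allows \<open>b\<close> to be exchanged in \<open>O^T b\<close> but does not reach
  \<open>b\<close> in \<open>O b\<close>, so the bound on W^T O b passes through a second,
  independent copy of O. And the estimators contain a matrix inverse and a projection defined by
  description. Their measurability is bypassed: the exceptional events are written with an
  existential over coefficients, which makes them open, and the interpolator enters them rescaled by
  a determinant. Only reflections are used, never general rotations: one reflection carries a vector
  to any other of the same length, and homogeneity of the events takes care of lengths. Constants:
  up to exponentially small probability a Gaussian vector in dimension p has squared length above
  p/2 and squared projection onto r dimensions below 2r, whence the correlation level 2 sqrt(r/p).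
  For r = n + d \<le> 2n and p \<ge> 17n its square is at most 8/17, so the relative squared
  distance of W theta is at least 9/17, and |b|^2 \<le> (17/9) |theta|^2 / (p gamma).\<close>

no_notation inner (infix "\<bullet>" 70)
no_notation vec_nth (infixl "$" 90)

section \<open>Reflection invariance of Gaussian vectors\<close>

abbreviation lebesgue_fn :: "'i set \<Rightarrow> ('i \<Rightarrow> real) measure" where
  "lebesgue_fn I \<equiv> PiM I (\<lambda>_. lborel)"

interpretation lebesgue_prod: product_sigma_finite "\<lambda>_::'i. lborel :: real measure"
  by standard

interpretation gauss_prod: product_sigma_finite "\<lambda>_::'i. density lborel std_normal_density"
  by (intro product_sigma_finite.intro prob_space_imp_sigma_finite prob_space_normal_density) simp

lemma prob_space_gauss_fn: "prob_space (gauss_fn I)"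
  unfolding gauss_fn_def by (intro prob_space_PiM prob_space_normal_density) simp

lemma sets_gauss_fn [measurable_cong]: "sets (gauss_fn I) = sets (lebesgue_fn I)"
  unfolding gauss_fn_def by (intro sets_PiM_cong) auto

lemma space_gauss_fn: "space (gauss_fn I) = space (lebesgue_fn I)"
  by (rule sets_eq_imp_space_eq[OF sets_gauss_fn])

lemma space_lebesgue_fn: "space (lebesgue_fn I) = extensional I"
  by (auto simp: space_PiM PiE_def)

text \<open>Reflection invariance is going to be a change of variables for Lebesgue measure, so the
  product of one-dimensional Gaussian laws is turned into a single density. The two measures are
  compared on boxes, where the integral factors.\<close>

lemma gauss_fn_density:
  assumes "finite I"
  shows "gauss_fn I = density (lebesgue_fn I) (\<lambda>x. \<Prod>i\<in>I. ennreal (std_normal_density (x i)))"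
proof -
  have "density (lebesgue_fn I) (\<lambda>x. \<Prod>i\<in>I. ennreal (std_normal_density (x i))) = gauss_fn I"
    unfolding gauss_fn_def
  proof (rule gauss_prod.PiM_eqI[OF assms])
    show "sets (density (lebesgue_fn I) (\<lambda>x. \<Prod>i\<in>I. ennreal (std_normal_density (x i)))) =
      sets (PiM I (\<lambda>i. density lborel (\<lambda>x. ennreal (std_normal_density x))))"
      using sets_gauss_fn[of I] unfolding gauss_fn_def by simp
  next
    fix A :: "'a \<Rightarrow> real set"
    assume "\<And>i. i \<in> I \<Longrightarrow> A i \<in> sets (density lborel (\<lambda>x. ennreal (std_normal_density x)))"
    then have A: "\<And>i. i \<in> I \<Longrightarrow> A i \<in> sets borel" by simp
    have AP: "Pi\<^sub>E I A \<in> sets (lebesgue_fn I)"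
      using A assms by (intro sets_PiM_I_finite) auto
    have "emeasure (density (lebesgue_fn I) (\<lambda>x. \<Prod>i\<in>I. ennreal (std_normal_density (x i)))) (Pi\<^sub>E I A)
       = (\<integral>\<^sup>+x. (\<Prod>i\<in>I. ennreal (std_normal_density (x i))) * indicator (Pi\<^sub>E I A) x \<partial>lebesgue_fn I)"
      using AP assms by (subst emeasure_density) auto
    also have "\<dots> = (\<integral>\<^sup>+x. (\<Prod>i\<in>I. ennreal (std_normal_density (x i)) * indicator (A i) (x i)) \<partial>lebesgue_fn I)"
    proof (rule nn_integral_cong)
      fix x :: "'a \<Rightarrow> real" assume "x \<in> space (lebesgue_fn I)"
      \<comment> \<open>Membership in \<open>Pi\<^sub>E I A\<close> also demands extensionality; the
        underlying space supplies it, so that only the coordinates in \<open>I\<close> are left to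
        test.\<close>
      then have "x \<in> extensional I" by (simp add: space_lebesgue_fn)
      then have "indicator (Pi\<^sub>E I A) x = (\<Prod>i\<in>I. indicator (A i) (x i) :: ennreal)"
        using assms by (auto simp: indicator_def PiE_def Pi_def)
      then show "(\<Prod>i\<in>I. ennreal (std_normal_density (x i))) * indicator (Pi\<^sub>E I A) x =
         (\<Prod>i\<in>I. ennreal (std_normal_density (x i)) * indicator (A i) (x i))"
        by (simp add: prod.distrib)
    qed
    also have "\<dots> = (\<Prod>i\<in>I. \<integral>\<^sup>+x. ennreal (std_normal_density x) * indicator (A i) x \<partial>lborel)"
      using A assms by (intro lebesgue_prod.product_nn_integral_prod) auto
    also have "\<dots> = (\<Prod>i\<in>I. emeasure (density lborel std_normal_density) (A i))"
      using A by (intro prod.cong refl, subst emeasure_density) auto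
    finally show "emeasure (density (lebesgue_fn I) (\<lambda>x. \<Prod>i\<in>I. ennreal (std_normal_density (x i)))) (Pi\<^sub>E I A) =
       (\<Prod>i\<in>I. emeasure (density lborel std_normal_density) (A i))" .
  qed
  then show ?thesis ..
qed

text \<open>In this form the density is visibly a function of the squared length, the quantity that
  a reflection preserves.\<close>

lemma prod_std_normal_density:
  assumes "finite I"
  shows "(\<Prod>i\<in>I. ennreal (std_normal_density (x i))) =
    ennreal ((1 / sqrt (2 * pi)) ^ card I * exp (- (\<Sum>i\<in>I. (x i)\<^sup>2) / 2))"
proof -
  have "(\<Prod>i\<in>I. ennreal (std_normal_density (x i))) = ennreal (\<Prod>i\<in>I. std_normal_density (x i))"
    by (rule prod_ennreal) simp
  also have "(\<Prod>i\<in>I. std_normal_density (x i)) =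
     (1 / sqrt (2 * pi)) ^ card I * (\<Prod>i\<in>I. exp (- (x i)\<^sup>2 / 2))"
    by (simp add: std_normal_density_def prod.distrib prod_dividef power_divide)
  also have "(\<Prod>i\<in>I. exp (- (x i)\<^sup>2 / 2)) = exp (- (\<Sum>i\<in>I. (x i)\<^sup>2) / 2)"
    using assms by (simp add: exp_sum[symmetric] sum_negf sum_divide_distrib)
  finally show ?thesis .
qed

lemma distr_lebesgue_fn_translate:
  assumes "finite I"
  shows "distr (lebesgue_fn I) (lebesgue_fn I) (\<lambda>x. \<lambda>i\<in>I. x i + v i) = lebesgue_fn I"
proof (rule lebesgue_prod.PiM_eqI[OF assms])
  fix A :: "'a \<Rightarrow> real set"
  assume A: "\<And>i. i \<in> I \<Longrightarrow> A i \<in> sets lborel"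
  have m: "(\<lambda>x. \<lambda>i\<in>I. x i + v i) \<in> measurable (lebesgue_fn I) (lebesgue_fn I)"
    by (intro measurable_restrict) auto
  have AP: "Pi\<^sub>E I A \<in> sets (lebesgue_fn I)"
    using A assms by (intro sets_PiM_I_finite) auto
  have eq: "(\<lambda>x. \<lambda>i\<in>I. x i + v i) -` Pi\<^sub>E I A \<inter> space (lebesgue_fn I) =
     Pi\<^sub>E I (\<lambda>i. (\<lambda>t. v i + t) -` A i \<inter> space lborel)"
    by (auto simp: space_lebesgue_fn PiE_def Pi_def add.commute)
  have "emeasure (distr (lebesgue_fn I) (lebesgue_fn I) (\<lambda>x. \<lambda>i\<in>I. x i + v i)) (Pi\<^sub>E I A) =
     emeasure (lebesgue_fn I) (Pi\<^sub>E I (\<lambda>i. (\<lambda>t. v i + t) -` A i \<inter> space lborel))"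
    unfolding eq[symmetric] by (rule emeasure_distr[OF m AP])
  also have "\<dots> = (\<Prod>i\<in>I. emeasure lborel ((\<lambda>t. v i + t) -` A i \<inter> space lborel))"
    using A assms by (intro lebesgue_prod.emeasure_PiM measurable_sets[of _ lborel lborel]) auto
  also have "\<dots> = (\<Prod>i\<in>I. emeasure lborel (A i))"
  proof (rule prod.cong[OF refl])
    fix i assume "i \<in> I"
    have "emeasure lborel ((\<lambda>t. v i + t) -` A i \<inter> space lborel) =
       emeasure (distr lborel borel (\<lambda>t. v i + t)) (A i)"
      using A[OF \<open>i \<in> I\<close>] by (subst emeasure_distr) auto
    then show "emeasure lborel ((\<lambda>t. v i + t) -` A i \<inter> space lborel) = emeasure lborel (A i)"
      by (simp add: lborel_distr_plus)
  qed
  finally show "emeasure (distr (lebesgue_fn I) (lebesgue_fn I) (\<lambda>x. \<lambda>i\<in>I. x i + v i)) (Pi\<^sub>E I A)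
    = (\<Prod>i\<in>I. emeasure lborel (A i))" .
qed simp

lemma nn_integral_lebesgue_fn_translate:
  assumes "finite I" "f \<in> borel_measurable (lebesgue_fn I)"
  shows "(\<integral>\<^sup>+x. f (\<lambda>i\<in>I. x i + v i) \<partial>lebesgue_fn I) = (\<integral>\<^sup>+x. f x \<partial>lebesgue_fn I)"
proof -
  have "(\<integral>\<^sup>+x. f x \<partial>lebesgue_fn I) =
    (\<integral>\<^sup>+x. f x \<partial>distr (lebesgue_fn I) (lebesgue_fn I) (\<lambda>x. \<lambda>i\<in>I. x i + v i))"
    by (simp only: distr_lebesgue_fn_translate[OF assms(1)])
  also have "\<dots> = (\<integral>\<^sup>+x. f (\<lambda>i\<in>I. x i + v i) \<partial>lebesgue_fn I)"
    by (rule nn_integral_distr) (intro measurable_restrict, use assms(2) in auto)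
  finally show ?thesis ..
qed

text \<open>For a unit vector \<open>a\<close> this is the reflection in the hyperplane orthogonal
  to \<open>a\<close>. The index set is left arbitrary because a whole matrix, indexed by pairs, is
  later treated as one vector.\<close>

definition reflect :: "'i set \<Rightarrow> ('i \<Rightarrow> real) \<Rightarrow> ('i \<Rightarrow> real) \<Rightarrow> 'i \<Rightarrow> real" where
  "reflect I a x = (\<lambda>i\<in>I. x i - 2 * (\<Sum>k\<in>I. a k * x k) * a i)"

lemma measurable_reflect [measurable]:
  "reflect I a \<in> measurable (lebesgue_fn I) (lebesgue_fn I)"
  unfolding reflect_def by (intro measurable_restrict) measurable

text \<open>Near a coordinate \<open>i\<close> with \<open>a i \<noteq> 0\<close> replace \<open>x i\<close> by \<open>t = \<Sum>k. a k * x k\<close>; in these coordinates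
  the reflection is \<open>t \<mapsto> -t\<close> together with a translation of the remaining coordinates.\<close>
lemma nn_integral_lebesgue_fn_reflect:
  assumes fin: "finite I" and a: "(\<Sum>i\<in>I. (a i)\<^sup>2) = 1"
    and f[measurable]: "f \<in> borel_measurable (lebesgue_fn I)"
  shows "(\<integral>\<^sup>+x. f (reflect I a x) \<partial>lebesgue_fn I) = (\<integral>\<^sup>+x. f x \<partial>lebesgue_fn I)"
proof -
  obtain i where i: "i \<in> I" "a i \<noteq> 0"
  proof (rule ccontr)
    assume "\<not> thesis"
    then have "\<And>i. i \<in> I \<Longrightarrow> a i = 0" using that by blast
    then show False using a by simp
  qed
  define J where "J = I - {i}"
  have J: "I = insert i J" "finite J" "i \<notin> J" using i fin by (auto simp: J_def)
  define s where "s x = (\<Sum>k\<in>J. a k * x k)" for x :: "'a \<Rightarrow> real"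
  \<comment> \<open>\<open>S t x\<close> extends \<open>x\<close> from \<open>J\<close> to
    \<open>I\<close> so that the inner product with \<open>a\<close> becomes
    \<open>t\<close>.\<close>
  define S where "S t x = x(i := (t - s x) / a i)" for t x
  have s_meas[measurable]: "s \<in> borel_measurable (lebesgue_fn J)"
    unfolding s_def by measurable
  have S_meas: "(\<lambda>(t, x). S t x) \<in> measurable (borel \<Otimes>\<^sub>M lebesgue_fn J) (lebesgue_fn I)"
  proof -
    have "(\<lambda>w. (snd w)(i := (fst w - s (snd w)) / a i)) \<in> measurable (borel \<Otimes>\<^sub>M lebesgue_fn J) (lebesgue_fn I)"
      by (rule measurable_fun_upd[where J = J and M = "\<lambda>_. lborel"]) (use J(1) in auto)
    then show ?thesis by (simp add: S_def split_beta)
  qed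
  have S_meas'[measurable]: "S t \<in> measurable (lebesgue_fn J) (lebesgue_fn I)" for t
    using measurable_compose[OF measurable_Pair1'[of t borel] S_meas] by simp
  have S_meas2[measurable (raw)]: "(\<lambda>w. S (g w) (h w)) \<in> measurable M (lebesgue_fn I)"
    if "g \<in> borel_measurable M" "h \<in> measurable M (lebesgue_fn J)" for g h and M :: "'z measure"
    using measurable_compose[OF measurable_Pair[OF that] S_meas] by simp
  have R_meas[measurable]: "reflect I a \<in> measurable (lebesgue_fn I) (lebesgue_fn I)"
    by (rule measurable_reflect)
  have aJ: "(\<Sum>k\<in>J. (a k)\<^sup>2) = 1 - (a i)\<^sup>2" using a J by simp
  \<comment> \<open>An affine substitution in coordinate \<open>i\<close> produces the factor
    \<open>\<bar>1 / a i\<bar>\<close>, and Fubini moves the \<open>t\<close> integral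
    outside.\<close>
  have coord: "(\<integral>\<^sup>+x. g x \<partial>lebesgue_fn I) =
      ennreal \<bar>1 / a i\<bar> * (\<integral>\<^sup>+t. (\<integral>\<^sup>+x. g (S t x) \<partial>lebesgue_fn J) \<partial>lborel)"
    if g[measurable]: "g \<in> borel_measurable (lebesgue_fn I)" for g
  proof -
    have upd[measurable]: "(\<lambda>y. g (x(i := y))) \<in> borel_measurable borel" if "x \<in> space (lebesgue_fn J)" for x
    proof -
      have "(\<lambda>y. x(i := y)) \<in> measurable lborel (lebesgue_fn I)"
        unfolding J(1) using measurable_component_update[OF that J(3)] by simp
      from measurable_compose[OF this g] show ?thesis by simp
    qed
    have "(\<integral>\<^sup>+x. g x \<partial>lebesgue_fn I) = (\<integral>\<^sup>+x. (\<integral>\<^sup>+y. g (x(i := y)) \<partial>lborel) \<partial>lebesgue_fn J)"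
      using lebesgue_prod.product_nn_integral_insert[OF J(2,3), of g] J(1) g by simp
    also have "\<dots> = (\<integral>\<^sup>+x. ennreal \<bar>1 / a i\<bar> * (\<integral>\<^sup>+t. g (S t x) \<partial>lborel) \<partial>lebesgue_fn J)"
    proof (rule nn_integral_cong)
      fix x :: "'a \<Rightarrow> real" assume x: "x \<in> space (lebesgue_fn J)"
      have "(\<integral>\<^sup>+y. g (x(i := y)) \<partial>lborel) =
         ennreal \<bar>1 / a i\<bar> * (\<integral>\<^sup>+t. g (x(i := - s x / a i + 1 / a i * t)) \<partial>lborel)"
        using i upd[OF x] by (intro nn_integral_real_affine) auto
      also have "(\<lambda>t. g (x(i := - s x / a i + 1 / a i * t))) = (\<lambda>t. g (S t x))"
        by (simp add: S_def diff_divide_distrib)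
      finally show "(\<integral>\<^sup>+y. g (x(i := y)) \<partial>lborel) = ennreal \<bar>1 / a i\<bar> * (\<integral>\<^sup>+t. g (S t x) \<partial>lborel)" .
    qed
    also have "\<dots> = ennreal \<bar>1 / a i\<bar> * (\<integral>\<^sup>+x. (\<integral>\<^sup>+t. g (S t x) \<partial>lborel) \<partial>lebesgue_fn J)"
      by (intro nn_integral_cmult) measurable
    also have "(\<integral>\<^sup>+x. (\<integral>\<^sup>+t. g (S t x) \<partial>lborel) \<partial>lebesgue_fn J) = (\<integral>\<^sup>+t. (\<integral>\<^sup>+x. g (S t x) \<partial>lebesgue_fn J) \<partial>lborel)"
      using lebesgue_prod.sigma_finite[OF J(2)] lborel.sigma_finite_measure_axioms
      by (intro pair_sigma_finite.Fubini' pair_sigma_finite.intro) (auto, measurable)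
    finally show ?thesis .
  qed
  \<comment> \<open>The reflection negates \<open>t\<close> and shifts each \<open>x j\<close> with
    \<open>j\<close> in \<open>J\<close> by \<open>- 2 * t * a j\<close>. That coordinate
    \<open>i\<close> also comes out right is due to the unit length of \<open>a\<close>, through
    \<open>aJ\<close>.\<close>
  have key: "reflect I a (S t x) = S (- t) (\<lambda>j\<in>J. x j + (- 2 * t * a j))"
    if "x \<in> space (lebesgue_fn J)" for t x
  proof -
    have x: "x \<in> extensional J" using that by (simp add: space_lebesgue_fn)
    have dot: "(\<Sum>k\<in>I. a k * S t x k) = t"
    proof -
      have "(\<Sum>k\<in>I. a k * S t x k) = a i * S t x i + (\<Sum>k\<in>J. a k * S t x k)"
        using J by simp
      also have "(\<Sum>k\<in>J. a k * S t x k) = s x"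
        unfolding s_def S_def using J by (intro sum.cong) auto
      finally show ?thesis using i by (simp add: S_def)
    qed
    have "s (\<lambda>j\<in>J. x j + (- 2 * t * a j)) = (\<Sum>k\<in>J. a k * x k) - 2 * t * (\<Sum>k\<in>J. (a k)\<^sup>2)"
      unfolding s_def sum_distrib_left sum_subtractf[symmetric]
      by (intro sum.cong) (auto simp: algebra_simps power2_eq_square)
    then have sx: "s (\<lambda>j\<in>J. x j + (- 2 * t * a j)) = s x - 2 * t * (1 - (a i)\<^sup>2)"
      by (simp add: aJ s_def)
    show ?thesis
    proof
      fix j
      consider "j = i" | "j \<in> J" | "j \<notin> I" using J by auto
      then show "reflect I a (S t x) j = S (- t) (\<lambda>j\<in>J. x j + (- 2 * t * a j)) j"
      proof cases
        case 1
        have "reflect I a (S t x) j = (t - s x) / a i - 2 * t * a i"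
          using 1 i unfolding reflect_def dot by (simp add: S_def)
        also have "\<dots> = (- t - (s x - 2 * t * (1 - (a i)\<^sup>2))) / a i"
          using i by (simp add: field_simps power2_eq_square)
        also have "\<dots> = S (- t) (\<lambda>j\<in>J. x j + (- 2 * t * a j)) j"
          unfolding S_def sx using 1 by simp
        finally show ?thesis .
      next
        case 2
        then show ?thesis using J unfolding reflect_def dot by (auto simp: S_def)
      next
        case 3
        then show ?thesis using J unfolding reflect_def by (auto simp: S_def)
      qed
    qed
  qed
  have "(\<integral>\<^sup>+x. f (reflect I a x) \<partial>lebesgue_fn I) =
      ennreal \<bar>1 / a i\<bar> * (\<integral>\<^sup>+t. (\<integral>\<^sup>+x. f (reflect I a (S t x)) \<partial>lebesgue_fn J) \<partial>lborel)"
    by (rule coord) measurable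
  also have "(\<lambda>t. \<integral>\<^sup>+x. f (reflect I a (S t x)) \<partial>lebesgue_fn J) = (\<lambda>t. \<integral>\<^sup>+x. f (S (- t) x) \<partial>lebesgue_fn J)"
  proof
    fix t
    have "(\<integral>\<^sup>+x. f (reflect I a (S t x)) \<partial>lebesgue_fn J) =
       (\<integral>\<^sup>+x. f (S (- t) (\<lambda>j\<in>J. x j + (- 2 * t * a j))) \<partial>lebesgue_fn J)"
      by (intro nn_integral_cong) (simp only: key)
    also have "\<dots> = (\<integral>\<^sup>+x. f (S (- t) x) \<partial>lebesgue_fn J)"
      by (rule nn_integral_lebesgue_fn_translate[OF J(2)]) measurable
    finally show "(\<integral>\<^sup>+x. f (reflect I a (S t x)) \<partial>lebesgue_fn J) = (\<integral>\<^sup>+x. f (S (- t) x) \<partial>lebesgue_fn J)" .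
  qed
  also have "(\<integral>\<^sup>+t. (\<integral>\<^sup>+x. f (S (- t) x) \<partial>lebesgue_fn J) \<partial>lborel) = (\<integral>\<^sup>+t. (\<integral>\<^sup>+x. f (S t x) \<partial>lebesgue_fn J) \<partial>lborel)"
  proof -
    interpret sigma_finite_measure "lebesgue_fn J" by (rule lebesgue_prod.sigma_finite[OF J(2)])
    have [measurable]: "(\<lambda>t. \<integral>\<^sup>+x. f (S t x) \<partial>lebesgue_fn J) \<in> borel_measurable borel"
      by measurable
    show ?thesis
      using nn_integral_real_affine[of "\<lambda>t. \<integral>\<^sup>+x. f (S t x) \<partial>lebesgue_fn J" "-1" 0] by simp
  qed
  also have "ennreal \<bar>1 / a i\<bar> * \<dots> = (\<integral>\<^sup>+x. f x \<partial>lebesgue_fn I)"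
    by (rule coord[symmetric]) measurable
  finally show ?thesis .
qed

lemma sum_reflect_power2:
  assumes fin: "finite I" and a: "(\<Sum>i\<in>I. (a i)\<^sup>2) = 1"
  shows "(\<Sum>i\<in>I. (reflect I a x i)\<^sup>2) = (\<Sum>i\<in>I. (x i)\<^sup>2)"
proof -
  define t where "t = (\<Sum>k\<in>I. a k * x k)"
  have "(\<Sum>i\<in>I. (reflect I a x i)\<^sup>2) = (\<Sum>i\<in>I. (x i)\<^sup>2 + (4 * t\<^sup>2 * (a i)\<^sup>2 - 4 * t * (a i * x i)))"
    by (intro sum.cong) (auto simp: reflect_def t_def[symmetric] power2_eq_square algebra_simps)
  also have "\<dots> = (\<Sum>i\<in>I. (x i)\<^sup>2)"
    by (simp add: sum.distrib sum_subtractf sum_distrib_left[symmetric] a t_def[symmetric])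
       (simp add: power2_eq_square)
  finally show ?thesis .
qed

text \<open>Both factors of the Gaussian law are invariant: Lebesgue measure by the change of
  variables, and the density because it depends on the length alone.\<close>

lemma distr_gauss_fn_reflect:
  assumes fin: "finite I" and a: "(\<Sum>i\<in>I. (a i)\<^sup>2) = 1"
  shows "distr (gauss_fn I) (gauss_fn I) (reflect I a) = gauss_fn I"
proof (rule measure_eqI)
  fix A assume "A \<in> sets (distr (gauss_fn I) (gauss_fn I) (reflect I a))"
  then have A[measurable]: "A \<in> sets (lebesgue_fn I)" by (simp add: sets_gauss_fn)
  define D where "D x = (\<Prod>i\<in>I. ennreal (std_normal_density (x i)))" for x :: "'a \<Rightarrow> real"
  have D[measurable]: "D \<in> borel_measurable (lebesgue_fn I)"
    unfolding D_def by measurable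
  have DR: "D (reflect I a x) = D x" for x
    unfolding D_def prod_std_normal_density[OF fin] sum_reflect_power2[OF fin a] ..
  have R: "reflect I a \<in> measurable (gauss_fn I) (gauss_fn I)" by measurable
  have "emeasure (distr (gauss_fn I) (gauss_fn I) (reflect I a)) A =
      emeasure (gauss_fn I) (reflect I a -` A \<inter> space (lebesgue_fn I))"
    using emeasure_distr[OF R] A by (simp add: sets_gauss_fn space_gauss_fn)
  also have "\<dots> = (\<integral>\<^sup>+x. D x * indicator (reflect I a -` A \<inter> space (lebesgue_fn I)) x \<partial>lebesgue_fn I)"
    unfolding gauss_fn_density[OF fin] D_def[symmetric]
    by (intro emeasure_density D measurable_sets[OF measurable_reflect A])
  also have "\<dots> = (\<integral>\<^sup>+x. D (reflect I a x) * indicator A (reflect I a x) \<partial>lebesgue_fn I)"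
    by (intro nn_integral_cong) (auto simp: DR indicator_def)
  also have "\<dots> = (\<integral>\<^sup>+x. D x * indicator A x \<partial>lebesgue_fn I)"
    by (rule nn_integral_lebesgue_fn_reflect[OF fin a]) measurable
  also have "\<dots> = emeasure (gauss_fn I) A"
    unfolding gauss_fn_density[OF fin] D_def[symmetric] by (subst emeasure_density[OF D A]) simp
  finally show "emeasure (distr (gauss_fn I) (gauss_fn I) (reflect I a)) A = emeasure (gauss_fn I) A" .
qed simp

section \<open>Gaussian vectors and fixed subspaces\<close>

lemma nn_integral_std_normal_exp:
  "(\<integral>\<^sup>+x. ennreal (exp (a * x)) \<partial>density lborel std_normal_density) = ennreal (exp (a\<^sup>2 / 2))"
proof -
  have "(\<integral>\<^sup>+x. ennreal (exp (a * x)) \<partial>density lborel std_normal_density) =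
     (\<integral>\<^sup>+x. ennreal (exp (a\<^sup>2 / 2)) * ennreal (normal_density a 1 x) \<partial>lborel)"
    by (subst nn_integral_density)
       (auto intro!: nn_integral_cong simp: normal_density_def ennreal_mult[symmetric] exp_add[symmetric]
         power2_eq_square field_simps)
  also have "\<dots> = ennreal (exp (a\<^sup>2 / 2)) * (\<integral>\<^sup>+x. ennreal (normal_density a 1 x) \<partial>lborel)"
    by (rule nn_integral_cmult) auto
  also have "(\<integral>\<^sup>+x. ennreal (normal_density a 1 x) \<partial>lborel) = 1"
    by (subst nn_integral_eq_integral) auto
  finally show ?thesis by simp
qed

text \<open>Absorbing the exponential leaves a normal density of standard deviation
  \<open>1 / r\<close> with \<open>r\<^sup>2 = 1 - 2 * t\<close>. This is the moment generating
  function of a chi-square variable with one degree of freedom.\<close>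

lemma nn_integral_std_normal_exp_power2:
  fixes t :: real assumes "t < 1 / 2"
  shows "(\<integral>\<^sup>+x. ennreal (exp (t * x\<^sup>2)) \<partial>density lborel std_normal_density) = ennreal (1 / sqrt (1 - 2 * t))"
proof -
  define r where "r = sqrt (1 - 2 * t)"
  have r: "r > 0" "r\<^sup>2 = 1 - 2 * t" using assms by (auto simp: r_def)
  have eq: "std_normal_density x * exp (t * x\<^sup>2) = 1 / r * normal_density 0 (1 / r) x" for x
  proof -
    have "std_normal_density x * exp (t * x\<^sup>2) = 1 / sqrt (2 * pi) * exp (- (r\<^sup>2 * x\<^sup>2) / 2)"
      unfolding r(2) by (simp add: std_normal_density_def exp_add[symmetric] field_simps)
    also have "\<dots> = 1 / r * normal_density 0 (1 / r) x"
      using r(1) by (simp add: normal_density_def real_sqrt_divide real_sqrt_mult power_divide field_simps)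
    finally show ?thesis .
  qed
  have "(\<integral>\<^sup>+x. ennreal (exp (t * x\<^sup>2)) \<partial>density lborel std_normal_density) =
     (\<integral>\<^sup>+x. ennreal (1 / r) * ennreal (normal_density 0 (1 / r) x) \<partial>lborel)"
  proof (subst nn_integral_density)
    have "ennreal (std_normal_density x) * ennreal (exp (t * x\<^sup>2)) =
       ennreal (1 / r) * ennreal (normal_density 0 (1 / r) x)" for x
      using eq[of x] r(1) by (simp add: ennreal_mult[symmetric])
    then show "(\<integral>\<^sup>+x. ennreal (std_normal_density x) * ennreal (exp (t * x\<^sup>2)) \<partial>lborel) =
       (\<integral>\<^sup>+x. ennreal (1 / r) * ennreal (normal_density 0 (1 / r) x) \<partial>lborel)" by simp
  qed auto
  also have "\<dots> = ennreal (1 / r) * (\<integral>\<^sup>+x. ennreal (normal_density 0 (1 / r) x) \<partial>lborel)"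
    by (rule nn_integral_cmult) auto
  also have "(\<integral>\<^sup>+x. ennreal (normal_density 0 (1 / r) x) \<partial>lborel) = 1"
    using r(1) by (subst nn_integral_eq_integral) auto
  finally show ?thesis by (simp add: r_def)
qed

lemma nn_integral_gauss_fn_exp:
  assumes "finite I"
  shows "(\<integral>\<^sup>+x. ennreal (exp (\<Sum>i\<in>I. a i * x i)) \<partial>gauss_fn I) = ennreal (exp ((\<Sum>i\<in>I. (a i)\<^sup>2) / 2))"
proof -
  have "(\<integral>\<^sup>+x. ennreal (exp (\<Sum>i\<in>I. a i * x i)) \<partial>gauss_fn I) =
     (\<integral>\<^sup>+x. (\<Prod>i\<in>I. ennreal (exp (a i * x i))) \<partial>gauss_fn I)"
    using assms by (simp add: exp_sum prod_ennreal)
  also have "\<dots> = (\<Prod>i\<in>I. ennreal (exp ((a i)\<^sup>2 / 2)))"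
    unfolding gauss_fn_def using assms
    by (subst gauss_prod.product_nn_integral_prod) (auto simp: nn_integral_std_normal_exp)
  also have "\<dots> = ennreal (exp ((\<Sum>i\<in>I. (a i)\<^sup>2) / 2))"
    using assms by (simp add: exp_sum prod_ennreal sum_divide_distrib)
  finally show ?thesis .
qed

lemma nn_integral_gauss_fn_exp_sum_power2:
  fixes t :: real assumes "finite I" "t < 1 / 2"
  shows "(\<integral>\<^sup>+x. ennreal (exp (t * (\<Sum>i\<in>I. (x i)\<^sup>2))) \<partial>gauss_fn I) = ennreal ((1 / sqrt (1 - 2 * t)) ^ card I)"
proof -
  have "(\<integral>\<^sup>+x. ennreal (exp (t * (\<Sum>i\<in>I. (x i)\<^sup>2))) \<partial>gauss_fn I) =
     (\<integral>\<^sup>+x. (\<Prod>i\<in>I. ennreal (exp (t * (x i)\<^sup>2))) \<partial>gauss_fn I)"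
    using assms by (simp add: exp_sum prod_ennreal sum_distrib_left)
  also have "\<dots> = (\<Prod>i\<in>I. ennreal (1 / sqrt (1 - 2 * t)))"
    unfolding gauss_fn_def using assms
    by (subst gauss_prod.product_nn_integral_prod) (auto simp: nn_integral_std_normal_exp_power2)
  also have "\<dots> = ennreal ((1 / sqrt (1 - 2 * t)) ^ card I)"
    using assms by (simp add: ennreal_power)
  finally show ?thesis .
qed

text \<open>Linearise the square with an auxiliary Gaussian vector \<open>k\<close>, \<open>exp (\<bar>v\<bar>\<^sup>2 / 4) = E (exp (k \<bullet> v / sqrt 2))\<close>,
  and integrate out \<open>h\<close> first.\<close>
lemma nn_integral_exp_orthonormal_coeffs:
  fixes a :: "nat \<Rightarrow> nat \<Rightarrow> real"
  assumes on: "\<And>k l. k < m \<Longrightarrow> l < m \<Longrightarrow> (\<Sum>j<p. a k j * a l j) = of_bool (k = l)"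
  shows "(\<integral>\<^sup>+h. ennreal (exp ((\<Sum>k<m. (\<Sum>j<p. a k j * h j)\<^sup>2) / 4)) \<partial>gauss_fn {..<p}) = ennreal (sqrt 2 ^ m)"
proof -
  interpret G: pair_sigma_finite "gauss_fn {..<p} :: (nat \<Rightarrow> real) measure" "gauss_fn {..<m} :: (nat \<Rightarrow> real) measure"
    using prob_space_gauss_fn by (auto intro!: pair_sigma_finite.intro prob_space_imp_sigma_finite)
  define v where "v h k = (\<Sum>j<p. a k j * h j) / sqrt 2" for h k
  define w where "w x j = (\<Sum>k<m. a k j * x k) / sqrt 2" for x j
  have meas: "(\<lambda>y. ennreal (exp (\<Sum>k<m. v (fst y) k * snd y k))) \<in>
     borel_measurable (gauss_fn {..<p} \<Otimes>\<^sub>M gauss_fn {..<m})"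
    unfolding v_def
    by measurable
  have "(\<integral>\<^sup>+h. ennreal (exp ((\<Sum>k<m. (\<Sum>j<p. a k j * h j)\<^sup>2) / 4)) \<partial>gauss_fn {..<p}) =
    (\<integral>\<^sup>+h. (\<integral>\<^sup>+x. ennreal (exp (\<Sum>k<m. v h k * x k)) \<partial>gauss_fn {..<m}) \<partial>gauss_fn {..<p})"
  proof (rule nn_integral_cong)
    fix h :: "nat \<Rightarrow> real"
    have "(\<Sum>k<m. (v h k)\<^sup>2) / 2 = (\<Sum>k<m. (\<Sum>j<p. a k j * h j)\<^sup>2) / 4"
      by (simp add: v_def power_divide sum_divide_distrib[symmetric])
    then show "ennreal (exp ((\<Sum>k<m. (\<Sum>j<p. a k j * h j)\<^sup>2) / 4)) =
       (\<integral>\<^sup>+x. ennreal (exp (\<Sum>k<m. v h k * x k)) \<partial>gauss_fn {..<m})"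
      by (simp add: nn_integral_gauss_fn_exp)
  qed
  also have "\<dots> = (\<integral>\<^sup>+x. (\<integral>\<^sup>+h. ennreal (exp (\<Sum>k<m. v h k * x k)) \<partial>gauss_fn {..<p}) \<partial>gauss_fn {..<m})"
    by (rule G.Fubini'[symmetric]) (use meas in \<open>simp add: split_beta\<close>)
  also have "\<dots> = (\<integral>\<^sup>+x. ennreal (exp (1/4 * (\<Sum>k<m. (x k)\<^sup>2))) \<partial>gauss_fn {..<m})"
  proof (rule nn_integral_cong)
    fix x :: "nat \<Rightarrow> real"
    have "(\<Sum>k<m. v h k * x k) = (\<Sum>j<p. w x j * h j)" for h
    proof -
      have "(\<Sum>k<m. v h k * x k) = (\<Sum>k<m. \<Sum>j<p. a k j * h j * x k / sqrt 2)"
        by (simp add: v_def sum_divide_distrib sum_distrib_right)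
      also have "\<dots> = (\<Sum>j<p. \<Sum>k<m. a k j * h j * x k / sqrt 2)" by (rule sum.swap)
      also have "\<dots> = (\<Sum>j<p. w x j * h j)"
        by (simp add: w_def sum_divide_distrib sum_distrib_left mult_ac)
      finally show ?thesis .
    qed
    then have "(\<integral>\<^sup>+h. ennreal (exp (\<Sum>k<m. v h k * x k)) \<partial>gauss_fn {..<p}) = ennreal (exp ((\<Sum>j<p. (w x j)\<^sup>2) / 2))"
      by (simp add: nn_integral_gauss_fn_exp)
    \<comment> \<open>Orthonormality kills the cross terms, so the ambient dimension
      \<open>p\<close> disappears. What remains is a chi-square exponent in \<open>m\<close>
      variables at parameter 1/4, each contributing a factor \<open>sqrt 2\<close>.\<close>
    also have "(\<Sum>j<p. (w x j)\<^sup>2) = (\<Sum>k<m. (x k)\<^sup>2) / 2"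
    proof -
      have "(\<Sum>j<p. (w x j)\<^sup>2) = (\<Sum>j<p. \<Sum>k<m. \<Sum>l<m. (a k j * a l j) * (x k * x l)) / 2"
        by (simp add: w_def power_divide power2_eq_square sum_product sum_divide_distrib mult_ac)
      also have "(\<Sum>j<p. \<Sum>k<m. \<Sum>l<m. (a k j * a l j) * (x k * x l)) =
         (\<Sum>k<m. \<Sum>l<m. \<Sum>j<p. (a k j * a l j) * (x k * x l))"
        by (rule trans[OF sum.swap], rule sum.cong[OF refl], rule sum.swap)
      also have "\<dots> = (\<Sum>k<m. \<Sum>l<m. of_bool (k = l) * (x k * x l))"
        by (intro sum.cong refl, subst sum_distrib_right[symmetric]) (simp add: on)
      also have "\<dots> = (\<Sum>k<m. (x k)\<^sup>2)"
        by (intro sum.cong refl) (simp add: power2_eq_square of_bool_def if_distrib[of "\<lambda>z. z * _"] cong: if_cong)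
      finally show ?thesis by simp
    qed
    finally show "(\<integral>\<^sup>+h. ennreal (exp (\<Sum>k<m. v h k * x k)) \<partial>gauss_fn {..<p}) =
      ennreal (exp (1/4 * (\<Sum>k<m. (x k)\<^sup>2)))" by simp
  qed
  also have "\<dots> = ennreal (sqrt 2 ^ m)"
    by (subst nn_integral_gauss_fn_exp_sum_power2) (auto simp: real_sqrt_divide)
  finally show ?thesis .
qed

text \<open>Chernoff's bound with the exponential parameter absorbed into \<open>f\<close>: positive
  multiples give upper tails, negative multiples lower tails.\<close>

lemma emeasure_exp_Markov:
  assumes f: "f \<in> borel_measurable M"
  shows "emeasure M {x \<in> space M. u \<le> f x} \<le> ennreal (exp (- u)) * (\<integral>\<^sup>+x. ennreal (exp (f x)) \<partial>M)"
proof -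
  have "{x \<in> space M. u \<le> f x} = {x \<in> space M. 1 \<le> ennreal (exp (- u)) * ennreal (exp (f x))}"
    by (auto simp: ennreal_mult[symmetric] exp_add[symmetric] ennreal_1[symmetric] simp del: ennreal_1)
  also have "emeasure M \<dots> \<le> ennreal (exp (- u)) * (\<integral>\<^sup>+x. ennreal (exp (f x)) * indicator (space M) x \<partial>M)"
    using f nn_integral_Markov_inequality[where M = M and u = "\<lambda>x. ennreal (exp (f x))" and A = "space M" and c = "ennreal (exp (- u))"]
    by simp
  also have "(\<integral>\<^sup>+x. ennreal (exp (f x)) * indicator (space M) x \<partial>M) = (\<integral>\<^sup>+x. ennreal (exp (f x)) \<partial>M)"
    by (intro nn_integral_cong) auto
  finally show ?thesis .
qed

text \<open>The first summand is the Chernoff bound, at parameter 1/4, for a chi-square variable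
  with at most \<open>r\<close> degrees of freedom to reach \<open>2 r\<close>. The second is the
  one, at parameter -1/2, for a chi-square variable with \<open>p\<close> degrees of freedom to stay
  at or below \<open>p / 2\<close>.\<close>

definition tail_bound :: "nat \<Rightarrow> nat \<Rightarrow> real" where
  "tail_bound r p = (2 / exp 1) powr (real r / 2) + (sqrt (exp 1) / 2) powr (real p / 2)"

text \<open>If the projection carries a share of at least \<open>4 r / p\<close> of the squared
  length, then either the squared projection is at least \<open>2 r\<close> or the squared length is
  at most \<open>p / 2\<close>. The union bound over these two events requires no independence
  between the projection and the length.\<close>

lemma gauss_fn_subspace_tail:
  fixes a :: "nat \<Rightarrow> nat \<Rightarrow> real"
  assumes on: "\<And>k l. k < m \<Longrightarrow> l < m \<Longrightarrow> (\<Sum>j<p. a k j * a l j) = of_bool (k = l)"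
    and m: "m \<le> r" and p: "0 < p"
  shows "emeasure (gauss_fn {..<p})
      {h \<in> space (gauss_fn {..<p}). 4 * real r / real p * (\<Sum>j<p. (h j)\<^sup>2) \<le> (\<Sum>k<m. (\<Sum>j<p. a k j * h j)\<^sup>2)}
     \<le> ennreal (tail_bound r p)"
proof -
  let ?M = "gauss_fn {..<p} :: (nat \<Rightarrow> real) measure"
  define A where "A h = (\<Sum>k<m. (\<Sum>j<p. a k j * h j)\<^sup>2)" for h :: "nat \<Rightarrow> real"
  define B where "B h = (\<Sum>j<p. (h j)\<^sup>2)" for h :: "nat \<Rightarrow> real"
  have [measurable]: "A \<in> borel_measurable ?M" "B \<in> borel_measurable ?M"
    unfolding A_def B_def by measurable
  have "{h \<in> space ?M. 4 * real r / real p * B h \<le> A h} \<subseteq>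
    {h \<in> space ?M. real r / 2 \<le> A h / 4} \<union> {h \<in> space ?M. - real p / 4 \<le> (- 1 / 2) * B h}" (is "?L \<subseteq> ?R1 \<union> ?R2")
  proof (intro subsetI UnCI)
    fix h assume h: "h \<in> ?L" and n: "h \<notin> ?R2"
    have "real p / 2 < B h" using h n by auto
    then have "2 * real r \<le> 4 * real r / real p * B h"
    proof -
      have "2 * real r = 4 * real r / real p * (real p / 2)" using p by simp
      also have "\<dots> \<le> 4 * real r / real p * B h" using \<open>real p / 2 < B h\<close> by (intro mult_left_mono) auto
      finally show ?thesis .
    qed
    then show "h \<in> ?R1" using h by auto
  qed
  then have "emeasure ?M ?L \<le> emeasure ?M (?R1 \<union> ?R2)"
    by (intro emeasure_mono) measurable
  also have "\<dots> \<le> emeasure ?M ?R1 + emeasure ?M ?R2"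
    by (rule emeasure_subadditive) measurable
  also have "\<dots> \<le> ennreal ((2 / exp 1) powr (real r / 2)) + ennreal ((sqrt (exp 1) / 2) powr (real p / 2))"
  proof (rule add_mono)
    have "emeasure ?M ?R1 \<le> ennreal (exp (- (real r / 2))) * (\<integral>\<^sup>+h. ennreal (exp (A h / 4)) \<partial>?M)"
      by (rule emeasure_exp_Markov) measurable
    also have "\<dots> = ennreal (exp (- (real r / 2)) * sqrt 2 ^ m)"
      unfolding A_def by (subst nn_integral_exp_orthonormal_coeffs[OF on]) (auto simp: ennreal_mult)
    also have "\<dots> \<le> ennreal (exp (- (real r / 2)) * sqrt 2 ^ r)"
      using m by (intro ennreal_leI mult_left_mono power_increasing) auto
    also have "exp (- (real r / 2)) * sqrt 2 ^ r = (2 / exp 1) powr (real r / 2)"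
    proof -
      have "sqrt 2 ^ r = 2 powr (real r / 2)"
        by (simp add: powr_half_sqrt[symmetric] powr_realpow[symmetric] powr_powr)
      then show ?thesis by (simp add: powr_divide exp_powr_real exp_minus field_simps)
    qed
    finally show "emeasure ?M ?R1 \<le> ennreal ((2 / exp 1) powr (real r / 2))" .
    have "emeasure ?M ?R2 \<le> ennreal (exp (- (- real p / 4))) * (\<integral>\<^sup>+h. ennreal (exp ((- 1 / 2) * B h)) \<partial>?M)"
      by (rule emeasure_exp_Markov) measurable
    also have "\<dots> = ennreal (exp (real p / 4) * (1 / sqrt 2) ^ p)"
      unfolding B_def by (subst nn_integral_gauss_fn_exp_sum_power2) (auto simp: ennreal_mult)
    also have "exp (real p / 4) * (1 / sqrt 2) ^ p = (sqrt (exp 1) / 2) powr (real p / 2)"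
    proof -
      have "sqrt 2 ^ p = 2 powr (real p / 2)" "sqrt (exp 1) = exp (1/2 :: real)"
        by (simp_all add: powr_half_sqrt[symmetric] powr_realpow[symmetric] powr_powr exp_powr_real)
      then show ?thesis by (simp add: powr_divide exp_powr_real power_divide)
    qed
    finally show "emeasure ?M ?R2 \<le> ennreal ((sqrt (exp 1) / 2) powr (real p / 2))" .
  qed
  also have "\<dots> = ennreal (tail_bound r p)"
    by (simp add: tail_bound_def)
  finally show ?thesis by (simp add: A_def B_def)
qed

section \<open>Euclidean norm, Gram-Schmidt, and correlation with a fixed row space\<close>

definition vnorm :: "real vec \<Rightarrow> real" where "vnorm v = sqrt (v \<bullet> v)"

lemma scalar_prod_sum_lessThan: "dim_vec y = n \<Longrightarrow> x \<bullet> y = (\<Sum>i<n. x $ i * y $ i)"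
  by (simp add: scalar_prod_def atLeast0LessThan)

lemma scalar_prod_self_nonneg [simp]: "0 \<le> (v :: real vec) \<bullet> v"
  by (simp add: scalar_prod_def sum_nonneg)

lemma scalar_prod_self_eq_0: "v \<in> carrier_vec n \<Longrightarrow> (v :: real vec) \<bullet> v = 0 \<longleftrightarrow> v = 0\<^sub>v n"
  by (auto simp: scalar_prod_def sum_nonneg_eq_0_iff)

lemma vnorm_nonneg [simp]: "0 \<le> vnorm v"
  by (simp add: vnorm_def)

lemma vnorm_power2: "(vnorm v)\<^sup>2 = v \<bullet> v"
  by (simp add: vnorm_def)

lemma vnorm_eq_0: "v \<in> carrier_vec n \<Longrightarrow> vnorm v = 0 \<longleftrightarrow> v = 0\<^sub>v n"
  by (simp add: vnorm_def scalar_prod_self_eq_0)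

lemma vnorm_zero [simp]: "vnorm (0\<^sub>v n) = 0"
  by (simp add: vnorm_def)

lemma vnorm_smult: "vnorm (c \<cdot>\<^sub>v v) = \<bar>c\<bar> * vnorm v"
proof -
  have "(c \<cdot>\<^sub>v v) \<bullet> (c \<cdot>\<^sub>v v) = c\<^sup>2 * (v \<bullet> v)"
    by (simp add: power2_eq_square scalar_prod_def sum_distrib_left mult_ac)
  then show ?thesis by (simp add: vnorm_def real_sqrt_mult)
qed

lemma abs_scalar_prod_le:
  assumes "x \<in> carrier_vec n" "y \<in> carrier_vec n"
  shows "\<bar>x \<bullet> y\<bar> \<le> vnorm x * vnorm y"
proof -
  have "(x \<bullet> y)\<^sup>2 \<le> (x \<bullet> x) * (y \<bullet> y)"
    using assms Cauchy_Schwarz_ineq_sum[of "\<lambda>i. x $ i" "\<lambda>i. y $ i" "{0..<n}"]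
    by (simp add: scalar_prod_def power2_eq_square)
  then have "sqrt ((x \<bullet> y)\<^sup>2) \<le> sqrt ((x \<bullet> x) * (y \<bullet> y))" by (rule real_sqrt_le_mono)
  then show ?thesis by (simp add: vnorm_def real_sqrt_mult)
qed

lemma scalar_prod_le: "x \<in> carrier_vec n \<Longrightarrow> y \<in> carrier_vec n \<Longrightarrow> x \<bullet> y \<le> vnorm x * vnorm y"
  using abs_scalar_prod_le[of x n y] by linarith

lemma scalar_prod_self_add:
  fixes x y :: "real vec"
  assumes "x \<in> carrier_vec n" "y \<in> carrier_vec n"
  shows "(x + y) \<bullet> (x + y) = x \<bullet> x + 2 * (x \<bullet> y) + y \<bullet> y"
  using assms comm_scalar_prod[of x n y]
  by (simp add: add_scalar_prod_distrib[of _ n] scalar_prod_add_distrib[of _ n])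

lemma scalar_prod_self_diff:
  fixes x y :: "real vec"
  assumes "x \<in> carrier_vec n" "y \<in> carrier_vec n"
  shows "(x - y) \<bullet> (x - y) = x \<bullet> x - 2 * (x \<bullet> y) + y \<bullet> y"
  using assms comm_scalar_prod[of x n y]
  by (simp add: minus_scalar_prod_distrib[of _ n] scalar_prod_minus_distrib[of _ n])

lemma vnorm_minus_le:
  assumes "x \<in> carrier_vec n" "y \<in> carrier_vec n"
  shows "vnorm (x - y) \<le> vnorm x + vnorm y"
proof (rule power2_le_imp_le)
  show "(vnorm (x - y))\<^sup>2 \<le> (vnorm x + vnorm y)\<^sup>2"
    using abs_scalar_prod_le[OF assms] scalar_prod_self_diff[OF assms]
    by (simp add: vnorm_power2 power2_sum)
qed simp

text \<open>Induction on the number of vectors: the next one, minus its projection onto the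
  orthonormal family, is normalised and appended, unless it vanishes. The second case is why only
  \<open>m \<le> n\<close> is claimed; the vectors may be linearly dependent.\<close>

lemma gram_schmidt_family:
  fixes x :: "nat \<Rightarrow> nat \<Rightarrow> real"
  shows "\<exists>m\<le>n. \<exists>a. (\<forall>k<m. \<forall>l<m. (\<Sum>j<p. a k j * a l j) = of_bool (k = l)) \<and>
     (\<forall>i<n. \<exists>e. \<forall>j<p. x i j = (\<Sum>k<m. e k * a k j))"
proof (induction n)
  case 0
  show ?case by auto
next
  case (Suc n)
  then obtain m a where m: "m \<le> n"
    and on: "\<And>k l. k < m \<Longrightarrow> l < m \<Longrightarrow> (\<Sum>j<p. a k j * a l j) = of_bool (k = l)"
    and ex: "\<And>i. i < n \<Longrightarrow> \<exists>e. \<forall>j<p. x i j = (\<Sum>k<m. e k * a k j)" by blast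
  define e0 where "e0 k = (\<Sum>j<p. a k j * x n j)" for k
  define r where "r j = x n j - (\<Sum>k<m. e0 k * a k j)" for j
  define R where "R = (\<Sum>j<p. (r j)\<^sup>2)"
  show ?case
  proof (cases "R = 0")
    case True
    then have "\<And>j. j < p \<Longrightarrow> r j = 0"
      unfolding R_def by (simp add: sum_nonneg_eq_0_iff)
    then have "\<forall>j<p. x n j = (\<Sum>k<m. e0 k * a k j)" by (simp add: r_def)
    then have "\<forall>i<Suc n. \<exists>e. \<forall>j<p. x i j = (\<Sum>k<m. e k * a k j)"
      using ex less_Suc_eq by auto
    then show ?thesis using m on by (intro exI[of _ m] conjI exI[of _ a]) auto
  next
    case False
    then have R: "R > 0" unfolding R_def by (simp add: sum_nonneg less_le)
    have orth: "(\<Sum>j<p. a k j * r j) = 0" if k: "k < m" for k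
    proof -
      have "(\<Sum>j<p. a k j * r j) = e0 k - (\<Sum>j<p. \<Sum>l<m. e0 l * (a k j * a l j))"
        by (simp add: r_def e0_def right_diff_distrib sum_subtractf sum_distrib_left mult_ac)
      also have "(\<Sum>j<p. \<Sum>l<m. e0 l * (a k j * a l j)) = (\<Sum>l<m. e0 l * (\<Sum>j<p. a k j * a l j))"
        by (subst sum.swap) (simp add: sum_distrib_left)
      also have "\<dots> = (\<Sum>l<m. e0 l * of_bool (k = l))"
        using k by (intro sum.cong) (auto simp: on)
      also have "\<dots> = e0 k" using k by (simp add: of_bool_def if_distrib[of "\<lambda>z. _ * z"] cong: if_cong)
      finally show ?thesis by simp
    qed
    define a' where "a' = a(m := \<lambda>j. r j / sqrt R)"
    have "(\<Sum>j<p. a' k j * a' l j) = of_bool (k = l)" if kl: "k < Suc m" "l < Suc m" for k l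
    proof -
      consider "k < m" "l < m" | "k = m" "l < m" | "k < m" "l = m" | "k = m" "l = m"
        using kl by (auto simp: less_Suc_eq)
      then show ?thesis
      proof cases
        case 1 then show ?thesis using on by (simp add: a'_def)
      next
        case 2
        then have "(\<Sum>j<p. a' k j * a' l j) = (\<Sum>j<p. a l j * r j) / sqrt R"
          by (simp add: a'_def sum_divide_distrib mult_ac)
        then show ?thesis using 2 orth by simp
      next
        case 3
        then have "(\<Sum>j<p. a' k j * a' l j) = (\<Sum>j<p. a k j * r j) / sqrt R"
          by (simp add: a'_def sum_divide_distrib mult_ac)
        then show ?thesis using 3 orth by simp
      next
        case 4
        then have "(\<Sum>j<p. a' k j * a' l j) = (\<Sum>j<p. (r j)\<^sup>2 / R)"
          using R by (simp add: a'_def power2_eq_square)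
        also have "\<dots> = R / R" by (simp add: R_def sum_divide_distrib[symmetric])
        finally have "(\<Sum>j<p. a' k j * a' l j) = R / R" .
        then show ?thesis using 4 R by simp
      qed
    qed
    moreover have "\<exists>e. \<forall>j<p. x i j = (\<Sum>k<Suc m. e k * a' k j)" if i: "i < Suc n" for i
    proof (cases "i = n")
      case True
      have "\<forall>j<p. x i j = (\<Sum>k<Suc m. (e0(m := sqrt R)) k * a' k j)"
        using R True by (simp add: a'_def r_def)
      then show ?thesis by blast
    next
      case False
      then obtain e where "\<forall>j<p. x i j = (\<Sum>k<m. e k * a k j)" using ex[of i] i by auto
      then have "\<forall>j<p. x i j = (\<Sum>k<Suc m. (e(m := 0)) k * a' k j)" by (simp add: a'_def)
      then show ?thesis by blast
    qed
    ultimately show ?thesis using m by (intro exI[of _ "Suc m"] conjI exI[of _ a']) auto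
  qed
qed

lemma gauss_fn_correlation_tail:
  assumes X: "X \<in> carrier_mat r p" and p: "0 < p"
    and S: "S \<in> sets (gauss_fn {..<p})"
    and corr: "\<And>h. h \<in> S \<Longrightarrow> vec p h = 0\<^sub>v p \<or>
      (\<exists>c\<in>carrier_vec r. sqrt (4 * real r / real p) * vnorm (transpose_mat X *\<^sub>v c) * vnorm (vec p h)
         < (transpose_mat X *\<^sub>v c) \<bullet> vec p h)"
  shows "emeasure (gauss_fn {..<p}) S \<le> ennreal (tail_bound r p)"
proof -
  obtain m a where m: "m \<le> r"
    and on: "\<And>k l. k < m \<Longrightarrow> l < m \<Longrightarrow> (\<Sum>j<p. a k j * a l j) = of_bool (k = l)"
    and "\<And>i. i < r \<Longrightarrow> \<exists>e. \<forall>j<p. X $$ (i, j) = (\<Sum>k<m. e k * a k j)"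
    using gram_schmidt_family[of r p "\<lambda>i j. X $$ (i, j)"] by blast
  then obtain e where e: "\<And>i j. i < r \<Longrightarrow> j < p \<Longrightarrow> X $$ (i, j) = (\<Sum>k<m. e i k * a k j)"
    by metis
  have "S \<subseteq> {h \<in> space (gauss_fn {..<p}). 4 * real r / real p * (\<Sum>j<p. (h j)\<^sup>2) \<le> (\<Sum>k<m. (\<Sum>j<p. a k j * h j)\<^sup>2)}"
  proof
    fix h assume h: "h \<in> S"
    then have sp: "h \<in> space (gauss_fn {..<p})" using S sets.sets_into_space by blast
    define t where "t = sqrt (4 * real r / real p)"
    define A where "A = (\<Sum>k<m. (\<Sum>j<p. a k j * h j)\<^sup>2)"
    have A0: "A \<ge> 0" by (simp add: A_def sum_nonneg)
    have hh: "(\<Sum>j<p. (h j)\<^sup>2) = (vnorm (vec p h))\<^sup>2"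
      unfolding vnorm_power2 by (subst scalar_prod_sum_lessThan[of _ p]) (auto simp: power2_eq_square)
    from corr[OF h] have "t\<^sup>2 * (vnorm (vec p h))\<^sup>2 \<le> A"
    proof
      assume "vec p h = 0\<^sub>v p"
      then show ?thesis using A0 by simp
    next
      assume "\<exists>c\<in>carrier_vec r. sqrt (4 * real r / real p) * vnorm (transpose_mat X *\<^sub>v c) * vnorm (vec p h)
         < (transpose_mat X *\<^sub>v c) \<bullet> vec p h"
      then obtain c where c: "c \<in> carrier_vec r"
        and lt: "t * vnorm (transpose_mat X *\<^sub>v c) * vnorm (vec p h) < (transpose_mat X *\<^sub>v c) \<bullet> vec p h"
        unfolding t_def by blast
      define y where "y = transpose_mat X *\<^sub>v c"
      have yc: "y \<in> carrier_vec p"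
        unfolding y_def using X c by (intro mult_mat_vec_carrier[of _ p r]) auto
      define f where "f k = (\<Sum>i<r. c $ i * e i k)" for k
      have y: "y $ j = (\<Sum>k<m. f k * a k j)" if j: "j < p" for j
      proof -
        have "y $ j = (\<Sum>i<r. X $$ (i, j) * c $ i)"
          using X c j by (simp add: y_def scalar_prod_def atLeast0LessThan)
        also have "\<dots> = (\<Sum>i<r. \<Sum>k<m. c $ i * e i k * a k j)"
          using j by (intro sum.cong) (auto simp: e sum_distrib_right sum_distrib_left mult_ac)
        also have "\<dots> = (\<Sum>k<m. f k * a k j)"
          by (subst sum.swap) (simp add: f_def sum_distrib_right)
        finally show ?thesis .
      qed
      have yh: "y \<bullet> vec p g = (\<Sum>k<m. f k * (\<Sum>j<p. a k j * g j))" for g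
      proof -
        have "y \<bullet> vec p g = (\<Sum>j<p. \<Sum>k<m. f k * (a k j * g j))"
          by (simp add: scalar_prod_sum_lessThan[of _ p] y sum_distrib_left sum_distrib_right mult_ac)
        also have "\<dots> = (\<Sum>k<m. f k * (\<Sum>j<p. a k j * g j))"
          by (subst sum.swap) (simp add: sum_distrib_left)
        finally show ?thesis .
      qed
      have yy: "y \<bullet> y = (\<Sum>k<m. (f k)\<^sup>2)"
      proof -
        have "vec p (($) y) = y" using yc by auto
        then have "y \<bullet> y = (\<Sum>k<m. f k * (\<Sum>j<p. a k j * y $ j))"
          using yh[of "($) y"] by simp
        also have "\<dots> = (\<Sum>k<m. f k * f k)"
        proof (intro sum.cong refl)
          fix k assume k: "k \<in> {..<m}"
          have "(\<Sum>j<p. a k j * y $ j) = (\<Sum>j<p. \<Sum>l<m. f l * (a k j * a l j))"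
            by (simp add: y sum_distrib_left mult_ac)
          also have "\<dots> = (\<Sum>l<m. f l * (\<Sum>j<p. a k j * a l j))"
            by (subst sum.swap) (simp add: sum_distrib_left)
          also have "\<dots> = (\<Sum>l<m. f l * of_bool (k = l))"
            using k by (intro sum.cong) (auto simp: on)
          also have "\<dots> = f k" using k by (simp add: of_bool_def if_distrib[of "\<lambda>z. _ * z"] cong: if_cong)
          finally show "f k * (\<Sum>j<p. a k j * y $ j) = f k * f k" by simp
        qed
        finally show ?thesis by (simp add: power2_eq_square)
      qed
      have "(y \<bullet> vec p h)\<^sup>2 \<le> (vnorm y)\<^sup>2 * A"
        unfolding yh vnorm_power2 yy A_def by (rule Cauchy_Schwarz_ineq_sum)
      then have "\<bar>y \<bullet> vec p h\<bar> \<le> vnorm y * sqrt A"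
        using real_sqrt_le_mono[of "(y \<bullet> vec p h)\<^sup>2"] by (fastforce simp: real_sqrt_mult)
      then have less: "t * vnorm y * vnorm (vec p h) < vnorm y * sqrt A"
        using lt by (simp add: y_def)
      have "vnorm y \<noteq> 0" using less by auto
      then have "vnorm y > 0" using vnorm_nonneg[of y] by linarith
      then have "t * vnorm (vec p h) < sqrt A" using less by (simp add: mult_ac)
      moreover have "0 \<le> t * vnorm (vec p h)" by (simp add: t_def)
      ultimately have "(t * vnorm (vec p h))\<^sup>2 \<le> (sqrt A)\<^sup>2" by (intro power_mono) auto
      then show ?thesis using A0 by (simp add: power_mult_distrib)
    qed
    then show "h \<in> {h \<in> space (gauss_fn {..<p}). 4 * real r / real p * (\<Sum>j<p. (h j)\<^sup>2) \<le> (\<Sum>k<m. (\<Sum>j<p. a k j * h j)\<^sup>2)}"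
      using sp by (simp add: hh A_def t_def)
  qed
  then have "emeasure (gauss_fn {..<p}) S \<le> emeasure (gauss_fn {..<p}) {h \<in> space (gauss_fn {..<p}). 4 * real r / real p * (\<Sum>j<p. (h j)\<^sup>2) \<le> (\<Sum>k<m. (\<Sum>j<p. a k j * h j)\<^sup>2)}"
    by (intro emeasure_mono) measurable
  also have "\<dots> \<le> ennreal (tail_bound r p)"
    by (rule gauss_fn_subspace_tail[OF on m p])
  finally show ?thesis .
qed

text \<open>The mechanism for exchanging a fixed vector for a random one. Here \<open>q\<close> is
  the probability under \<open>M\<close> of an event about a fixed vector; invariance shows that it
  is not larger with \<open>h\<close> in its place, for almost every \<open>h\<close>. By Fubini the
  roles may be swapped: \<open>x\<close> is frozen, and only the tail of \<open>h\<close> under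
  \<open>N\<close> has to be estimated.\<close>

lemma (in prob_space) le_by_averaging:
  assumes N: "prob_space N" and S: "S \<in> sets (M \<Otimes>\<^sub>M N)"
    and lower: "AE h in N. q \<le> emeasure M ((\<lambda>x. (x, h)) -` S)"
    and upper: "AE x in M. emeasure N (Pair x -` S) \<le> \<epsilon>"
  shows "q \<le> \<epsilon>"
proof -
  interpret N: prob_space N by fact
  interpret pair_sigma_finite M N ..
  have "q = (\<integral>\<^sup>+h. q \<partial>N)" by (simp add: N.emeasure_space_1)
  also have "\<dots> \<le> (\<integral>\<^sup>+h. emeasure M ((\<lambda>x. (x, h)) -` S) \<partial>N)"
    by (rule nn_integral_mono_AE[OF lower])
  also have "\<dots> = emeasure (M \<Otimes>\<^sub>M N) S"
    by (rule emeasure_pair_measure_alt2[OF S, symmetric])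
  also have "\<dots> = (\<integral>\<^sup>+x. emeasure N (Pair x -` S) \<partial>M)"
    by (rule N.emeasure_pair_measure_alt[OF S])
  also have "\<dots> \<le> (\<integral>\<^sup>+x. \<epsilon> \<partial>M)"
    by (rule nn_integral_mono_AE[OF upper])
  also have "\<dots> = \<epsilon>" by (simp add: emeasure_space_1)
  finally show ?thesis .
qed

section \<open>Haar-distributed orthogonal matrices\<close>

lemma mat_eq_oneI:
  fixes M :: "real mat"
  assumes M: "M \<in> carrier_mat n n" and id: "\<And>x. x \<in> carrier_vec n \<Longrightarrow> M *\<^sub>v x = x"
  shows "M = 1\<^sub>m n"
proof (rule eq_matI)
  fix i j assume "i < dim_row (1\<^sub>m n :: real mat)" "j < dim_col (1\<^sub>m n :: real mat)"
  then have ij: "i < n" "j < n" by auto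
  have "M $$ (i, j) = (M *\<^sub>v unit_vec n j) $ i"
    using M ij by (simp add: scalar_prod_right_unit[of _ n])
  also have "\<dots> = unit_vec n j $ i" by (simp add: id)
  finally show "M $$ (i, j) = 1\<^sub>m n $$ (i, j)" using ij by auto
qed (use M in auto)

definition householder :: "nat \<Rightarrow> real vec \<Rightarrow> real mat" where
  "householder p v = mat p p (\<lambda>(i, j). of_bool (i = j) - 2 * v $ i * v $ j / (v \<bullet> v))"

lemma householder_carrier [simp]: "householder p v \<in> carrier_mat p p"
  by (simp add: householder_def)

lemma transpose_householder: "transpose_mat (householder p v) = householder p v"
  by (rule eq_matI) (auto simp: householder_def)

lemma householder_mult_vec:
  assumes "v \<in> carrier_vec p" "x \<in> carrier_vec p"
  shows "householder p v *\<^sub>v x = x - (2 * (v \<bullet> x) / (v \<bullet> v)) \<cdot>\<^sub>v v"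
proof (rule eq_vecI)
  fix i assume "i < dim_vec (x - (2 * (v \<bullet> x) / (v \<bullet> v)) \<cdot>\<^sub>v v)"
  then have i: "i < p" using assms by auto
  have "(householder p v *\<^sub>v x) $ i = (\<Sum>j<p. (of_bool (i = j) - 2 * v $ i * v $ j / (v \<bullet> v)) * x $ j)"
    using i assms by (simp add: householder_def scalar_prod_def atLeast0LessThan)
  also have "\<dots> = (\<Sum>j<p. of_bool (i = j) * x $ j) - (\<Sum>j<p. 2 * v $ i * v $ j / (v \<bullet> v) * x $ j)"
    by (simp add: left_diff_distrib sum_subtractf)
  also have "(\<Sum>j<p. of_bool (i = j) * x $ j) = x $ i"
    using i by (simp add: of_bool_def if_distrib[of "\<lambda>z. z * _"] cong: if_cong)
  also have "(\<Sum>j<p. 2 * v $ i * v $ j / (v \<bullet> v) * x $ j) = 2 * v $ i / (v \<bullet> v) * (\<Sum>j<p. v $ j * x $ j)"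
    by (simp add: sum_distrib_left sum_divide_distrib mult_ac)
  also have "(\<Sum>j<p. v $ j * x $ j) = v \<bullet> x"
    using assms by (simp add: scalar_prod_sum_lessThan[of _ p])
  finally show "(householder p v *\<^sub>v x) $ i = (x - (2 * (v \<bullet> x) / (v \<bullet> v)) \<cdot>\<^sub>v v) $ i"
    using i assms by simp
qed (use assms in \<open>auto simp: householder_def\<close>)

lemma orth_mat_householder:
  assumes v: "v \<in> carrier_vec p" "v \<noteq> 0\<^sub>v p"
  shows "orth_mat p (householder p v)"
proof -
  have "householder p v * householder p v = 1\<^sub>m p"
  proof (rule mat_eq_oneI)
    fix x :: "real vec" assume x: "x \<in> carrier_vec p"
    have vv: "v \<bullet> v \<noteq> 0" using v scalar_prod_self_eq_0 by blast
    define t where "t = 2 * (v \<bullet> x) / (v \<bullet> v)"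
    have xt: "householder p v *\<^sub>v x = x - t \<cdot>\<^sub>v v" "x - t \<cdot>\<^sub>v v \<in> carrier_vec p"
      using v x by (auto simp: householder_mult_vec t_def)
    have "v \<bullet> (x - t \<cdot>\<^sub>v v) = v \<bullet> x - t * (v \<bullet> v)"
      using v x by (simp add: scalar_prod_minus_distrib[of _ p])
    also have "\<dots> = - (v \<bullet> x)" using vv by (simp add: t_def)
    finally have "householder p v *\<^sub>v (x - t \<cdot>\<^sub>v v) = x - t \<cdot>\<^sub>v v - (- t) \<cdot>\<^sub>v v"
      using v xt(2) by (simp add: householder_mult_vec t_def)
    also have "\<dots> = x" using v x by auto
    finally show "(householder p v * householder p v) *\<^sub>v x = x"
      using x by (simp add: assoc_mult_mat_vec[of _ p p _ p] xt)
  qed (rule mult_carrier_mat[of _ p p], simp_all)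
  then show ?thesis by (simp add: orth_mat_def transpose_householder)
qed

text \<open>The reflection in the hyperplane bisecting \<open>x\<close> and \<open>w\<close>.
  Symmetry is recorded because in \<open>transpose_mat (Q * O) *\<^sub>v h\<close> it is the
  transpose of \<open>Q\<close> that acts on \<open>h\<close>.\<close>

lemma exists_symmetric_orth_mat:
  assumes x: "x \<in> carrier_vec p" and w: "w \<in> carrier_vec p" and eq: "vnorm x = vnorm w"
  shows "\<exists>Q. orth_mat p Q \<and> transpose_mat Q = Q \<and> Q *\<^sub>v x = w"
proof (cases "x = w")
  case True
  then show ?thesis using x by (intro exI[of _ "1\<^sub>m p"]) (auto simp: orth_mat_def)
next
  case False
  define v where "v = x - w"
  have v: "v \<in> carrier_vec p" using x w by (simp add: v_def)
  have v0: "v \<noteq> 0\<^sub>v p"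
  proof
    assume "v = 0\<^sub>v p"
    then have "x $ i = w $ i" if "i < p" for i
      using that x w by (metis v_def carrier_vecD eq_iff_diff_eq_0 index_minus_vec(1) index_zero_vec(1))
    then have "x = w" using x w by (intro eq_vecI) auto
    then show False using False by simp
  qed
  have "x \<bullet> x = w \<bullet> w" using eq by (metis vnorm_power2)
  \<comment> \<open>Equality of the two lengths makes the coefficient in the Householder formula
    equal to 1, so exactly \<open>v = x - w\<close> is subtracted.\<close>
  then have "v \<bullet> v = 2 * (v \<bullet> x)"
    using x w scalar_prod_self_diff[OF x w] comm_scalar_prod[OF x w]
    by (simp add: v_def minus_scalar_prod_distrib[of _ p])
  moreover have "v \<bullet> v \<noteq> 0" using v v0 scalar_prod_self_eq_0 by blast
  ultimately have "householder p v *\<^sub>v x = x - 1 \<cdot>\<^sub>v v"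
    using v x by (simp add: householder_mult_vec)
  also have "\<dots> = w" using x w by (auto simp: v_def)
  finally show ?thesis
    using orth_mat_householder[OF v v0] transpose_householder by blast
qed

lemma transpose_mult_scalar:
  fixes A :: "real mat"
  assumes "A \<in> carrier_mat n m" "x \<in> carrier_vec n" "y \<in> carrier_vec m"
  shows "x \<bullet> (A *\<^sub>v y) = (transpose_mat A *\<^sub>v x) \<bullet> y"
  using transpose_vec_mult_scalar[OF assms(1,3,2)] assms
    comm_scalar_prod[of y m "transpose_mat A *\<^sub>v x"] by (simp add: mult_mat_vec_carrier[of _ m n])

lemma orth_mat_right_inverse: "orth_mat p Q \<Longrightarrow> Q * transpose_mat Q = 1\<^sub>m p"
  unfolding orth_mat_def using mat_mult_left_right_inverse[of "transpose_mat Q" p Q] by auto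

lemma orth_mat_transpose: "orth_mat p Q \<Longrightarrow> orth_mat p (transpose_mat Q)"
  using orth_mat_right_inverse[of p Q] by (auto simp: orth_mat_def)

lemma vnorm_orth_mat:
  assumes Q: "orth_mat p Q" and x: "x \<in> carrier_vec p"
  shows "vnorm (Q *\<^sub>v x) = vnorm x"
proof -
  have c: "Q \<in> carrier_mat p p" and o: "transpose_mat Q * Q = 1\<^sub>m p" using Q by (auto simp: orth_mat_def)
  have "(Q *\<^sub>v x) \<bullet> (Q *\<^sub>v x) = (transpose_mat Q *\<^sub>v (Q *\<^sub>v x)) \<bullet> x"
    using c x by (intro transpose_mult_scalar) auto
  also have "transpose_mat Q *\<^sub>v (Q *\<^sub>v x) = (transpose_mat Q * Q) *\<^sub>v x"
    using c x by (intro assoc_mult_mat_vec[symmetric]) auto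
  also have "\<dots> = x" using o x by simp
  finally show ?thesis by (simp add: vnorm_def)
qed

section \<open>Matrices as functions on index pairs, and an open correlation event\<close>

lemma fmat_carrier [simp]: "fmat m k f \<in> carrier_mat m k"
  by (simp add: fmat_def)

lemma dim_fmat [simp]: "dim_row (fmat m k f) = m" "dim_col (fmat m k f) = k"
  by (simp_all add: fmat_def)

lemma index_fmat [simp]: "i < m \<Longrightarrow> j < k \<Longrightarrow> fmat m k f $$ (i, j) = f (i, j)"
  by (simp add: fmat_def)

lemma fmat_mat_fn: "M \<in> carrier_mat m k \<Longrightarrow> fmat m k (mat_fn M) = M"
  by (rule eq_matI) (auto simp: mat_fn_def)

lemma index_transpose_fmat_mult_vec:
  assumes "c \<in> carrier_vec r" "j < p"
  shows "(transpose_mat (fmat r p X) *\<^sub>v c) $ j = (\<Sum>i<r. X (i, j) * c $ i)"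
  using assms by (simp add: scalar_prod_def atLeast0LessThan)

text \<open>Quantifying over the coefficients instead of projecting onto the row space of \<open>X\<close> makes this an open
  set, whence its measurability without any matrix inverse.\<close>
definition correlated :: "nat \<Rightarrow> nat \<Rightarrow> real \<Rightarrow> ((nat \<times> nat \<Rightarrow> real) \<times> (nat \<Rightarrow> real) \<times> (nat \<times> nat \<Rightarrow> real)) set" where
  "correlated r p \<kappa> = {(X, b, Om). \<exists>c\<in>carrier_vec r.
     \<kappa> * vnorm (transpose_mat (fmat r p X) *\<^sub>v c) * vnorm (vec p b) <
     (transpose_mat (fmat r p X) *\<^sub>v c) \<bullet> (transpose_mat (fmat p p Om) *\<^sub>v vec p b)}"

lemma open_correlated: "open (correlated r p \<kappa>)"
proof -
  have "correlated r p \<kappa> = (\<Union>c\<in>carrier_vec r. {w.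
     \<kappa> * sqrt (\<Sum>j<p. (\<Sum>i<r. fst w (i, j) * c $ i) * (\<Sum>i<r. fst w (i, j) * c $ i)) *
       sqrt (\<Sum>j<p. fst (snd w) j * fst (snd w) j) <
     (\<Sum>j<p. (\<Sum>i<r. fst w (i, j) * c $ i) * (\<Sum>i<p. snd (snd w) (i, j) * fst (snd w) i))})"
    unfolding correlated_def vnorm_def
    by (auto simp: scalar_prod_sum_lessThan[of _ p] index_transpose_fmat_mult_vec simp del: index_mult_mat_vec)
  moreover have "open \<dots>"
  proof (intro open_UN ballI open_Collect_less)
    have c1: "continuous_on UNIV (\<lambda>w :: (nat \<times> nat \<Rightarrow> real) \<times> (nat \<Rightarrow> real) \<times> (nat \<times> nat \<Rightarrow> real). fst w i)" for i
      by (rule continuous_on_product_then_coordinatewise) (intro continuous_intros)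
    have c2: "continuous_on UNIV (\<lambda>w :: (nat \<times> nat \<Rightarrow> real) \<times> (nat \<Rightarrow> real) \<times> (nat \<times> nat \<Rightarrow> real). fst (snd w) i)" for i
      by (rule continuous_on_product_then_coordinatewise) (intro continuous_intros)
    have c3: "continuous_on UNIV (\<lambda>w :: (nat \<times> nat \<Rightarrow> real) \<times> (nat \<Rightarrow> real) \<times> (nat \<times> nat \<Rightarrow> real). snd (snd w) i)" for i
      by (rule continuous_on_product_then_coordinatewise) (intro continuous_intros)
    fix c :: "real Matrix.vec"
    show "continuous_on UNIV (\<lambda>w :: (nat \<times> nat \<Rightarrow> real) \<times> (nat \<Rightarrow> real) \<times> (nat \<times> nat \<Rightarrow> real).
       \<kappa> * sqrt (\<Sum>j<p. (\<Sum>i<r. fst w (i, j) * c $ i) * (\<Sum>i<r. fst w (i, j) * c $ i)) *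
       sqrt (\<Sum>j<p. fst (snd w) j * fst (snd w) j))"
      by (intro continuous_intros c1 c2 c3)
    show "continuous_on UNIV (\<lambda>w :: (nat \<times> nat \<Rightarrow> real) \<times> (nat \<Rightarrow> real) \<times> (nat \<times> nat \<Rightarrow> real).
       (\<Sum>j<p. (\<Sum>i<r. fst w (i, j) * c $ i) * (\<Sum>i<p. snd (snd w) (i, j) * fst (snd w) i)))"
      by (intro continuous_intros c1 c2 c3)
  qed
  ultimately show ?thesis by simp
qed

text \<open>The open events live in the space of all functions on the index type, so coordinates
  outside \<open>I\<close> must be measurable as well. On the extensional functions they are
  constantly \<open>undefined\<close>.\<close>

lemma measurable_component_lebesgue_fn:
  "(\<lambda>x. x i) \<in> borel_measurable (lebesgue_fn I)"
proof (cases "i \<in> I")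
  case True
  then show ?thesis using measurable_component_singleton[OF True, of "\<lambda>_. lborel"] by simp
next
  case False
  then have "(\<lambda>x. x i) \<in> borel_measurable (lebesgue_fn I) \<longleftrightarrow>
     (\<lambda>x. undefined :: real) \<in> borel_measurable (lebesgue_fn I :: ('a \<Rightarrow> real) measure)"
    by (intro measurable_cong) (auto simp: space_lebesgue_fn extensional_def)
  then show ?thesis by simp
qed

lemma measurable_compose_component [measurable (raw)]:
  "f \<in> measurable M (lebesgue_fn I) \<Longrightarrow> (\<lambda>x. f x i) \<in> borel_measurable M"
  by (rule measurable_compose[OF _ measurable_component_lebesgue_fn])

text \<open>The index types are countable, so coordinatewise measurability gives measurability into
  the Borel sets of the product topology, among which is the open set
  \<open>correlated r p \<kappa>\<close>.\<close>

lemma measurable_correlated: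
  assumes X: "\<And>i. (\<lambda>x. X x i) \<in> borel_measurable M" and b: "\<And>i. (\<lambda>x. b x i) \<in> borel_measurable M"
    and Om: "\<And>i. (\<lambda>x. Om x i) \<in> borel_measurable M"
  shows "{x \<in> space M. (X x, b x, Om x) \<in> correlated r p \<kappa>} \<in> sets M"
proof -
  have "(\<lambda>x. (X x, b x, Om x)) \<in> measurable M (borel \<Otimes>\<^sub>M (borel \<Otimes>\<^sub>M borel))"
    by (intro measurable_Pair measurable_coordinatewise_then_product assms)
  moreover have "correlated r p \<kappa> \<in> sets (borel \<Otimes>\<^sub>M (borel \<Otimes>\<^sub>M borel))"
    unfolding borel_prod using open_correlated by (rule borel_open)
  ultimately have "(\<lambda>x. (X x, b x, Om x)) -` correlated r p \<kappa> \<inter> space M \<in> sets M"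
    by (rule measurable_sets)
  then show ?thesis by (simp add: vimage_def Int_def conj_commute)
qed

section \<open>Left invariance and the correlation tails of a Haar matrix\<close>

lemma haar_orthD:
  assumes "haar_orth p H"
  shows "prob_space H" "sets H = sets (lebesgue_fn ({..<p} \<times> {..<p}))"
    "space H = extensional ({..<p} \<times> {..<p})"
    "AE Om in H. orth_mat p (fmat p p Om)"
    "\<And>Q. orth_mat p Q \<Longrightarrow> distr H H (\<lambda>Om. mat_fn (Q * fmat p p Om)) = H"
  using assms sets_eq_imp_space_eq[of H "lebesgue_fn ({..<p} \<times> {..<p})"]
  by (auto simp: haar_orth_def space_lebesgue_fn)

lemma haar_measurable_mult:
  assumes H: "haar_orth p H" and Q: "Q \<in> carrier_mat p p"
  shows "(\<lambda>Om. mat_fn (Q * fmat p p Om)) \<in> measurable H H"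
proof -
  note sets = haar_orthD(2)[OF H]
  have "(\<lambda>Om. \<lambda>ij\<in>{..<p} \<times> {..<p}. \<Sum>k<p. Q $$ (fst ij, k) * Om (k, snd ij)) \<in>
     measurable (lebesgue_fn ({..<p} \<times> {..<p})) (lebesgue_fn ({..<p} \<times> {..<p}))"
    by (intro measurable_restrict) measurable
  also have "(\<lambda>Om. \<lambda>ij\<in>{..<p} \<times> {..<p}. \<Sum>k<p. Q $$ (fst ij, k) * Om (k, snd ij)) =
     (\<lambda>Om. mat_fn (Q * fmat p p Om))"
    using Q by (auto simp: mat_fn_def fun_eq_iff scalar_prod_def atLeast0LessThan)
  finally show ?thesis
    by (subst measurable_cong_sets[OF sets sets])
qed

lemma haar_emeasure_mult:
  assumes H: "haar_orth p H" and Q: "orth_mat p Q" and A: "A \<in> sets H"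
  shows "emeasure H {Om \<in> space H. mat_fn (Q * fmat p p Om) \<in> A} = emeasure H A"
proof -
  have Qc: "Q \<in> carrier_mat p p" using Q by (simp add: orth_mat_def)
  have "emeasure H A = emeasure (distr H H (\<lambda>Om. mat_fn (Q * fmat p p Om))) A"
    by (simp add: haar_orthD(5)[OF H Q])
  also have "\<dots> = emeasure H ((\<lambda>Om. mat_fn (Q * fmat p p Om)) -` A \<inter> space H)"
    by (rule emeasure_distr[OF haar_measurable_mult[OF H Qc] A])
  also have "(\<lambda>Om. mat_fn (Q * fmat p p Om)) -` A \<inter> space H = {Om \<in> space H. mat_fn (Q * fmat p p Om) \<in> A}"
    by auto
  finally show ?thesis ..
qed

lemma fmat_mat_fn_mult:
  "Q \<in> carrier_mat p p \<Longrightarrow> fmat p p (mat_fn (Q * fmat p p Om)) = Q * fmat p p Om"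
  by (rule fmat_mat_fn) (metis fmat_carrier mult_carrier_mat)

lemma transpose_mult_mult_vec:
  fixes A B :: "real mat"
  assumes "A \<in> carrier_mat n m" "B \<in> carrier_mat m k" "x \<in> carrier_vec n"
  shows "transpose_mat (A * B) *\<^sub>v x = transpose_mat B *\<^sub>v (transpose_mat A *\<^sub>v x)"
proof -
  have "transpose_mat (A * B) *\<^sub>v x = (transpose_mat B * transpose_mat A) *\<^sub>v x"
    using transpose_mult[OF assms(1,2)] by simp
  also have "\<dots> = transpose_mat B *\<^sub>v (transpose_mat A *\<^sub>v x)"
    using assms by (intro assoc_mult_mat_vec[of _ k m _ n]) auto
  finally show ?thesis .
qed

text \<open>If a symmetric orthogonal \<open>Q\<close> carries a multiple of \<open>h\<close> to
  \<open>b\<close>, then \<open>(Q O)^T h\<close> is a multiple of \<open>O^T b\<close>. The event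
  is homogeneous in the vector, so left invariance gives it the same probability for
  \<open>h\<close> as for \<open>b\<close>. With \<open>h\<close> Gaussian and \<open>O\<close>
  frozen, the condition is a correlation of \<open>h\<close> with the row space of
  \<open>X O^T\<close>.\<close>

lemma haar_correlation_tail:
  assumes H: "haar_orth p H" and p: "0 < p"
  shows "emeasure H {Om \<in> space H. (X, b, Om) \<in> correlated r p (sqrt (4 * real r / real p))} \<le> ennreal (tail_bound r p)"
proof -
  interpret H: prob_space H by (rule haar_orthD(1)[OF H])
  define \<kappa> where "\<kappa> = sqrt (4 * real r / real p)"
  let ?N = "gauss_fn {..<p} :: (nat \<Rightarrow> real) measure"
  let ?X = "transpose_mat (fmat r p X)"
  have Xc: "?X *\<^sub>v c \<in> carrier_vec p" if "c \<in> carrier_vec r" for c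
    using that by (intro mult_mat_vec_carrier[of _ p r]) auto
  have sH[measurable_cong]: "sets H = sets (lebesgue_fn ({..<p} \<times> {..<p}))" by (rule haar_orthD(2)[OF H])
  have Kset: "{Om \<in> space H. (X, h, Om) \<in> correlated r p \<kappa>} \<in> sets H" for h
    by (rule measurable_correlated) measurable
  \<comment> \<open>Vectors \<open>h\<close> that vanish on the first \<open>p\<close> coordinates
    cannot be carried to \<open>b\<close>; including them in \<open>S\<close> makes the lower bound
    trivial there.\<close>
  define S where "S = {w \<in> space (H \<Otimes>\<^sub>M ?N). vec p (snd w) = 0\<^sub>v p \<or> (X, snd w, fst w) \<in> correlated r p \<kappa>}"
  have zero: "vec p h = 0\<^sub>v p \<longleftrightarrow> (\<forall>j<p. h j = 0)" for h :: "nat \<Rightarrow> real"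
    by (auto simp: vec_eq_iff)
  have S: "S \<in> sets (H \<Otimes>\<^sub>M ?N)"
  proof -
    have "{w \<in> space (H \<Otimes>\<^sub>M ?N). (X, snd w, fst w) \<in> correlated r p \<kappa>} \<in> sets (H \<Otimes>\<^sub>M ?N)"
      by (rule measurable_correlated) measurable
    moreover have "{w \<in> space (H \<Otimes>\<^sub>M ?N). \<forall>j\<in>{..<p}. snd w j = 0} \<in> sets (H \<Otimes>\<^sub>M ?N)"
      by measurable
    ultimately have "{w \<in> space (H \<Otimes>\<^sub>M ?N). \<forall>j\<in>{..<p}. snd w j = 0} \<union> {w \<in> space (H \<Otimes>\<^sub>M ?N). (X, snd w, fst w) \<in> correlated r p \<kappa>}
       \<in> sets (H \<Otimes>\<^sub>M ?N)" by blast
    moreover have "S = {w \<in> space (H \<Otimes>\<^sub>M ?N). \<forall>j\<in>{..<p}. snd w j = 0} \<union> {w \<in> space (H \<Otimes>\<^sub>M ?N). (X, snd w, fst w) \<in> correlated r p \<kappa>}"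
      unfolding S_def zero by auto
    ultimately show ?thesis by simp
  qed
  show ?thesis unfolding \<kappa>_def[symmetric]
  proof (cases "vec p b = 0\<^sub>v p")
    case True
    then have "transpose_mat (fmat p p Om) *\<^sub>v vec p b = 0\<^sub>v p" for Om by (auto simp: scalar_prod_def)
    then have "{Om \<in> space H. (X, b, Om) \<in> correlated r p \<kappa>} = {}"
      using True Xc by (auto simp: correlated_def)
    then show "emeasure H {Om \<in> space H. (X, b, Om) \<in> correlated r p \<kappa>} \<le> ennreal (tail_bound r p)"
      by (simp only: emeasure_empty) simp
  next
    case b0: False
    show "emeasure H {Om \<in> space H. (X, b, Om) \<in> correlated r p \<kappa>} \<le> ennreal (tail_bound r p)"
    proof (rule H.le_by_averaging[OF prob_space_gauss_fn S])
      show "AE h in ?N. emeasure H {Om \<in> space H. (X, b, Om) \<in> correlated r p \<kappa>} \<le> emeasure H ((\<lambda>Om. (Om, h)) -` S)"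
      proof (rule AE_I2)
        fix h assume h: "h \<in> space ?N"
        show "emeasure H {Om \<in> space H. (X, b, Om) \<in> correlated r p \<kappa>} \<le> emeasure H ((\<lambda>Om. (Om, h)) -` S)"
        proof (cases "vec p h = 0\<^sub>v p")
          case True
          then have "(\<lambda>Om. (Om, h)) -` S = space H" using h by (auto simp: S_def space_pair_measure)
          then show ?thesis by (auto intro: emeasure_mono)
        next
          case h0: False
          define s where "s = vnorm (vec p b) / vnorm (vec p h)"
          have pos: "vnorm (vec p h) > 0" "vnorm (vec p b) > 0"
            using h0 b0 vnorm_eq_0[of "vec p h" p] vnorm_eq_0[of "vec p b" p]
              vnorm_nonneg[of "vec p h"] vnorm_nonneg[of "vec p b"] by (auto simp: less_le)
          then have s: "s > 0" by (simp add: s_def)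
          have "vnorm (s \<cdot>\<^sub>v vec p h) = vnorm (vec p b)" using pos s by (simp add: vnorm_smult s_def)
          then obtain Q where Q: "orth_mat p Q" "transpose_mat Q = Q" "Q *\<^sub>v (s \<cdot>\<^sub>v vec p h) = vec p b"
            using exists_symmetric_orth_mat[of "s \<cdot>\<^sub>v vec p h" p "vec p b"] by auto
          have Qc: "Q \<in> carrier_mat p p" using Q by (simp add: orth_mat_def)
          have Qb: "Q *\<^sub>v vec p h = (1 / s) \<cdot>\<^sub>v vec p b"
            using s Qc by (simp add: Q(3)[symmetric] mult_mat_vec[of _ p p] smult_smult_assoc)
          have eq: "(X, h, mat_fn (Q * fmat p p Om)) \<in> correlated r p \<kappa> \<longleftrightarrow> (X, b, Om) \<in> correlated r p \<kappa>" for Om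
          proof -
            have "transpose_mat (Q * fmat p p Om) *\<^sub>v vec p h = (1 / s) \<cdot>\<^sub>v (transpose_mat (fmat p p Om) *\<^sub>v vec p b)"
              using Qc by (subst transpose_mult_mult_vec[of _ p p _ p]) (auto simp: Q(2) Qb mult_mat_vec[of _ p p])
            moreover have "vnorm (vec p h) = vnorm (vec p b) / s" using pos by (simp add: s_def)
            ultimately have "(\<kappa> * vnorm (?X *\<^sub>v c) * vnorm (vec p h) < (?X *\<^sub>v c) \<bullet> (transpose_mat (Q * fmat p p Om) *\<^sub>v vec p h)) \<longleftrightarrow>
              (\<kappa> * vnorm (?X *\<^sub>v c) * vnorm (vec p b) < (?X *\<^sub>v c) \<bullet> (transpose_mat (fmat p p Om) *\<^sub>v vec p b))"
              if "c \<in> carrier_vec r" for c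
              using s Xc[OF that] by (simp add: scalar_prod_smult_distrib[of _ p] divide_less_cancel)
            then show ?thesis by (simp add: correlated_def fmat_mat_fn_mult[OF Qc])
          qed
          have "emeasure H {Om \<in> space H. (X, b, Om) \<in> correlated r p \<kappa>} =
             emeasure H {Om \<in> space H. mat_fn (Q * fmat p p Om) \<in> {Om \<in> space H. (X, h, Om) \<in> correlated r p \<kappa>}}"
            using measurable_space[OF haar_measurable_mult[OF H Qc]] by (intro arg_cong[where f = "emeasure H"]) (auto simp: eq)
          also have "\<dots> = emeasure H {Om \<in> space H. (X, h, Om) \<in> correlated r p \<kappa>}"
            by (rule haar_emeasure_mult[OF H Q(1) Kset])
          also have "\<dots> \<le> emeasure H ((\<lambda>Om. (Om, h)) -` S)"
            using h by (intro emeasure_mono sets_Pair2[OF S]) (auto simp: S_def space_pair_measure)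
          finally show ?thesis .
        qed
      qed
      show "AE Om in H. emeasure ?N (Pair Om -` S) \<le> ennreal (tail_bound r p)"
        using haar_orthD(4)[OF H]
      proof (rule AE_mp, intro AE_I2 impI)
        fix Om assume Om: "orth_mat p (fmat p p Om)"
        let ?Y = "fmat r p X * transpose_mat (fmat p p Om)"
        show "emeasure ?N (Pair Om -` S) \<le> ennreal (tail_bound r p)"
        proof (rule gauss_fn_correlation_tail[of ?Y, OF _ p sets_Pair1[OF S]])
          show "?Y \<in> carrier_mat r p" by (rule mult_carrier_mat[of _ _ p]) auto
          fix h assume "h \<in> Pair Om -` S"
          then have "vec p h = 0\<^sub>v p \<or> (X, h, Om) \<in> correlated r p \<kappa>" by (simp add: S_def)
          moreover have "\<exists>c\<in>carrier_vec r. \<kappa> * vnorm (transpose_mat ?Y *\<^sub>v c) * vnorm (vec p h)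
             < (transpose_mat ?Y *\<^sub>v c) \<bullet> vec p h" if corr: "(X, h, Om) \<in> correlated r p \<kappa>"
          proof -
            obtain c where c: "c \<in> carrier_vec r"
              and less: "\<kappa> * vnorm (?X *\<^sub>v c) * vnorm (vec p h) < (?X *\<^sub>v c) \<bullet> (transpose_mat (fmat p p Om) *\<^sub>v vec p h)"
              using corr by (auto simp: correlated_def)
            \<comment> \<open>The rotation is moved from \<open>h\<close> to the row-space vector,
              whose length it preserves.\<close>
            have Y: "transpose_mat ?Y *\<^sub>v c = fmat p p Om *\<^sub>v (?X *\<^sub>v c)"
              using c by (subst transpose_mult_mult_vec[of _ r p _ p]) auto
            have "(?X *\<^sub>v c) \<bullet> (transpose_mat (fmat p p Om) *\<^sub>v vec p h) = (fmat p p Om *\<^sub>v (?X *\<^sub>v c)) \<bullet> vec p h"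
              using Xc[OF c] by (subst transpose_mult_scalar[of _ p p]) auto
            then show ?thesis using less c vnorm_orth_mat[OF Om Xc[OF c]]
              by (intro bexI[of _ c]) (simp_all add: Y)
          qed
          ultimately show "vec p h = 0\<^sub>v p \<or> (\<exists>c\<in>carrier_vec r. sqrt (4 * real r / real p) *
             vnorm (transpose_mat ?Y *\<^sub>v c) * vnorm (vec p h) < (transpose_mat ?Y *\<^sub>v c) \<bullet> vec p h)"
            unfolding \<kappa>_def by blast
        qed
      qed
    qed
  qed
qed

text \<open>Transposition of the index pair undoes the transpose built into
  \<open>correlated\<close>, so that one open set serves for both \<open>O^T b\<close> and
  \<open>O b\<close>.\<close>

definition swap_ix :: "(nat \<times> nat \<Rightarrow> real) \<Rightarrow> nat \<times> nat \<Rightarrow> real" where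
  "swap_ix Om = (\<lambda>(i, j). Om (j, i))"

lemma fmat_swap_ix: "fmat p p (swap_ix Om) = transpose_mat (fmat p p Om)"
  by (rule eq_matI) (auto simp: swap_ix_def)

text \<open>Left invariance lets us insert an independent copy: \<open>O b\<close> and \<open>O'\<^sup>T (O b)\<close> have the same law.\<close>
lemma haar_correlation_tail_transpose:
  assumes H: "haar_orth p H" and p: "0 < p"
  shows "emeasure H {Om \<in> space H. (X, b, swap_ix Om) \<in> correlated r p (sqrt (4 * real r / real p))} \<le> ennreal (tail_bound r p)"
proof -
  interpret H: prob_space H by (rule haar_orthD(1)[OF H])
  define \<kappa> where "\<kappa> = sqrt (4 * real r / real p)"
  let ?X = "transpose_mat (fmat r p X)"
  have Xc: "?X *\<^sub>v c \<in> carrier_vec p" if "c \<in> carrier_vec r" for c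
    using that by (intro mult_mat_vec_carrier[of _ p r]) auto
  have sH[measurable_cong]: "sets H = sets (lebesgue_fn ({..<p} \<times> {..<p}))" by (rule haar_orthD(2)[OF H])
  define Ob where "Ob Om i = (\<Sum>k<p. Om (i, k) * b k)" for Om :: "nat \<times> nat \<Rightarrow> real" and i
  have Ob: "vec p (Ob Om) = fmat p p Om *\<^sub>v vec p b" for Om
    by (rule eq_vecI) (auto simp: Ob_def scalar_prod_def atLeast0LessThan)
  define S where "S = {w \<in> space (H \<Otimes>\<^sub>M H). (X, Ob (fst w), snd w) \<in> correlated r p \<kappa>}"
  have S: "S \<in> sets (H \<Otimes>\<^sub>M H)"
    unfolding S_def Ob_def by (rule measurable_correlated) measurable
  have K: "{Om \<in> space H. (X, b, swap_ix Om) \<in> correlated r p \<kappa>} \<in> sets H"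
    by (rule measurable_correlated) (simp_all add: swap_ix_def split_beta, measurable)
  show ?thesis unfolding \<kappa>_def[symmetric]
  proof (rule H.le_by_averaging[OF H.prob_space_axioms S])
    \<comment> \<open>With \<open>Om\<close> frozen, \<open>Ob Om\<close> is a fixed vector, and the
      second copy acts on it in the transposed way that the previous tail bound covers.\<close>
    show "AE Om in H. emeasure H (Pair Om -` S) \<le> ennreal (tail_bound r p)"
    proof (rule AE_I2)
      fix Om assume "Om \<in> space H"
      then have "Pair Om -` S = {Om' \<in> space H. (X, Ob Om, Om') \<in> correlated r p \<kappa>}"
        by (auto simp: S_def space_pair_measure)
      then show "emeasure H (Pair Om -` S) \<le> ennreal (tail_bound r p)"
        using haar_correlation_tail[OF H p] by (simp add: \<kappa>_def)
    qed
    show "AE Om' in H. emeasure H {Om \<in> space H. (X, b, swap_ix Om) \<in> correlated r p \<kappa>} \<le> emeasure H ((\<lambda>Om. (Om, Om')) -` S)"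
      using haar_orthD(4)[OF H]
    proof (rule AE_mp, intro AE_I2 impI)
      fix Om' assume Om': "Om' \<in> space H" "orth_mat p (fmat p p Om')"
      define Q where "Q = transpose_mat (fmat p p Om')"
      have Q: "orth_mat p Q" "Q \<in> carrier_mat p p"
        using Om' by (auto simp: Q_def intro: orth_mat_transpose)
      have "emeasure H {Om \<in> space H. (X, b, swap_ix Om) \<in> correlated r p \<kappa>} =
         emeasure H {Om \<in> space H. mat_fn (Q * fmat p p Om) \<in> {Om \<in> space H. (X, b, swap_ix Om) \<in> correlated r p \<kappa>}}"
        by (rule haar_emeasure_mult[OF H Q(1) K, symmetric])
      also have "\<dots> \<le> emeasure H ((\<lambda>Om. (Om, Om')) -` S)"
      \<comment> \<open>The inclusion needs \<open>O b\<close> and \<open>b\<close> to have equal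
        length, which holds for orthogonal \<open>Om\<close> and therefore only almost
        everywhere.\<close>
      proof (rule emeasure_mono_AE)
        show "(\<lambda>Om. (Om, Om')) -` S \<in> sets H" by (rule sets_Pair2[OF S])
        show "AE Om in H. Om \<in> {Om \<in> space H. mat_fn (Q * fmat p p Om) \<in> {Om \<in> space H. (X, b, swap_ix Om) \<in> correlated r p \<kappa>}}
            \<longrightarrow> Om \<in> (\<lambda>Om. (Om, Om')) -` S"
          using haar_orthD(4)[OF H]
        proof (rule AE_mp, intro AE_I2 impI)
          fix Om assume Om: "Om \<in> space H" "orth_mat p (fmat p p Om)"
            and "Om \<in> {Om \<in> space H. mat_fn (Q * fmat p p Om) \<in> {Om \<in> space H. (X, b, swap_ix Om) \<in> correlated r p \<kappa>}}"
          then obtain c where c: "c \<in> carrier_vec r" and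
            less: "\<kappa> * vnorm (?X *\<^sub>v c) * vnorm (vec p b) < (?X *\<^sub>v c) \<bullet> ((Q * fmat p p Om) *\<^sub>v vec p b)"
            by (auto simp: correlated_def fmat_swap_ix fmat_mat_fn_mult[OF Q(2)])
          have "(Q * fmat p p Om) *\<^sub>v vec p b = Q *\<^sub>v vec p (Ob Om)"
            using Q by (simp add: Ob assoc_mult_mat_vec[of _ p p _ p])
          moreover have "vnorm (vec p b) = vnorm (vec p (Ob Om))"
            by (simp add: Ob vnorm_orth_mat[OF Om(2)])
          ultimately have "(X, Ob Om, Om') \<in> correlated r p \<kappa>"
            using less c by (auto simp: correlated_def Q_def)
          then show "Om \<in> (\<lambda>Om. (Om, Om')) -` S"
            using Om Om' by (simp add: S_def space_pair_measure)
        qed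
      qed
      finally show "emeasure H {Om \<in> space H. (X, b, swap_ix Om) \<in> correlated r p \<kappa>} \<le> emeasure H ((\<lambda>Om. (Om, Om')) -` S)" .
    qed
  qed
qed

section \<open>Distance to the span of a Gaussian matrix\<close>

text \<open>Reflecting one row is a reflection of the whole matrix viewed as a vector of length
  \<open>n p\<close>: the unit normal is \<open>v\<close> in that row and zero in the others. The
  induction composes these reflections, the first \<open>m\<close> rows having been treated.\<close>

lemma distr_gauss_fn_reflect_rows:
  assumes v: "(\<Sum>j<p. (v j)\<^sup>2) = 1"
  shows "distr (gauss_fn ({..<n} \<times> {..<p})) (gauss_fn ({..<n} \<times> {..<p}))
     (\<lambda>U. \<lambda>(i, j)\<in>{..<n} \<times> {..<p}. U (i, j) - of_bool (i < m) * 2 * (\<Sum>k<p. v k * U (i, k)) * v j)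
   = gauss_fn ({..<n :: nat} \<times> {..<p :: nat})"
  (is "distr ?M ?M (?T m) = ?M")
proof (induction m)
  case 0
  have "distr ?M ?M (?T 0) = distr ?M ?M (\<lambda>U. U)"
    by (rule distr_cong) (auto simp: space_gauss_fn space_lebesgue_fn extensional_def fun_eq_iff)
  then show ?case by (simp add: distr_id2)
next
  case (Suc m)
  have meas: "?T m \<in> measurable ?M ?M" for m
  proof -
    have "(\<lambda>U. \<lambda>ij\<in>{..<n} \<times> {..<p}. U ij - of_bool (fst ij < m) * 2 * (\<Sum>k<p. v k * U (fst ij, k)) * v (snd ij))
        \<in> measurable ?M (lebesgue_fn ({..<n} \<times> {..<p}))"
      by (intro measurable_restrict) measurable
    then show ?thesis
      by (simp only: case_prod_unfold prod.collapse measurable_cong_sets[OF refl sets_gauss_fn])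
  qed
  show ?case
  proof (cases "m < n")
    case False
    then have "?T (Suc m) U = ?T m U" for U by (auto simp: fun_eq_iff)
    then show ?thesis using Suc by simp
  next
    case True
    let ?I = "{..<n} \<times> {..<p}"
    define a where "a = (\<lambda>(i, j). of_bool (i = m) * v j)"
    have row: "(\<Sum>ij\<in>?I. a ij * x ij) = (\<Sum>k<p. v k * x (m, k))" for x :: "nat \<times> nat \<Rightarrow> real"
    proof -
      have "(\<Sum>ij\<in>?I. a ij * x ij) = (\<Sum>i<n. \<Sum>j<p. a (i, j) * x (i, j))"
        by (simp add: sum.cartesian_product)
      also have "\<dots> = (\<Sum>i<n. if i = m then (\<Sum>j<p. v j * x (m, j)) else 0)"
        by (intro sum.cong) (auto simp: a_def)
      also have "\<dots> = (\<Sum>k<p. v k * x (m, k))" using True by simp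
      finally show ?thesis .
    qed
    have "(\<Sum>ij\<in>?I. (a ij)\<^sup>2) = (\<Sum>k<p. v k * a (m, k))"
      using row[of a] by (simp add: power2_eq_square)
    also have "\<dots> = 1" using v by (simp add: a_def power2_eq_square)
    finally have a: "(\<Sum>ij\<in>?I. (a ij)\<^sup>2) = 1" .
    have R: "reflect ?I a \<in> measurable ?M ?M" by measurable
    have "?T (Suc m) U = (reflect ?I a \<circ> ?T m) U" for U
    proof -
      have "(\<Sum>ij\<in>?I. a ij * ?T m U ij) = (\<Sum>k<p. v k * ?T m U (m, k))" by (rule row)
      also have "\<dots> = (\<Sum>k<p. v k * U (m, k))" using True by (intro sum.cong) auto
      finally show ?thesis
        unfolding reflect_def comp_def by (auto simp: a_def fun_eq_iff less_Suc_eq)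
    qed
    then have "?T (Suc m) = reflect ?I a \<circ> ?T m" by blast
    then have "distr ?M ?M (?T (Suc m)) = distr (distr ?M ?M (?T m)) ?M (reflect ?I a)"
      using distr_distr[OF R meas[of m]] by simp
    also have "\<dots> = ?M" unfolding Suc by (rule distr_gauss_fn_reflect[OF _ a]) simp
    finally show ?thesis .
  qed
qed

section \<open>Nearness to the random span\<close>

definition near_span :: "nat \<Rightarrow> nat \<Rightarrow> nat \<Rightarrow> real mat \<Rightarrow> real vec \<Rightarrow> real \<Rightarrow> ((nat \<times> nat \<Rightarrow> real) \<times> (nat \<Rightarrow> real)) set" where
  "near_span d n p W \<theta> t = {(U, x). \<exists>c\<in>carrier_vec n. \<exists>a\<in>{a \<in> carrier_vec d. a \<bullet> \<theta> = 0}.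
     (vnorm (vec p x - (W *\<^sub>v a + transpose_mat (fmat n p U) *\<^sub>v c)))\<^sup>2 < t * (vnorm (vec p x))\<^sup>2}"

lemma near_spanI:
  assumes "c \<in> carrier_vec n" "a \<in> carrier_vec d" "a \<bullet> \<theta> = 0"
    and "(vnorm (vec p x - (W *\<^sub>v a + transpose_mat (fmat n p U) *\<^sub>v c)))\<^sup>2 < t * (vnorm (vec p x))\<^sup>2"
  shows "(U, x) \<in> near_span d n p W \<theta> t"
  using assms unfolding near_span_def by blast

lemma open_near_span:
  assumes W: "W \<in> carrier_mat p d"
  shows "open (near_span d n p W \<theta> t)"
proof -
  have eq: "(vnorm (vec p x - (W *\<^sub>v a + transpose_mat (fmat n p U) *\<^sub>v c)))\<^sup>2 =
     (\<Sum>j<p. (x j - ((W *\<^sub>v a) $ j + (\<Sum>i<n. U (i, j) * c $ i))) * (x j - ((W *\<^sub>v a) $ j + (\<Sum>i<n. U (i, j) * c $ i))))"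
    if "c \<in> carrier_vec n" for x U c a
    unfolding vnorm_power2 using W that
    by (simp add: scalar_prod_sum_lessThan[of _ p] index_transpose_fmat_mult_vec del: index_mult_mat_vec)
  have eq': "(vnorm (vec p x))\<^sup>2 = (\<Sum>j<p. x j * x j)" for x
    unfolding vnorm_power2 by (simp add: scalar_prod_sum_lessThan[of _ p])
  have "near_span d n p W \<theta> t = (\<Union>c\<in>carrier_vec n. \<Union>a\<in>{a \<in> carrier_vec d. a \<bullet> \<theta> = 0}. {w.
     (\<Sum>j<p. (snd w j - ((W *\<^sub>v a) $ j + (\<Sum>i<n. fst w (i, j) * c $ i))) * (snd w j - ((W *\<^sub>v a) $ j + (\<Sum>i<n. fst w (i, j) * c $ i)))) <
     t * (\<Sum>j<p. snd w j * snd w j)})"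
    by (rule Set.set_eqI) (simp add: near_span_def split_beta eq eq' del: index_mult_mat_vec cong: bex_cong)
  moreover have "open \<dots>"
  proof (intro open_UN ballI open_Collect_less)
    have c1: "continuous_on UNIV (\<lambda>w :: (nat \<times> nat \<Rightarrow> real) \<times> (nat \<Rightarrow> real). fst w i)" for i
      by (rule continuous_on_product_then_coordinatewise) (intro continuous_intros)
    have c2: "continuous_on UNIV (\<lambda>w :: (nat \<times> nat \<Rightarrow> real) \<times> (nat \<Rightarrow> real). snd w i)" for i
      by (rule continuous_on_product_then_coordinatewise) (intro continuous_intros)
    fix c a :: "real Matrix.vec"
    show "continuous_on UNIV (\<lambda>w :: (nat \<times> nat \<Rightarrow> real) \<times> (nat \<Rightarrow> real).
       (\<Sum>j<p. (snd w j - ((W *\<^sub>v a) $ j + (\<Sum>i<n. fst w (i, j) * c $ i))) * (snd w j - ((W *\<^sub>v a) $ j + (\<Sum>i<n. fst w (i, j) * c $ i)))))"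
      by (intro continuous_intros c1 c2)
    show "continuous_on UNIV (\<lambda>w :: (nat \<times> nat \<Rightarrow> real) \<times> (nat \<Rightarrow> real). t * (\<Sum>j<p. snd w j * snd w j))"
      by (intro continuous_intros c1 c2)
  qed
  ultimately show ?thesis by simp
qed

lemma measurable_near_span:
  assumes W: "W \<in> carrier_mat p d"
    and U: "\<And>i. (\<lambda>x. U x i) \<in> borel_measurable M" and X: "\<And>i. (\<lambda>x. X x i) \<in> borel_measurable M"
  shows "{x \<in> space M. (U x, X x) \<in> near_span d n p W \<theta> t} \<in> sets M"
proof -
  have "(\<lambda>x. (U x, X x)) \<in> measurable M (borel \<Otimes>\<^sub>M borel)"
    by (intro measurable_Pair measurable_coordinatewise_then_product assms)
  moreover have "near_span d n p W \<theta> t \<in> sets (borel \<Otimes>\<^sub>M borel)"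
    unfolding borel_prod using open_near_span[OF W] by (rule borel_open)
  ultimately have "(\<lambda>x. (U x, X x)) -` near_span d n p W \<theta> t \<inter> space M \<in> sets M"
    by (rule measurable_sets)
  then show ?thesis by (simp add: vimage_def Int_def conj_commute)
qed

text \<open>The span is a linear subspace and the inequality is homogeneous. This permits adjusting
  lengths before a reflection, which can only join vectors of equal length.\<close>

lemma near_span_scale:
  assumes W: "W \<in> carrier_mat p d" and \<theta>: "\<theta> \<in> carrier_vec d" and s: "s \<noteq> 0"
    and eq: "vec p x' = s \<cdot>\<^sub>v vec p x"
    and near: "(U, x) \<in> near_span d n p W \<theta> t"
  shows "(U, x') \<in> near_span d n p W \<theta> t"
proof -
  let ?U = "transpose_mat (fmat n p U)"
  obtain c a where c: "c \<in> carrier_vec n" and a: "a \<in> carrier_vec d" "a \<bullet> \<theta> = 0"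
    and less: "(vnorm (vec p x - (W *\<^sub>v a + ?U *\<^sub>v c)))\<^sup>2 < t * (vnorm (vec p x))\<^sup>2"
    using near by (auto simp: near_span_def)
  have Wa: "W *\<^sub>v a \<in> carrier_vec p" and Uc: "?U *\<^sub>v c \<in> carrier_vec p"
    using W a c by (auto intro: mult_mat_vec_carrier[of _ p d] mult_mat_vec_carrier[of _ p n])
  have "W *\<^sub>v (s \<cdot>\<^sub>v a) = s \<cdot>\<^sub>v (W *\<^sub>v a)" "?U *\<^sub>v (s \<cdot>\<^sub>v c) = s \<cdot>\<^sub>v (?U *\<^sub>v c)"
    using W a c by (auto intro: mult_mat_vec[of _ p d] mult_mat_vec[of _ p n])
  then have "vec p x' - (W *\<^sub>v (s \<cdot>\<^sub>v a) + ?U *\<^sub>v (s \<cdot>\<^sub>v c)) = s \<cdot>\<^sub>v (vec p x - (W *\<^sub>v a + ?U *\<^sub>v c))"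
    unfolding eq using W Wa Uc by (intro eq_vecI) (auto simp: algebra_simps simp del: index_mult_mat_vec)
  then have "(vnorm (vec p x' - (W *\<^sub>v (s \<cdot>\<^sub>v a) + ?U *\<^sub>v (s \<cdot>\<^sub>v c))))\<^sup>2 < t * (vnorm (vec p x'))\<^sup>2"
    using less s by (simp add: eq vnorm_smult power_mult_distrib mult.left_commute)
  moreover have "(s \<cdot>\<^sub>v a) \<bullet> \<theta> = 0" using a \<theta> by simp
  ultimately show ?thesis using a c by (intro near_spanI[of "s \<cdot>\<^sub>v c" _ "s \<cdot>\<^sub>v a"]) auto
qed

text \<open>The reflection exchanging \<open>x\<close> and \<open>x'\<close> has normal direction
  \<open>x - x'\<close>. The vectors \<open>W a\<close> with \<open>a\<close> orthogonal to
  \<open>\<theta>\<close> are orthogonal to it and stay fixed, while the rows of \<open>U\<close>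
  are reflected; distances to the span are preserved.\<close>

lemma near_span_reflect:
  assumes W: "W \<in> carrier_mat p d" and \<theta>: "\<theta> \<in> carrier_vec d"
    and norm: "vnorm (vec p x) = vnorm (vec p x')" and neq: "vec p x \<noteq> vec p x'"
    and orth: "\<And>a. a \<in> carrier_vec d \<Longrightarrow> a \<bullet> \<theta> = 0 \<Longrightarrow> (W *\<^sub>v a) \<bullet> (vec p x - vec p x') = 0"
  obtains v where "(\<Sum>j<p. (v j)\<^sup>2) = 1"
    "\<And>U. (U, x) \<in> near_span d n p W \<theta> t \<Longrightarrow>
       ((\<lambda>(i, j)\<in>{..<n} \<times> {..<p}. U (i, j) - of_bool (i < n) * 2 * (\<Sum>k<p. v k * U (i, k)) * v j), x') \<in> near_span d n p W \<theta> t"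
proof -
  define z where "z = vec p x - vec p x'"
  have z: "z \<in> carrier_vec p" by (simp add: z_def)
  have z0: "z \<noteq> 0\<^sub>v p"
  proof
    assume z0: "z = 0\<^sub>v p"
    have "vec p x $ j = vec p x' $ j" if "j < p" for j
      using arg_cong[OF z0, of "\<lambda>z. z $ j"] that by (simp add: z_def)
    then have "vec p x = vec p x'" by (intro eq_vecI) auto
    with neq show False ..
  qed
  have zpos: "vnorm z > 0" using vnorm_eq_0[OF z] z0 vnorm_nonneg[of z] by (simp add: less_le)
  define u where "u = (1 / vnorm z) \<cdot>\<^sub>v z"
  have u: "u \<in> carrier_vec p" using z by (simp add: u_def)
  have "vnorm u = 1" using zpos by (simp add: u_def vnorm_smult)
  then have uu: "u \<bullet> u = 1" by (metis vnorm_power2 one_power2)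
  define v where "v j = u $ j" for j
  have "(\<Sum>j<p. (v j)\<^sup>2) = u \<bullet> u" using u by (simp add: v_def scalar_prod_sum_lessThan[of _ p] power2_eq_square)
  then have v1: "(\<Sum>j<p. (v j)\<^sup>2) = 1" using uu by simp
  let ?Q = "householder p u"
  have u0: "u \<noteq> 0\<^sub>v p" using uu by auto
  have Q: "orth_mat p ?Q" by (rule orth_mat_householder[OF u u0])
  have Qy: "?Q *\<^sub>v y = y - (2 * (u \<bullet> y)) \<cdot>\<^sub>v u" if "y \<in> carrier_vec p" for y
    using householder_mult_vec[OF u that] uu by simp
  have Qx: "?Q *\<^sub>v vec p x = vec p x'"
  proof -
    have xx: "vec p x \<bullet> vec p x = vec p x' \<bullet> vec p x'" using norm by (metis vnorm_power2)
    have "z \<bullet> z = 2 * (z \<bullet> vec p x)"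
      using xx scalar_prod_self_diff[of "vec p x" p "vec p x'"] comm_scalar_prod[of "vec p x" p "vec p x'"]
      by (simp add: z_def minus_scalar_prod_distrib[of _ p])
    then have "2 * (z \<bullet> vec p x) = (vnorm z)\<^sup>2" by (simp add: vnorm_power2)
    then have "2 * (u \<bullet> vec p x) = vnorm z" using zpos z by (simp add: u_def power2_eq_square field_simps)
    moreover have "vnorm z \<cdot>\<^sub>v u = z" using zpos by (simp add: u_def smult_smult_assoc)
    ultimately have "?Q *\<^sub>v vec p x = vec p x - z" by (simp add: Qy)
    also have "\<dots> = vec p x'" by (rule eq_vecI) (auto simp: z_def)
    finally show ?thesis .
  qed
  show thesis
  proof (rule that[OF v1])
    fix U assume "(U, x) \<in> near_span d n p W \<theta> t"
    then obtain c a where c: "c \<in> carrier_vec n" and a: "a \<in> carrier_vec d" "a \<bullet> \<theta> = 0"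
      and less: "(vnorm (vec p x - (W *\<^sub>v a + transpose_mat (fmat n p U) *\<^sub>v c)))\<^sup>2 < t * (vnorm (vec p x))\<^sup>2"
      by (auto simp: near_span_def)
    define U' where "U' = (\<lambda>(i, j)\<in>{..<n} \<times> {..<p}. U (i, j) - of_bool (i < n) * 2 * (\<Sum>k<p. v k * U (i, k)) * v j)"
    let ?y = "transpose_mat (fmat n p U) *\<^sub>v c"
    have Wa: "W *\<^sub>v a \<in> carrier_vec p" and Uc: "?y \<in> carrier_vec p"
      using W a c by (auto intro: mult_mat_vec_carrier[of _ p d] mult_mat_vec_carrier[of _ p n])
    have "u \<bullet> (W *\<^sub>v a) = (1 / vnorm z) * (z \<bullet> (W *\<^sub>v a))" using z Wa by (simp add: u_def)
    also have "z \<bullet> (W *\<^sub>v a) = 0" using orth[OF a] comm_scalar_prod[OF z Wa] by (simp add: z_def)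
    finally have "?Q *\<^sub>v (W *\<^sub>v a) = W *\<^sub>v a - 0 \<cdot>\<^sub>v u" using Wa by (simp add: Qy)
    then have QW: "?Q *\<^sub>v (W *\<^sub>v a) = W *\<^sub>v a" using W Wa u by (auto simp del: index_mult_mat_vec)
    have QU: "?Q *\<^sub>v ?y = transpose_mat (fmat n p U') *\<^sub>v c"
    proof (rule eq_vecI)
      fix j assume "j < dim_vec (transpose_mat (fmat n p U') *\<^sub>v c)"
      then have j: "j < p" by simp
      have uy: "u \<bullet> ?y = (\<Sum>i<n. c $ i * (\<Sum>k<p. v k * U (i, k)))"
      proof -
        have "u \<bullet> ?y = (\<Sum>k<p. v k * (\<Sum>i<n. U (i, k) * c $ i))"
          using c by (simp add: scalar_prod_sum_lessThan[of _ p] index_transpose_fmat_mult_vec v_def del: index_mult_mat_vec)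
        also have "\<dots> = (\<Sum>k<p. \<Sum>i<n. c $ i * (v k * U (i, k)))" by (simp add: sum_distrib_left mult_ac)
        also have "\<dots> = (\<Sum>i<n. c $ i * (\<Sum>k<p. v k * U (i, k)))" by (subst sum.swap) (simp add: sum_distrib_left)
        finally show ?thesis .
      qed
      have "(?Q *\<^sub>v ?y) $ j = ?y $ j - 2 * (u \<bullet> ?y) * v j"
        using j u Uc by (simp add: Qy v_def del: index_mult_mat_vec)
      also have "\<dots> = (\<Sum>i<n. U (i, j) * c $ i) - 2 * (\<Sum>i<n. c $ i * (\<Sum>k<p. v k * U (i, k))) * v j"
        unfolding uy index_transpose_fmat_mult_vec[OF c j] ..
      also have "\<dots> = (\<Sum>i<n. (U (i, j) - 2 * (\<Sum>k<p. v k * U (i, k)) * v j) * c $ i)"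
        by (simp add: left_diff_distrib right_diff_distrib sum_subtractf sum_distrib_left[of _ _ "{..<n}"] sum_distrib_right[of _ "{..<n}"] mult_ac)
      also have "\<dots> = (\<Sum>i<n. U' (i, j) * c $ i)"
        using j by (intro sum.cong) (auto simp: U'_def)
      also have "\<dots> = (transpose_mat (fmat n p U') *\<^sub>v c) $ j" by (rule index_transpose_fmat_mult_vec[OF c j, symmetric])
      finally show "(?Q *\<^sub>v ?y) $ j = (transpose_mat (fmat n p U') *\<^sub>v c) $ j" .
    qed (auto simp: householder_def)
    have Qc: "?Q \<in> carrier_mat p p" by simp
    have "vec p x' - (W *\<^sub>v a + transpose_mat (fmat n p U') *\<^sub>v c) = ?Q *\<^sub>v (vec p x - (W *\<^sub>v a + ?y))"
    proof -
      have "?Q *\<^sub>v (vec p x - (W *\<^sub>v a + ?y)) = ?Q *\<^sub>v vec p x - ?Q *\<^sub>v (W *\<^sub>v a + ?y)"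
        by (rule mult_minus_distrib_mat_vec[OF Qc]) (use Wa Uc in auto)
      also have "?Q *\<^sub>v (W *\<^sub>v a + ?y) = ?Q *\<^sub>v (W *\<^sub>v a) + ?Q *\<^sub>v ?y"
        by (rule mult_add_distrib_mat_vec[OF Qc Wa Uc])
      finally show ?thesis by (simp only: Qx QW QU)
    qed
    then have "vnorm (vec p x' - (W *\<^sub>v a + transpose_mat (fmat n p U') *\<^sub>v c)) = vnorm (vec p x - (W *\<^sub>v a + ?y))"
      using vnorm_orth_mat[OF Q, of "vec p x - (W *\<^sub>v a + ?y)"] Wa Uc by simp
    then have "(U', x') \<in> near_span d n p W \<theta> t"
      using less a c norm by (intro near_spanI[of c _ a]) auto
    then show "((\<lambda>(i, j)\<in>{..<n} \<times> {..<p}. U (i, j) - of_bool (i < n) * 2 * (\<Sum>k<p. v k * U (i, k)) * v j), x') \<in> near_span d n p W \<theta> t"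
      by (simp add: U'_def)
  qed
qed

text \<open>\<open>W *\<^sub>v drop_coef l W \<theta> x\<close> is the orthogonal projection of \<open>x\<close> onto the vectors \<open>W a\<close> with \<open>a\<close>
  orthogonal to \<open>\<theta>\<close>, provided \<open>W\<^sup>T W = l I\<close>.\<close>
definition drop_coef :: "real \<Rightarrow> real mat \<Rightarrow> real vec \<Rightarrow> real vec \<Rightarrow> real vec" where
  "drop_coef l W \<theta> x = (1 / l) \<cdot>\<^sub>v (transpose_mat W *\<^sub>v x - ((\<theta> \<bullet> (transpose_mat W *\<^sub>v x)) / (\<theta> \<bullet> \<theta>)) \<cdot>\<^sub>v \<theta>)"

definition drop_span :: "real \<Rightarrow> real mat \<Rightarrow> real vec \<Rightarrow> real vec \<Rightarrow> real vec" where
  "drop_span l W \<theta> x = x - W *\<^sub>v drop_coef l W \<theta> x"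

lemma sum_lessThan_add: "(\<Sum>i<m + (k::nat). f i) = (\<Sum>i<m. f i) + (\<Sum>i<k. f (m + i) :: real)"
  by (induction k) auto

context
  fixes d p :: nat and W :: "real mat" and \<theta> :: "real vec" and l :: real
  assumes W: "W \<in> carrier_mat p d" and \<theta>: "\<theta> \<in> carrier_vec d" and \<theta>0: "\<theta> \<bullet> \<theta> \<noteq> 0" and l: "0 < l"
    and WW: "transpose_mat W * W = l \<cdot>\<^sub>m 1\<^sub>m d"
begin

lemma transpose_mult_scaled_isometry: "a \<in> carrier_vec d \<Longrightarrow> transpose_mat W *\<^sub>v (W *\<^sub>v a) = l \<cdot>\<^sub>v a"
proof -
  assume a: "a \<in> carrier_vec d"
  have "transpose_mat W *\<^sub>v (W *\<^sub>v a) = (transpose_mat W * W) *\<^sub>v a"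
    using W a by (intro assoc_mult_mat_vec[symmetric, of _ d p _ d]) auto
  also have "\<dots> = l \<cdot>\<^sub>v (1\<^sub>m d *\<^sub>v a)" unfolding WW
    using a by (intro eq_vecI) auto
  finally show ?thesis using a by simp
qed

lemma scalar_prod_scaled_isometry:
  "a \<in> carrier_vec d \<Longrightarrow> b \<in> carrier_vec d \<Longrightarrow> (W *\<^sub>v a) \<bullet> (W *\<^sub>v b) = l * (a \<bullet> b)"
  using transpose_mult_scalar[OF W mult_mat_vec_carrier[OF W], of a b] W
  by (simp add: transpose_mult_scaled_isometry)

lemma drop_coef_carrier: "x \<in> carrier_vec p \<Longrightarrow> drop_coef l W \<theta> x \<in> carrier_vec d"
  using W \<theta> by (auto simp: drop_coef_def intro!: mult_mat_vec_carrier[of _ d p])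

lemma drop_span_carrier: "x \<in> carrier_vec p \<Longrightarrow> drop_span l W \<theta> x \<in> carrier_vec p"
  using W drop_coef_carrier[of x] by (auto simp: drop_span_def intro!: mult_mat_vec_carrier[of _ p d])

lemma drop_coef_orth: "x \<in> carrier_vec p \<Longrightarrow> drop_coef l W \<theta> x \<bullet> \<theta> = 0"
proof -
  assume x: "x \<in> carrier_vec p"
  have "transpose_mat W *\<^sub>v x \<in> carrier_vec d" using W x by (intro mult_mat_vec_carrier[of _ d p]) auto
  then show ?thesis
    using \<theta> \<theta>0 comm_scalar_prod[of "transpose_mat W *\<^sub>v x" d \<theta>]
    by (simp add: drop_coef_def minus_scalar_prod_distrib[of _ d])
qed

lemma drop_span_orth:
  assumes x: "x \<in> carrier_vec p" and a: "a \<in> carrier_vec d" "a \<bullet> \<theta> = 0"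
  shows "(W *\<^sub>v a) \<bullet> drop_span l W \<theta> x = 0"
proof -
  let ?y = "transpose_mat W *\<^sub>v x"
  have y: "?y \<in> carrier_vec d" using W x by (intro mult_mat_vec_carrier[of _ d p]) auto
  have Wa: "W *\<^sub>v a \<in> carrier_vec p" using W a by (intro mult_mat_vec_carrier[of _ p d])
  have "(W *\<^sub>v a) \<bullet> drop_span l W \<theta> x = (W *\<^sub>v a) \<bullet> x - (W *\<^sub>v a) \<bullet> (W *\<^sub>v drop_coef l W \<theta> x)"
    unfolding drop_span_def
    by (rule scalar_prod_minus_distrib[OF Wa x mult_mat_vec_carrier[OF W drop_coef_carrier[OF x]]])
  also have "(W *\<^sub>v a) \<bullet> x = a \<bullet> ?y"
    using transpose_mult_scalar[of "transpose_mat W" d p a x] W a x by simp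
  also have "(W *\<^sub>v a) \<bullet> (W *\<^sub>v drop_coef l W \<theta> x) = l * (a \<bullet> drop_coef l W \<theta> x)"
    using a drop_coef_carrier[OF x] by (intro scalar_prod_scaled_isometry)
  also have "\<dots> = a \<bullet> ?y"
    unfolding drop_coef_def using l a \<theta> y by (simp add: scalar_prod_minus_distrib[of _ d])
  finally show ?thesis by simp
qed

lemma drop_span_add: "x \<in> carrier_vec p \<Longrightarrow> x = drop_span l W \<theta> x + W *\<^sub>v drop_coef l W \<theta> x"
  unfolding drop_span_def using W by (intro eq_vecI) (auto simp del: index_mult_mat_vec)

lemma vnorm_drop_span_le: assumes x: "x \<in> carrier_vec p" shows "vnorm (drop_span l W \<theta> x) \<le> vnorm x"
proof (rule power2_le_imp_le)
  have c: "drop_span l W \<theta> x \<in> carrier_vec p" "W *\<^sub>v drop_coef l W \<theta> x \<in> carrier_vec p"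
    using drop_span_carrier[OF x] drop_coef_carrier[OF x] W by (auto intro!: mult_mat_vec_carrier[of _ p d])
  have "x \<bullet> x = drop_span l W \<theta> x \<bullet> drop_span l W \<theta> x + 2 * (drop_span l W \<theta> x \<bullet> (W *\<^sub>v drop_coef l W \<theta> x))
     + (W *\<^sub>v drop_coef l W \<theta> x) \<bullet> (W *\<^sub>v drop_coef l W \<theta> x)"
    using scalar_prod_self_add[OF c] drop_span_add[OF x] by simp
  moreover have "drop_span l W \<theta> x \<bullet> (W *\<^sub>v drop_coef l W \<theta> x) = 0"
    using drop_span_orth[OF x drop_coef_carrier[OF x] drop_coef_orth[OF x]] comm_scalar_prod[OF c] by simp
  ultimately show "(vnorm (drop_span l W \<theta> x))\<^sup>2 \<le> (vnorm x)\<^sup>2" by (simp add: vnorm_power2)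
qed simp

text \<open>\<open>W \<theta>\<close> is orthogonal to the \<open>W a\<close> with \<open>a\<close>
  orthogonal to \<open>\<theta>\<close>, so a reflection fixing these can only carry it to another
  vector with that property; hence the Gaussian \<open>h\<close> is first replaced by its
  \<open>drop_span\<close>. In the tail estimate the removed part returns as a point of a larger
  span, generated by the rows of \<open>U\<close> and all columns of \<open>W\<close>. This accounts
  for \<open>n + d\<close>.\<close>

lemma gauss_fn_near_span_tail:
  assumes p: "0 < p" and t: "0 < t" "4 * real (n + d) / real p \<le> 1 - t"
    and w: "vec p w = W *\<^sub>v \<theta>"
  shows "emeasure (gauss_fn ({..<n} \<times> {..<p})) {U \<in> space (gauss_fn ({..<n} \<times> {..<p})). (U, w) \<in> near_span d n p W \<theta> t}
     \<le> ennreal (tail_bound (n + d) p)"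
proof -
  let ?M = "gauss_fn ({..<n} \<times> {..<p}) :: (nat \<times> nat \<Rightarrow> real) measure"
  let ?N = "gauss_fn {..<p} :: (nat \<Rightarrow> real) measure"
  interpret M: prob_space ?M by (rule prob_space_gauss_fn)
  define Ph where "Ph h j = (if j < p then drop_span l W \<theta> (vec p h) $ j else 0)" for h j
  have Ph: "vec p (Ph h) = drop_span l W \<theta> (vec p h)" for h
    using drop_span_carrier[of "vec p h"] by (intro eq_vecI) (auto simp: Ph_def)
  have Ph_meas: "(\<lambda>h. Ph h j) \<in> borel_measurable ?N" for j
  proof (cases "j < p")
    case True
    \<comment> \<open>Unfolding the projection into finite sums of coordinates serves measurability
      only.\<close>
    have "Ph h j = h j - (\<Sum>k<d. W $$ (j, k) * (1 / l * ((\<Sum>i<p. W $$ (i, k) * h i) -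
        (\<Sum>m<d. \<theta> $ m * (\<Sum>i<p. W $$ (i, m) * h i)) / (\<theta> \<bullet> \<theta>) * \<theta> $ k)))" for h
    proof -
      have Wh: "(transpose_mat W *\<^sub>v vec p h) $ k = (\<Sum>i<p. W $$ (i, k) * h i)" if "k < d" for k
        using W that by (simp add: scalar_prod_def atLeast0LessThan)
      have "\<theta> \<bullet> (transpose_mat W *\<^sub>v vec p h) = (\<Sum>m<d. \<theta> $ m * (\<Sum>i<p. W $$ (i, m) * h i))"
        using W by (simp add: scalar_prod_sum_lessThan[of _ d] Wh del: index_mult_mat_vec)
      then have dc: "drop_coef l W \<theta> (vec p h) $ k = 1 / l * ((\<Sum>i<p. W $$ (i, k) * h i) -
        (\<Sum>m<d. \<theta> $ m * (\<Sum>i<p. W $$ (i, m) * h i)) / (\<theta> \<bullet> \<theta>) * \<theta> $ k)" if "k < d" for k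
        using that W \<theta> by (simp add: drop_coef_def Wh del: index_mult_mat_vec)
      have "(W *\<^sub>v drop_coef l W \<theta> (vec p h)) $ j = (\<Sum>k<d. W $$ (j, k) * drop_coef l W \<theta> (vec p h) $ k)"
        using True W drop_coef_carrier[of "vec p h"] by (simp add: scalar_prod_def atLeast0LessThan)
      also have "\<dots> = (\<Sum>k<d. W $$ (j, k) * (1 / l * ((\<Sum>i<p. W $$ (i, k) * h i) -
        (\<Sum>m<d. \<theta> $ m * (\<Sum>i<p. W $$ (i, m) * h i)) / (\<theta> \<bullet> \<theta>) * \<theta> $ k)))"
        by (intro sum.cong refl) (simp only: dc lessThan_iff)
      finally show ?thesis using True W by (simp add: Ph_def drop_span_def del: index_mult_mat_vec)
    qed
    then show ?thesis by simp
  qed (simp add: Ph_def)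
  have zero: "vec p (Ph h) = 0\<^sub>v p \<longleftrightarrow> (\<forall>j\<in>{..<p}. Ph h j = 0)" for h
    by (auto simp: vec_eq_iff)
  have Wth: "W *\<^sub>v \<theta> \<in> carrier_vec p" using W \<theta> by (rule mult_mat_vec_carrier)
  define S where "S = {x \<in> space (?M \<Otimes>\<^sub>M ?N). vec p (Ph (snd x)) = 0\<^sub>v p \<or> (fst x, Ph (snd x)) \<in> near_span d n p W \<theta> t}"
  have [measurable]: "(\<lambda>x. Ph (snd x) j) \<in> borel_measurable (?M \<Otimes>\<^sub>M ?N)" for j
    by (rule measurable_compose[OF measurable_snd Ph_meas])
  have S: "S \<in> sets (?M \<Otimes>\<^sub>M ?N)"
  proof -
    have "{x \<in> space (?M \<Otimes>\<^sub>M ?N). (fst x, Ph (snd x)) \<in> near_span d n p W \<theta> t} \<in> sets (?M \<Otimes>\<^sub>M ?N)"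
      by (rule measurable_near_span[OF W]) measurable
    moreover have "{x \<in> space (?M \<Otimes>\<^sub>M ?N). \<forall>j\<in>{..<p}. Ph (snd x) j = 0} \<in> sets (?M \<Otimes>\<^sub>M ?N)"
      by measurable
    moreover have "S = {x \<in> space (?M \<Otimes>\<^sub>M ?N). \<forall>j\<in>{..<p}. Ph (snd x) j = 0} \<union>
       {x \<in> space (?M \<Otimes>\<^sub>M ?N). (fst x, Ph (snd x)) \<in> near_span d n p W \<theta> t}"
      unfolding S_def zero by auto
    ultimately show ?thesis by simp
  qed
  show ?thesis
  proof (rule M.le_by_averaging[OF prob_space_gauss_fn S])
    show "AE h in ?N. emeasure ?M {U \<in> space ?M. (U, w) \<in> near_span d n p W \<theta> t} \<le> emeasure ?M ((\<lambda>U. (U, h)) -` S)"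
    proof (rule AE_I2)
      fix h assume h: "h \<in> space ?N"
      show "emeasure ?M {U \<in> space ?M. (U, w) \<in> near_span d n p W \<theta> t} \<le> emeasure ?M ((\<lambda>U. (U, h)) -` S)"
      proof (cases "vec p (Ph h) = 0\<^sub>v p")
        case True
        then have "(\<lambda>U. (U, h)) -` S = space ?M" using h by (auto simp: S_def space_pair_measure)
        then show ?thesis by (auto intro: emeasure_mono)
      next
        case P0: False
        let ?K = "\<lambda>x. {U \<in> space ?M. (U, x) \<in> near_span d n p W \<theta> t}"
        have Kset: "?K x \<in> sets ?M" for x
          by (rule measurable_near_span[OF W]) measurable
        \<comment> \<open>Stretches the projected Gaussian vector to the length of
          \<open>W \<theta>\<close>, as the reflection requires.\<close>
        define s where "s = vnorm (vec p w) / vnorm (vec p (Ph h))"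
        have w0: "vnorm (vec p w) \<noteq> 0"
        proof -
          have "vec p w \<bullet> vec p w = l * (\<theta> \<bullet> \<theta>)" unfolding w using \<theta> by (simp add: scalar_prod_scaled_isometry)
          then show ?thesis using l \<theta>0 vnorm_power2[of "vec p w"] by auto
        qed
        have Pn: "vnorm (vec p (Ph h)) \<noteq> 0" using P0 vnorm_eq_0[of "vec p (Ph h)" p] by simp
        have s0: "s \<noteq> 0" using w0 Pn by (simp add: s_def)
        define x where "x j = s * Ph h j" for j
        have x: "vec p x = s \<cdot>\<^sub>v vec p (Ph h)" by (rule eq_vecI) (auto simp: x_def)
        have x': "vec p (Ph h) = (1 / s) \<cdot>\<^sub>v vec p x" using s0 by (simp add: x smult_smult_assoc)
        have xn: "vnorm (vec p w) = vnorm (vec p x)"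
          using Pn w0 by (simp add: x vnorm_smult s_def)
        have "emeasure ?M (?K w) \<le> emeasure ?M (?K x)"
        proof (cases "vec p w = vec p x")
          case True
          then show ?thesis by (simp add: near_span_def)
        next
          case neq: False
          have orth: "(W *\<^sub>v a) \<bullet> (vec p w - vec p x) = 0" if a: "a \<in> carrier_vec d" "a \<bullet> \<theta> = 0" for a
          proof -
            have Wa: "W *\<^sub>v a \<in> carrier_vec p" using W a by (intro mult_mat_vec_carrier)
            have "(W *\<^sub>v a) \<bullet> vec p w = l * (a \<bullet> \<theta>)" unfolding w using a \<theta> by (intro scalar_prod_scaled_isometry)
            moreover have "(W *\<^sub>v a) \<bullet> vec p x = s * ((W *\<^sub>v a) \<bullet> drop_span l W \<theta> (vec p h))"
              unfolding x Ph using Wa drop_span_carrier[of "vec p h"] by simp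
            ultimately show ?thesis using Wa a drop_span_orth[of "vec p h" a]
              by (simp add: scalar_prod_minus_distrib[of _ p])
          qed
          obtain v where v1: "(\<Sum>j<p. (v j)\<^sup>2) = 1"
            and v2: "\<And>U. (U, w) \<in> near_span d n p W \<theta> t \<Longrightarrow>
              ((\<lambda>(i, j)\<in>{..<n} \<times> {..<p}. U (i, j) - of_bool (i < n) * 2 * (\<Sum>k<p. v k * U (i, k)) * v j), x) \<in> near_span d n p W \<theta> t"
            using near_span_reflect[OF W \<theta> xn neq orth, of n t] by blast
          let ?T = "\<lambda>U. \<lambda>(i, j)\<in>{..<n} \<times> {..<p}. U (i, j) - of_bool (i < n) * 2 * (\<Sum>k<p. v k * U (i, k)) * v j"
          have T: "?T \<in> measurable ?M ?M"
          proof -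
            have "(\<lambda>U. \<lambda>ij\<in>{..<n} \<times> {..<p}. U ij - of_bool (fst ij < n) * 2 * (\<Sum>k<p. v k * U (fst ij, k)) * v (snd ij))
              \<in> measurable ?M (lebesgue_fn ({..<n} \<times> {..<p}))"
              by (intro measurable_restrict) measurable
            then show ?thesis
              by (simp only: case_prod_unfold prod.collapse measurable_cong_sets[OF refl sets_gauss_fn])
          qed
          have "emeasure ?M (?K w) \<le> emeasure ?M (?T -` ?K x \<inter> space ?M)"
          proof (rule emeasure_mono)
            show "?T -` ?K x \<inter> space ?M \<in> sets ?M" by (rule measurable_sets[OF T Kset])
            show "?K w \<subseteq> ?T -` ?K x \<inter> space ?M"
              using v2 measurable_space[OF T] by auto
          qed
          also have "\<dots> = emeasure (distr ?M ?M ?T) (?K x)" by (rule emeasure_distr[OF T Kset, symmetric])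
          also have "distr ?M ?M ?T = ?M" by (rule distr_gauss_fn_reflect_rows[OF v1])
          finally show ?thesis .
        qed
        also have "\<dots> \<le> emeasure ?M ((\<lambda>U. (U, h)) -` S)"
        proof (intro emeasure_mono sets_Pair2[OF S] subsetI)
          fix U assume U: "U \<in> ?K x"
          then have "(U, Ph h) \<in> near_span d n p W \<theta> t"
            using near_span_scale[OF W \<theta> _ x', of U n t] s0 by simp
          then show "U \<in> (\<lambda>U. (U, h)) -` S" using U h by (simp add: S_def space_pair_measure)
        qed
        finally show ?thesis .
      qed
    qed
    show "AE U in ?M. emeasure ?N (Pair U -` S) \<le> ennreal (tail_bound (n + d) p)"
    proof (rule AE_I2)
      fix U assume "U \<in> space ?M"
      \<comment> \<open>The rows of \<open>U\<close> stacked on the columns of \<open>W\<close>, so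
        that the enlarged span is one row space.\<close>
      define X where "X = mat (n + d) p (\<lambda>(i, j). if i < n then U (i, j) else W $$ (j, i - n))"
      have X: "X \<in> carrier_mat (n + d) p" by (simp add: X_def)
      define \<kappa> where "\<kappa> = sqrt (4 * real (n + d) / real p)"
      have k2: "\<kappa>\<^sup>2 \<le> 1 - t" using t by (simp add: \<kappa>_def)
      have k0: "\<kappa> \<ge> 0" by (simp add: \<kappa>_def)
      have span: "\<exists>e\<in>carrier_vec (n + d). transpose_mat X *\<^sub>v e = W *\<^sub>v a + transpose_mat (fmat n p U) *\<^sub>v c"
        if a: "a \<in> carrier_vec d" and c: "c \<in> carrier_vec n" for a c
      proof
        define e where "e = vec (n + d) (\<lambda>i. if i < n then c $ i else a $ (i - n))"
        show "e \<in> carrier_vec (n + d)" by (simp add: e_def)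
        show "transpose_mat X *\<^sub>v e = W *\<^sub>v a + transpose_mat (fmat n p U) *\<^sub>v c"
        proof (rule eq_vecI)
          fix j assume "j < dim_vec (W *\<^sub>v a + transpose_mat (fmat n p U) *\<^sub>v c)"
          then have j: "j < p" by simp
          have "(transpose_mat X *\<^sub>v e) $ j = (\<Sum>i<n + d. X $$ (i, j) * e $ i)"
            using X j by (simp add: e_def scalar_prod_def atLeast0LessThan)
          also have "\<dots> = (\<Sum>i<n. U (i, j) * c $ i) + (\<Sum>i<d. W $$ (j, i) * a $ i)"
            using j by (simp add: sum_lessThan_add X_def e_def)
          also have "(\<Sum>i<d. W $$ (j, i) * a $ i) = (W *\<^sub>v a) $ j"
            using W a j by (simp add: scalar_prod_def atLeast0LessThan)
          finally show "(transpose_mat X *\<^sub>v e) $ j = (W *\<^sub>v a + transpose_mat (fmat n p U) *\<^sub>v c) $ j"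
            using j W by (simp add: index_transpose_fmat_mult_vec[OF c j] del: index_mult_mat_vec)
        qed (use X W in auto)
      qed
      show "emeasure ?N (Pair U -` S) \<le> ennreal (tail_bound (n + d) p)"
      proof (rule gauss_fn_correlation_tail[OF X p sets_Pair1[OF S]])
        fix h assume h: "h \<in> Pair U -` S"
        let ?h = "vec p h"
        let ?b = "drop_coef l W \<theta> ?h"
        have hc: "?h \<in> carrier_vec p" by simp
        have b: "?b \<in> carrier_vec d" by (rule drop_coef_carrier[OF hc])
        have Wb: "W *\<^sub>v ?b \<in> carrier_vec p" using W b by (intro mult_mat_vec_carrier)
        have "?h = 0\<^sub>v p \<or> (\<exists>e\<in>carrier_vec (n + d). (vnorm (?h - transpose_mat X *\<^sub>v e))\<^sup>2 < t * (vnorm ?h)\<^sup>2)"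
        proof (cases "vec p (Ph h) = 0\<^sub>v p")
          \<comment> \<open>Here \<open>h\<close> equals its removed part, so it lies in the
            enlarged span itself, at distance zero.\<close>
          case True
          have z: "0\<^sub>v n \<in> carrier_vec n" by simp
          obtain e where e: "e \<in> carrier_vec (n + d)" "transpose_mat X *\<^sub>v e = W *\<^sub>v ?b + transpose_mat (fmat n p U) *\<^sub>v 0\<^sub>v n"
            using span[OF b z] by blast
          have "transpose_mat (fmat n p U) *\<^sub>v 0\<^sub>v n = 0\<^sub>v p" by (rule eq_vecI) (auto simp: scalar_prod_def)
          then have "transpose_mat X *\<^sub>v e = ?h"
            using e(2) Wb drop_span_add[OF hc] True by (simp add: Ph)
          then have "vnorm (?h - transpose_mat X *\<^sub>v e) = 0" by simp
          moreover have "0 < (vnorm ?h)\<^sup>2" if "?h \<noteq> 0\<^sub>v p" using that vnorm_eq_0[OF hc] by simp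
          ultimately show ?thesis using e(1) t by (metis mult_pos_pos zero_power2)
        next
          case False
          then have "(U, Ph h) \<in> near_span d n p W \<theta> t" using h by (simp add: S_def)
          then obtain c a where c: "c \<in> carrier_vec n" and a: "a \<in> carrier_vec d" "a \<bullet> \<theta> = 0"
            and less: "(vnorm (drop_span l W \<theta> ?h - (W *\<^sub>v a + transpose_mat (fmat n p U) *\<^sub>v c)))\<^sup>2 < t * (vnorm (drop_span l W \<theta> ?h))\<^sup>2"
            by (auto simp: near_span_def Ph)
          have ab: "a + ?b \<in> carrier_vec d" using a b by simp
          obtain e where e: "e \<in> carrier_vec (n + d)" "transpose_mat X *\<^sub>v e = W *\<^sub>v (a + ?b) + transpose_mat (fmat n p U) *\<^sub>v c"
            using span[OF ab c] by blast
          have Wa: "W *\<^sub>v a \<in> carrier_vec p" and Uc: "transpose_mat (fmat n p U) *\<^sub>v c \<in> carrier_vec p"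
            using W a c by (auto intro: mult_mat_vec_carrier[of _ p d] mult_mat_vec_carrier[of _ p n])
          have "W *\<^sub>v (a + ?b) = W *\<^sub>v a + W *\<^sub>v ?b" by (rule mult_add_distrib_mat_vec[OF W a(1) b])
          then have "?h - transpose_mat X *\<^sub>v e = drop_span l W \<theta> ?h - (W *\<^sub>v a + transpose_mat (fmat n p U) *\<^sub>v c)"
            unfolding e(2) drop_span_def using W Wa Wb Uc by (intro eq_vecI) (auto simp del: index_mult_mat_vec)
          then have "(vnorm (?h - transpose_mat X *\<^sub>v e))\<^sup>2 < t * (vnorm (drop_span l W \<theta> ?h))\<^sup>2"
            using less by simp
          also have "\<dots> \<le> t * (vnorm ?h)\<^sup>2"
            using t vnorm_drop_span_le[OF hc] by (intro mult_left_mono power_mono) auto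
          finally show ?thesis using e(1) by blast
        qed
        moreover have "\<kappa> * vnorm (transpose_mat X *\<^sub>v e) * vnorm ?h < (transpose_mat X *\<^sub>v e) \<bullet> ?h"
          if e: "e \<in> carrier_vec (n + d)" and less: "(vnorm (?h - transpose_mat X *\<^sub>v e))\<^sup>2 < t * (vnorm ?h)\<^sup>2" for e
        proof -
          let ?y = "transpose_mat X *\<^sub>v e"
          have y: "?y \<in> carrier_vec p" using X e by (intro mult_mat_vec_carrier[of _ p "n + d"]) auto
          have "(vnorm (?h - ?y))\<^sup>2 = (vnorm ?h)\<^sup>2 - 2 * (?y \<bullet> ?h) + (vnorm ?y)\<^sup>2"
            using scalar_prod_self_diff[OF hc y] comm_scalar_prod[OF hc y] by (simp add: vnorm_power2)
          then have "2 * (?y \<bullet> ?h) > (1 - t) * (vnorm ?h)\<^sup>2 + (vnorm ?y)\<^sup>2"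
            using less by (simp add: algebra_simps)
          moreover have "(1 - t) * (vnorm ?h)\<^sup>2 \<ge> \<kappa>\<^sup>2 * (vnorm ?h)\<^sup>2"
            using k2 by (intro mult_right_mono) auto
          \<comment> \<open>Nearness becomes correlation: expanding the squared distance bounds
            twice the inner product from below, and the arithmetic-geometric mean inequality turns
            that bound into a product of lengths.\<close>
          moreover have "\<kappa>\<^sup>2 * (vnorm ?h)\<^sup>2 + (vnorm ?y)\<^sup>2 \<ge> 2 * (\<kappa> * vnorm ?y * vnorm ?h)"
            using zero_le_power2[of "\<kappa> * vnorm ?h - vnorm ?y"] by (simp add: power2_diff power_mult_distrib mult_ac)
          ultimately show ?thesis by linarith
        qed
        ultimately show "?h = 0\<^sub>v p \<or> (\<exists>c\<in>carrier_vec (n + d). sqrt (4 * real (n + d) / real p) *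
           vnorm (transpose_mat X *\<^sub>v c) * vnorm ?h < (transpose_mat X *\<^sub>v c) \<bullet> ?h)"
          unfolding \<kappa>_def[symmetric] by blast
      qed
    qed
  qed
qed

end

section \<open>The risk functional\<close>

lemma std_normal_moments:
  defines "N \<equiv> density lborel std_normal_density"
  shows "integrable N (\<lambda>x. x)" "integrable N (\<lambda>x. x\<^sup>2)" "integral\<^sup>L N (\<lambda>x. x) = 0" "integral\<^sup>L N (\<lambda>x. x\<^sup>2) = 1"
proof -
  show "integrable N (\<lambda>x. x)" "integrable N (\<lambda>x. x\<^sup>2)"
    unfolding N_def using integrable_std_normal_moment[of 1] integrable_std_normal_moment[of 2]
    by (subst integrable_density; simp)+
  have "integral\<^sup>L N (\<lambda>x. x) = integral\<^sup>L lborel (\<lambda>x. std_normal_density x *\<^sub>R x)"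
    unfolding N_def by (rule integral_density) auto
  then show "integral\<^sup>L N (\<lambda>x. x) = 0"
    using integral_std_normal_moment_odd[of 0] by simp
  have "integral\<^sup>L N (\<lambda>x. x\<^sup>2) = integral\<^sup>L lborel (\<lambda>x. std_normal_density x *\<^sub>R x\<^sup>2)"
    unfolding N_def by (rule integral_density) auto
  then show "integral\<^sup>L N (\<lambda>x. x\<^sup>2) = 1"
    using integral_std_normal_moment_even[of 1] by simp
qed

lemma gauss_fn_moments:
  assumes fin: "finite I" and i: "i \<in> I" and j: "j \<in> I"
  shows "integrable (gauss_fn I) (\<lambda>x. x i)" "integral\<^sup>L (gauss_fn I) (\<lambda>x. x i) = 0"
    "integrable (gauss_fn I) (\<lambda>x. x i * x j)" "integral\<^sup>L (gauss_fn I) (\<lambda>x. x i * x j) = of_bool (i = j)"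
proof -
  let ?N = "density lborel std_normal_density"
  interpret N: prob_space ?N by (rule prob_space_normal_density) simp
  note mom = std_normal_moments
  define f :: "'a \<Rightarrow> real \<Rightarrow> real" where "f k x = (if k = i then x else 1)" for k x
  have f: "(\<Prod>k\<in>I. f k (x k)) = x i" for x
    using fin i by (simp add: f_def)
  have fi: "integrable ?N (f k)" for k using mom by (cases "k = i") (auto simp: f_def[abs_def])
  have fI: "integral\<^sup>L ?N (f k) = (if k = i then 0 else 1)" for k
    using mom N.prob_space by (cases "k = i") (auto simp: f_def[abs_def])
  show "integrable (gauss_fn I) (\<lambda>x. x i)"
    using gauss_prod.product_integrable_prod[OF fin, of f] fi by (simp add: f gauss_fn_def)
  show "integral\<^sup>L (gauss_fn I) (\<lambda>x. x i) = 0"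
    using gauss_prod.product_integral_prod[OF fin, of f] fi fin i by (simp add: f gauss_fn_def fI)
  define g :: "'a \<Rightarrow> real \<Rightarrow> real" where "g k x = (if k = i then x else 1) * (if k = j then x else 1)" for k x
  have g: "(\<Prod>k\<in>I. g k (x k)) = x i * x j" for x
    using fin i j by (simp add: g_def prod.distrib)
  have gi: "integrable ?N (g k)" for k
    using mom by (cases "k = i"; cases "k = j") (auto simp: g_def[abs_def] power2_eq_square[symmetric])
  \<comment> \<open>The factor is \<open>x\<^sup>2\<close> or 1 when \<open>k\<close> matches both
    or neither of \<open>i\<close> and \<open>j\<close>, with mean 1; if it matches exactly one, it
    is \<open>x\<close>, with mean 0.\<close>
  have gI: "integral\<^sup>L ?N (g k) = (if (k = i) = (k = j) then 1 else 0)" for k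
    using mom N.prob_space by (cases "k = i"; cases "k = j") (auto simp: g_def[abs_def] power2_eq_square[symmetric])
  show "integrable (gauss_fn I) (\<lambda>x. x i * x j)"
    using gauss_prod.product_integrable_prod[OF fin, of g] gi by (simp add: g gauss_fn_def)
  have "integral\<^sup>L (gauss_fn I) (\<lambda>x. x i * x j) = (\<Prod>k\<in>I. if (k = i) = (k = j) then 1 else 0)"
    using gauss_prod.product_integral_prod[OF fin, of g] gi by (simp add: g gauss_fn_def gI)
  also have "\<dots> = of_bool (i = j)"
    using fin i by (cases "i = j") auto
  finally show "integral\<^sup>L (gauss_fn I) (\<lambda>x. x i * x j) = of_bool (i = j)" .
qed

lemma gauss_fn_affine_square:
  assumes fin: "finite I"
  shows "(\<integral>\<^sup>+x. ennreal ((r + (\<Sum>i\<in>I. a i * x i))\<^sup>2) \<partial>gauss_fn I) = ennreal (r\<^sup>2 + (\<Sum>i\<in>I. (a i)\<^sup>2))"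
proof -
  interpret prob_space "gauss_fn I" by (rule prob_space_gauss_fn)
  note mom = gauss_fn_moments[OF fin]
  have eq: "(r + (\<Sum>i\<in>I. a i * x i))\<^sup>2 = r\<^sup>2 + 2 * r * (\<Sum>i\<in>I. a i * x i) + (\<Sum>i\<in>I. \<Sum>j\<in>I. a i * a j * (x i * x j))" for x
    by (simp add: power2_eq_square sum_product algebra_simps)
  have int: "integrable (gauss_fn I) (\<lambda>x. (r + (\<Sum>i\<in>I. a i * x i))\<^sup>2)"
    unfolding eq using mom by (intro Bochner_Integration.integrable_add Bochner_Integration.integrable_sum integrable_mult_right) auto
  have "(\<integral>x. (r + (\<Sum>i\<in>I. a i * x i))\<^sup>2 \<partial>gauss_fn I) = r\<^sup>2 + 2 * r * (\<Sum>i\<in>I. a i * 0) + (\<Sum>i\<in>I. \<Sum>j\<in>I. a i * a j * of_bool (i = j))"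
  proof -
    have i1: "integrable (gauss_fn I) (\<lambda>x. \<Sum>i\<in>I. a i * x i)"
      using mom by (intro Bochner_Integration.integrable_sum integrable_mult_right) auto
    have i2: "integrable (gauss_fn I) (\<lambda>x. \<Sum>j\<in>I. a i * a j * (x i * x j))" if "i \<in> I" for i
      using mom that by (intro Bochner_Integration.integrable_sum integrable_mult_right) auto
    have e1: "(\<integral>x. (\<Sum>i\<in>I. a i * x i) \<partial>gauss_fn I) = (\<Sum>i\<in>I. a i * 0)"
      using mom by (subst Bochner_Integration.integral_sum) auto
    have e2: "(\<integral>x. (\<Sum>i\<in>I. \<Sum>j\<in>I. a i * a j * (x i * x j)) \<partial>gauss_fn I) = (\<Sum>i\<in>I. \<Sum>j\<in>I. a i * a j * of_bool (i = j))"
      using i2 mom by (subst Bochner_Integration.integral_sum, simp, intro sum.cong refl,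
        subst Bochner_Integration.integral_sum) (auto intro!: sum.cong simp del: of_bool_eq_iff)
    have i3: "integrable (gauss_fn I) (\<lambda>x. \<Sum>i\<in>I. \<Sum>j\<in>I. a i * a j * (x i * x j))"
      by (rule Bochner_Integration.integrable_sum[OF i2])
    show ?thesis unfolding eq
      using i1 i3 by (simp add: e1 e2 prob_space)
  qed
  also have "\<dots> = r\<^sup>2 + (\<Sum>i\<in>I. (a i)\<^sup>2)"
    using fin by (simp add: of_bool_def power2_eq_square if_distrib[of "\<lambda>z. _ * z"] cong: if_cong)
  finally show ?thesis
    using int by (subst nn_integral_eq_integral) auto
qed

text \<open>The prediction error is the linear form with coefficients
  \<open>W^T b - \<theta>\<close> in \<open>z\<close> and \<open>b\<close> in \<open>u\<close>; its
  second moment under independent standard Gaussians is the sum of squared coefficients. Neither the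
  covariance of \<open>x\<close> nor the population parameter is involved in this form.\<close>

lemma risk_eq:
  assumes W: "W \<in> carrier_mat p d" and \<theta>: "\<theta> \<in> carrier_vec d" and b: "b \<in> carrier_vec p"
  shows "risk d p W \<theta> b = (vnorm (transpose_mat W *\<^sub>v b - \<theta>))\<^sup>2 + (vnorm b)\<^sup>2"
proof -
  let ?A = "gauss_fn {..<d} :: (nat \<Rightarrow> real) measure" and ?B = "gauss_fn {..<p} :: (nat \<Rightarrow> real) measure"
  interpret B: prob_space ?B by (rule prob_space_gauss_fn)
  define \<alpha> where "\<alpha> = transpose_mat W *\<^sub>v b - \<theta>"
  have Wb: "transpose_mat W *\<^sub>v b \<in> carrier_vec d" using W b by (intro mult_mat_vec_carrier[of _ d p]) auto
  have \<alpha>: "\<alpha> \<in> carrier_vec d" using Wb \<theta> by (simp add: \<alpha>_def)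
  have eq: "(W *\<^sub>v vec d z + vec p u) \<bullet> b - vec d z \<bullet> \<theta> = (\<Sum>i<d. \<alpha> $ i * z i) + (\<Sum>j<p. b $ j * u j)" for z u
  proof -
    have Wz: "W *\<^sub>v vec d z \<in> carrier_vec p" using W by (intro mult_mat_vec_carrier) auto
    have "(W *\<^sub>v vec d z + vec p u) \<bullet> b = (W *\<^sub>v vec d z) \<bullet> b + vec p u \<bullet> b"
      using Wz b by (intro add_scalar_prod_distrib) auto
    also have "(W *\<^sub>v vec d z) \<bullet> b = vec d z \<bullet> (transpose_mat W *\<^sub>v b)"
      using transpose_mult_scalar[of "transpose_mat W" d p "vec d z" b] W b by simp
    finally have "(W *\<^sub>v vec d z + vec p u) \<bullet> b - vec d z \<bullet> \<theta> = vec d z \<bullet> \<alpha> + vec p u \<bullet> b"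
      using Wb \<theta> by (simp add: \<alpha>_def scalar_prod_minus_distrib[of _ d])
    then show ?thesis using \<alpha> b by (simp add: scalar_prod_sum_lessThan[of _ d] scalar_prod_sum_lessThan[of _ p] mult.commute)
  qed
  have meas: "(\<lambda>w. ((\<Sum>i<d. \<alpha> $ i * fst w i) + (\<Sum>j<p. b $ j * snd w j))\<^sup>2) \<in> borel_measurable (?A \<Otimes>\<^sub>M ?B)"
    by measurable
  have "risk d p W \<theta> b = (\<integral>w. ((\<Sum>i<d. \<alpha> $ i * fst w i) + (\<Sum>j<p. b $ j * snd w j))\<^sup>2 \<partial>(?A \<Otimes>\<^sub>M ?B))"
    unfolding risk_def eq ..
  also have "\<dots> = enn2real (\<integral>\<^sup>+w. ennreal (((\<Sum>i<d. \<alpha> $ i * fst w i) + (\<Sum>j<p. b $ j * snd w j))\<^sup>2) \<partial>(?A \<Otimes>\<^sub>M ?B))"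
    by (intro integral_eq_nn_integral meas) simp
  also have "(\<integral>\<^sup>+w. ennreal (((\<Sum>i<d. \<alpha> $ i * fst w i) + (\<Sum>j<p. b $ j * snd w j))\<^sup>2) \<partial>(?A \<Otimes>\<^sub>M ?B)) =
     (\<integral>\<^sup>+z. (\<integral>\<^sup>+u. ennreal (((\<Sum>i<d. \<alpha> $ i * z i) + (\<Sum>j<p. b $ j * u j))\<^sup>2) \<partial>?B) \<partial>?A)"
    using B.nn_integral_fst[of "\<lambda>w. ennreal (((\<Sum>i<d. \<alpha> $ i * fst w i) + (\<Sum>j<p. b $ j * snd w j))\<^sup>2)" ?A] meas by simp
  also have "\<dots> = (\<integral>\<^sup>+z. ennreal ((0 + (\<Sum>i<d. \<alpha> $ i * z i))\<^sup>2) + ennreal (\<Sum>j<p. (b $ j)\<^sup>2) \<partial>?A)"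
    by (simp add: gauss_fn_affine_square ennreal_plus[symmetric] sum_nonneg del: ennreal_plus)
  also have "\<dots> = (\<integral>\<^sup>+z. ennreal ((0 + (\<Sum>i<d. \<alpha> $ i * z i))\<^sup>2) \<partial>?A) + ennreal (\<Sum>j<p. (b $ j)\<^sup>2)"
    using prob_space.emeasure_space_1[OF prob_space_gauss_fn, of "{..<d}"]
    by (subst nn_integral_add) auto
  also have "\<dots> = ennreal ((\<Sum>i<d. (\<alpha> $ i)\<^sup>2) + (\<Sum>j<p. (b $ j)\<^sup>2))"
    by (subst gauss_fn_affine_square) (auto simp: sum_nonneg)
  finally have "risk d p W \<theta> b = (\<Sum>i<d. (\<alpha> $ i)\<^sup>2) + (\<Sum>j<p. (b $ j)\<^sup>2)"
    by (simp add: sum_nonneg del: ennreal_plus)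
  then show ?thesis
    unfolding \<alpha>_def[symmetric] vnorm_power2
    using \<alpha> b by (simp add: scalar_prod_sum_lessThan[of _ d] scalar_prod_sum_lessThan[of _ p] power2_eq_square)
qed

section \<open>The risk increment as a function of the data\<close>

text \<open>Gives the definite description its value: the difference of two candidates lies in the
  range and is orthogonal to the range, hence to itself.\<close>

lemma proj_range_eqI:
  assumes v: "v \<in> carrier_vec m" and M: "M \<in> carrier_mat m k"
    and w: "w \<in> colsp M" and orth: "\<And>c. c \<in> carrier_vec k \<Longrightarrow> (v - w) \<bullet> (M *\<^sub>v c) = 0"
  shows "proj_range M v = w"
  unfolding proj_range_def
proof (rule the_equality)
  show "w \<in> colsp M \<and> (\<forall>u\<in>colsp M. (v - w) \<bullet> u = 0)"
    using w orth M by (auto simp: colsp_def)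
next
  fix w' assume w': "w' \<in> colsp M \<and> (\<forall>u\<in>colsp M. (v - w') \<bullet> u = 0)"
  obtain c c' where c: "c \<in> carrier_vec k" "w = M *\<^sub>v c" and c': "c' \<in> carrier_vec k" "w' = M *\<^sub>v c'"
    using w w' M by (auto simp: colsp_def)
  have carr: "w \<in> carrier_vec m" "w' \<in> carrier_vec m" using c c' M by auto
  have "w' - w = M *\<^sub>v (c' - c)" using mult_minus_distrib_mat_vec[OF M c'(1) c(1)] c c' by simp
  moreover have cc: "c' - c \<in> carrier_vec k" using c c' by simp
  ultimately have "(v - w) \<bullet> (w' - w) = 0" "(v - w') \<bullet> (w' - w) = 0"
    using orth[OF cc] w' M by (auto simp: colsp_def)
  then have "(w' - w) \<bullet> (w' - w) = 0"
    using carr v by (simp add: minus_scalar_prod_distrib[of _ m])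
  then have z: "w' - w = 0\<^sub>v m" using carr scalar_prod_self_eq_0[of "w' - w" m] by simp
  have "w' $ i = w $ i" if "i < m" for i
    using arg_cong[OF z, of "\<lambda>x. x $ i"] that carr by simp
  then show "w' = w" using carr by (intro eq_vecI) auto
qed

text \<open>The last identity connects the interpolator with its polynomial multiple, on which the
  measurable events are formulated.\<close>

lemma minv_nonsingular:
  assumes A: "A \<in> carrier_mat n n" and det: "det A \<noteq> 0"
  shows "minv A \<in> carrier_mat n n" "A * minv A = 1\<^sub>m n" "minv A * A = 1\<^sub>m n" "adj_mat A = det A \<cdot>\<^sub>m minv A"
proof -
  have "mat_inverse A \<noteq> None"
    using mat_inverse(1)[OF A, where b = "()"] det_non_zero_imp_unit[OF A det, where b = "()"] by blast
  then obtain B where B: "mat_inverse A = Some B" by auto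
  then have m: "minv A = B" by (simp add: minv_def)
  show *: "minv A \<in> carrier_mat n n" "A * minv A = 1\<^sub>m n" "minv A * A = 1\<^sub>m n"
    using mat_inverse(2)[OF A B] by (auto simp: m)
  have "adj_mat A = (minv A * A) * adj_mat A" using *(3) adj_mat(1)[OF A] by simp
  also have "\<dots> = minv A * (A * adj_mat A)" using * A adj_mat(1)[OF A] by (intro assoc_mult_mat) auto
  also have "\<dots> = det A \<cdot>\<^sub>m (minv A * 1\<^sub>m n)"
    unfolding adj_mat(2)[OF A] using * by (intro mult_smult_distrib) auto
  finally show "adj_mat A = det A \<cdot>\<^sub>m minv A" using * by simp
qed

lemma minv_singular:
  assumes A: "A \<in> carrier_mat n n" and det: "det A = 0"
  shows "minv A = 0\<^sub>m n n"
proof (cases "mat_inverse A")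
  case None
  then show ?thesis using A by (simp add: minv_def)
next
  case (Some B)
  then have "A * B = 1\<^sub>m n" "B \<in> carrier_mat n n" using mat_inverse(2)[OF A] by auto
  then have "det A * det B = 1" using det_mult[OF A, of B] by simp
  then show ?thesis using det by simp
qed

lemma zero_mat_mult_vec: "v \<in> carrier_vec k \<Longrightarrow> 0\<^sub>m m k *\<^sub>v v = (0\<^sub>v m :: real vec)"
  by (intro eq_vecI) (auto simp: scalar_prod_def)

lemma mult_mat_zero_vec: "M \<in> carrier_mat m k \<Longrightarrow> M *\<^sub>v 0\<^sub>v k = (0\<^sub>v m :: real vec)"
  by (intro eq_vecI) (auto simp: scalar_prod_def)

lemma proj_range_zero: "M \<in> carrier_mat m k \<Longrightarrow> proj_range M (0\<^sub>v m) = 0\<^sub>v m"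
proof (rule proj_range_eqI[of _ m _ k])
  assume M: "M \<in> carrier_mat m k"
  show "0\<^sub>v m \<in> colsp M" using mult_mat_zero_vec[OF M] M by (auto simp: colsp_def intro!: exI[of _ "0\<^sub>v k"])
  show "(0\<^sub>v m - 0\<^sub>v m) \<bullet> (M *\<^sub>v c) = 0" if "c \<in> carrier_vec k" for c
    using M that mult_mat_vec_carrier[OF M that] by simp
qed auto

section \<open>The deterministic bound on the risk increment\<close>

text \<open>Here \<open>s\<close> is \<open>sqrt (n / p)\<close>, \<open>l\<close> is
  \<open>p \<gamma>\<close>, and \<open>T\<close> and \<open>b\<close> are the lengths of
  \<open>\<theta>\<close> and of the task-A interpolator. Further, \<open>u\<close> is the length of
  \<open>W^T b - \<theta>\<close>, \<open>x\<close> that of its change, and \<open>B\<close> the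
  squared length of the sequential estimator. The terms with \<open>s\<close> add up to
  \<open>39 s T^2\<close>.\<close>

lemma risk_increment_numeric:
  fixes s l T b x u B :: real
  assumes s: "0 \<le> s" "s \<le> 1 / 4" and l: "0 < l" and T: "0 \<le> T" and b: "0 \<le> b"
    and bT: "l * b\<^sup>2 \<le> 17 / 9 * T\<^sup>2" and x: "0 \<le> x" "x \<le> 4 * s * (sqrt l * b)"
    and u: "0 \<le> u" "u \<le> sqrt l * b + T" and B: "B \<le> 2 * b\<^sup>2"
  shows "2 * u * x + x\<^sup>2 + B - b\<^sup>2 \<le> (66 * s + 12 / l) * T\<^sup>2"
proof -
  \<comment> \<open>The factor 3/2 comes from 17/9 \<le> 9/4; it leads to 5/2 for \<open>u\<close>
    and to 6 for \<open>x\<close>.\<close>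
  have "(sqrt l * b)\<^sup>2 \<le> (3 / 2 * T)\<^sup>2"
  proof -
    have "(sqrt l * b)\<^sup>2 = l * b\<^sup>2" "(3 / 2 * T)\<^sup>2 = 9 / 4 * T\<^sup>2"
      using l by (simp_all add: power_mult_distrib power_divide)
    then show ?thesis using bT zero_le_power2[of T] by linarith
  qed
  then have lb: "sqrt l * b \<le> 3 / 2 * T" by (rule power2_le_imp_le) (use T in simp)
  have x6: "x \<le> 6 * s * T"
  proof -
    have "4 * s * (sqrt l * b) \<le> 4 * s * (3 / 2 * T)" using lb s by (intro mult_left_mono) auto
    with x(2) have "x \<le> 4 * s * (3 / 2 * T)" by (rule order_trans)
    then show ?thesis by (simp add: mult_ac)
  qed
  have u5: "u \<le> 5 / 2 * T" using u lb by simp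
  have "2 * u * x \<le> 2 * (5 / 2 * T) * (6 * s * T)" using u5 x6 u x T by (intro mult_mono) auto
  also have "\<dots> = 30 * s * T\<^sup>2" by (simp add: power2_eq_square)
  finally have 1: "2 * u * x \<le> 30 * s * T\<^sup>2" .
  have "x\<^sup>2 \<le> (6 * s * T)\<^sup>2" using x x6 by (intro power_mono) auto
  also have "\<dots> = 36 * s * (s * T\<^sup>2)" by (simp add: power2_eq_square)
  \<comment> \<open>The bound \<open>s \<le> 1 / 4\<close> trades one factor \<open>s\<close> for a
    constant, making the quadratic term linear in \<open>s\<close>.\<close>
  also have "\<dots> \<le> 36 * s * (1 / 4 * T\<^sup>2)" using s by (intro mult_left_mono mult_right_mono) auto
  finally have 2: "x\<^sup>2 \<le> 9 * s * T\<^sup>2" by simp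
  have "b\<^sup>2 \<le> 12 / l * T\<^sup>2"
  proof -
    have "l * b\<^sup>2 \<le> 12 * T\<^sup>2" using bT zero_le_power2[of T] by linarith
    then have "(l * b\<^sup>2) / l \<le> (12 * T\<^sup>2) / l" using l by (intro divide_right_mono) auto
    then show ?thesis using l by simp
  qed
  moreover have "39 * s * T\<^sup>2 \<le> 66 * s * T\<^sup>2" using s by (intro mult_right_mono) auto
  ultimately show ?thesis using 1 2 B by (simp add: distrib_right)
qed

text \<open>The vector \<open>b'\<close> is the task-A interpolator multiplied by \<open>det (X X\<^sup>T)\<close>: it is polynomial in the data,
  and the two correlation hypotheses are invariant under this rescaling.\<close>
lemma risk_increment_le:
  fixes Z U :: "nat \<times> nat \<Rightarrow> real"
  assumes dnp: "0 < n" "17 * real n \<le> real p"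
    and l: "0 < l" and \<theta>: "\<theta> \<in> carrier_vec d" and W: "W \<in> carrier_mat p d"
    and WW: "transpose_mat W * W = l \<cdot>\<^sub>m 1\<^sub>m d"
    and R: "orth_mat p (fmat p p Om)"
  defines "X \<equiv> XA d n p W Z U" and "\<kappa> \<equiv> 2 * sqrt (real n / real p)"
  defines "b' \<equiv> transpose_mat X *\<^sub>v (adj_mat (X * transpose_mat X) *\<^sub>v yA d n \<theta> Z)"
  assumes H1: "\<And>c a. c \<in> carrier_vec n \<Longrightarrow> a \<in> carrier_vec d \<Longrightarrow> a \<bullet> \<theta> = 0 \<Longrightarrow> \<theta> \<bullet> \<theta> \<noteq> 0 \<Longrightarrow>
      9 / 17 * (vnorm (W *\<^sub>v \<theta>))\<^sup>2 \<le> (vnorm (W *\<^sub>v \<theta> - (W *\<^sub>v a + transpose_mat (fmat n p U) *\<^sub>v c)))\<^sup>2"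
    and H2: "\<And>c. c \<in> carrier_vec n \<Longrightarrow>
      (transpose_mat X *\<^sub>v c) \<bullet> (transpose_mat (fmat p p Om) *\<^sub>v b') \<le> \<kappa> * vnorm (transpose_mat X *\<^sub>v c) * vnorm b'"
    and H3: "\<And>c. c \<in> carrier_vec d \<Longrightarrow>
      (W *\<^sub>v c) \<bullet> (fmat p p Om *\<^sub>v b') \<le> \<kappa> * vnorm (W *\<^sub>v c) * vnorm b'"
  shows "risk d p W \<theta> (beta_BA d n p W \<theta> Z U Om) - risk d p W \<theta> (beta_A d n p W \<theta> Z U)
     \<le> (66 * sqrt (real n / real p) + 12 / l) * (\<theta> \<bullet> \<theta>)"
proof -
  define R where "R = fmat p p Om"
  have Oc: "R \<in> carrier_mat p p" and Oo: "orth_mat p R" using R by (auto simp: R_def)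
  have OO: "transpose_mat R * R = 1\<^sub>m p" using Oo by (simp add: orth_mat_def)
  define y where "y = yA d n \<theta> Z"
  have y: "y \<in> carrier_vec n" using \<theta> by (auto simp: y_def yA_def intro!: mult_mat_vec_carrier[of _ n d])
  have X: "X \<in> carrier_mat n p"
    unfolding X_def XA_def using W by (intro add_carrier_mat mult_carrier_mat[of _ n d]) auto
  have XT: "transpose_mat X \<in> carrier_mat p n" using X by simp
  define XB where "XB = X * transpose_mat R"
  have XB: "XB \<in> carrier_mat n p" unfolding XB_def using X Oc by (intro mult_carrier_mat[of _ n p]) auto
  have XBT: "transpose_mat XB \<in> carrier_mat p n" using XB by simp
  define A where "A = X * transpose_mat X"
  have A: "A \<in> carrier_mat n n" unfolding A_def using X by (intro mult_carrier_mat[of _ n p]) auto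
  have XBv: "transpose_mat XB *\<^sub>v c = R *\<^sub>v (transpose_mat X *\<^sub>v c)" if "c \<in> carrier_vec n" for c
    unfolding XB_def using X Oc that by (subst transpose_mult_mult_vec[of _ n p _ p]) auto
  have Xv: "transpose_mat X *\<^sub>v c \<in> carrier_vec p" if "c \<in> carrier_vec n" for c
    using XT that by (intro mult_mat_vec_carrier)
  have OTO: "transpose_mat R *\<^sub>v (R *\<^sub>v v) = v" if "v \<in> carrier_vec p" for v
  proof -
    have "transpose_mat R *\<^sub>v (R *\<^sub>v v) = (transpose_mat R * R) *\<^sub>v v"
      using Oc that by (intro assoc_mult_mat_vec[symmetric, of _ p p _ p]) auto
    then show ?thesis using OO that by simp
  qed
  \<comment> \<open>Both tasks have the same Gram matrix and the same labels, hence the same dual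
    coefficients \<open>c0\<close>. This is why the task-B interpolator is the rotated task-A
    one.\<close>
  have XXB: "XB * transpose_mat XB = A"
  proof -
    have "XB * transpose_mat XB = XB * (R * transpose_mat X)"
      unfolding XB_def using transpose_mult[of X n p "transpose_mat R" p] X Oc by simp
    also have "\<dots> = X * (transpose_mat R * (R * transpose_mat X))"
      unfolding XB_def using X Oc XT by (intro assoc_mult_mat[of _ n p _ p _ n]) (auto intro: mult_carrier_mat[of _ p p])
    also have "transpose_mat R * (R * transpose_mat X) = (transpose_mat R * R) * transpose_mat X"
      using Oc XT by (intro assoc_mult_mat[symmetric, of _ p p _ p _ n]) auto
    finally show ?thesis using OO XT by (simp add: A_def)
  qed
  define c0 where "c0 = minv A *\<^sub>v y"
  define b where "b = transpose_mat X *\<^sub>v c0"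
  have bA: "beta_A d n p W \<theta> Z U = b"
    by (simp add: beta_A_def minnorm_def b_def c0_def A_def X_def y_def)
  have bB: "beta_B d n p W \<theta> Z U Om = transpose_mat XB *\<^sub>v c0"
    using XXB by (simp add: beta_B_def minnorm_def c0_def XB_def X_def y_def R_def)
  have bBA: "beta_BA d n p W \<theta> Z U Om = b + transpose_mat XB *\<^sub>v c0 - proj_range (transpose_mat XB) b"
    by (simp add: beta_BA_def bA bB XB_def X_def R_def)
  have rhs: "0 \<le> (66 * sqrt (real n / real p) + 12 / l) * (\<theta> \<bullet> \<theta>)" using l by simp
  show ?thesis
  proof (cases "det A = 0")
    case True
    then have "c0 = 0\<^sub>v n" using minv_singular[OF A] y by (simp add: c0_def zero_mat_mult_vec)
    then have "b = 0\<^sub>v p" "transpose_mat XB *\<^sub>v c0 = 0\<^sub>v p"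
      using mult_mat_zero_vec[OF XT] mult_mat_zero_vec[OF XBT] by (auto simp: b_def)
    then have "beta_BA d n p W \<theta> Z U Om = beta_A d n p W \<theta> Z U"
      using proj_range_zero[OF XBT] by (simp add: bA bBA)
    then show ?thesis using rhs by simp
  next
    case det: False
    note inv = minv_nonsingular[OF A det]
    have c0: "c0 \<in> carrier_vec n" unfolding c0_def using inv(1) y by (rule mult_mat_vec_carrier)
    have b: "b \<in> carrier_vec p" unfolding b_def using c0 by (rule Xv)
    have Xb: "X *\<^sub>v b = y"
    proof -
      have "X *\<^sub>v b = A *\<^sub>v c0" unfolding b_def A_def using X XT c0 by (intro assoc_mult_mat_vec[symmetric, of _ n p _ n]) auto
      also have "\<dots> = (A * minv A) *\<^sub>v y" unfolding c0_def using A inv(1) y by (intro assoc_mult_mat_vec[symmetric, of _ n n _ n]) auto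
      finally show ?thesis using inv(2) y by simp
    qed
    have b'b: "b' = det A \<cdot>\<^sub>v b"
    proof -
      have "adj_mat A *\<^sub>v y = det A \<cdot>\<^sub>v c0"
        unfolding inv(4) c0_def using inv(1) y by (intro eq_vecI) (auto simp: scalar_prod_def sum_distrib_left mult_ac)
      then have "b' = transpose_mat X *\<^sub>v (det A \<cdot>\<^sub>v c0)" by (simp add: b'_def A_def y_def)
      also have "\<dots> = det A \<cdot>\<^sub>v b" unfolding b_def using XT c0 by (rule mult_mat_vec)
      finally show ?thesis .
    qed
    have Ob: "R *\<^sub>v b \<in> carrier_vec p" "transpose_mat R *\<^sub>v b \<in> carrier_vec p"
      using Oc b by (auto intro: mult_mat_vec_carrier[of _ p p])
    have d2: "0 < (det A)\<^sup>2" using det by simp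
    have abs2: "k * (\<bar>det A\<bar> * v) * (\<bar>det A\<bar> * w) = (det A)\<^sup>2 * (k * v * w)" for k v w
    proof -
      have "k * (\<bar>det A\<bar> * v) * (\<bar>det A\<bar> * w) = (\<bar>det A\<bar> * \<bar>det A\<bar>) * (k * v * w)"
        by (simp only: mult_ac)
      then show ?thesis by (simp add: power2_eq_square)
    qed
    \<comment> \<open>The hypothesis is taken at \<open>det A \<cdot>\<^sub>v c\<close>, so that the
      determinant enters squared and cancels whatever its sign.\<close>
    have H2': "(transpose_mat X *\<^sub>v c) \<bullet> (transpose_mat R *\<^sub>v b) \<le> \<kappa> * vnorm (transpose_mat X *\<^sub>v c) * vnorm b"
      if c: "c \<in> carrier_vec n" for c
    proof -
      have e1: "transpose_mat X *\<^sub>v (det A \<cdot>\<^sub>v c) = det A \<cdot>\<^sub>v (transpose_mat X *\<^sub>v c)" using XT c by (rule mult_mat_vec)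
      have e2: "transpose_mat R *\<^sub>v b' = det A \<cdot>\<^sub>v (transpose_mat R *\<^sub>v b)" unfolding b'b using Oc b by (intro mult_mat_vec[of _ p p]) auto
      have "(det A)\<^sup>2 * ((transpose_mat X *\<^sub>v c) \<bullet> (transpose_mat R *\<^sub>v b)) =
          (det A \<cdot>\<^sub>v (transpose_mat X *\<^sub>v c)) \<bullet> (det A \<cdot>\<^sub>v (transpose_mat R *\<^sub>v b))"
        using Xv[OF c] Ob by (simp add: power2_eq_square)
      also have "\<dots> \<le> \<kappa> * vnorm (det A \<cdot>\<^sub>v (transpose_mat X *\<^sub>v c)) * vnorm b'"
        using H2[of "det A \<cdot>\<^sub>v c"] c unfolding R_def[symmetric] e1 e2 by simp
      also have "\<dots> = (det A)\<^sup>2 * (\<kappa> * vnorm (transpose_mat X *\<^sub>v c) * vnorm b)"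
        unfolding b'b vnorm_smult by (rule abs2)
      finally have "(det A)\<^sup>2 * ((transpose_mat X *\<^sub>v c) \<bullet> (transpose_mat R *\<^sub>v b)) \<le> (det A)\<^sup>2 * (\<kappa> * vnorm (transpose_mat X *\<^sub>v c) * vnorm b)" .
      then show ?thesis using d2 by simp
    qed
    have H3': "(W *\<^sub>v c) \<bullet> (R *\<^sub>v b) \<le> \<kappa> * vnorm (W *\<^sub>v c) * vnorm b"
      if c: "c \<in> carrier_vec d" for c
    proof -
      have e1: "W *\<^sub>v (det A \<cdot>\<^sub>v c) = det A \<cdot>\<^sub>v (W *\<^sub>v c)" using W c by (rule mult_mat_vec)
      have e2: "R *\<^sub>v b' = det A \<cdot>\<^sub>v (R *\<^sub>v b)" unfolding b'b using Oc b by (rule mult_mat_vec)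
      have Wc: "W *\<^sub>v c \<in> carrier_vec p" using W c by (rule mult_mat_vec_carrier)
      have "(det A)\<^sup>2 * ((W *\<^sub>v c) \<bullet> (R *\<^sub>v b)) = (det A \<cdot>\<^sub>v (W *\<^sub>v c)) \<bullet> (det A \<cdot>\<^sub>v (R *\<^sub>v b))"
        using Wc Ob by (simp add: power2_eq_square)
      also have "\<dots> \<le> \<kappa> * vnorm (det A \<cdot>\<^sub>v (W *\<^sub>v c)) * vnorm b'"
        using H3[of "det A \<cdot>\<^sub>v c"] c unfolding R_def[symmetric] e1 e2 by simp
      also have "\<dots> = (det A)\<^sup>2 * (\<kappa> * vnorm (W *\<^sub>v c) * vnorm b)"
        unfolding b'b vnorm_smult by (rule abs2)
      finally have "(det A)\<^sup>2 * ((W *\<^sub>v c) \<bullet> (R *\<^sub>v b)) \<le> (det A)\<^sup>2 * (\<kappa> * vnorm (W *\<^sub>v c) * vnorm b)" .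
      then show ?thesis using d2 by simp
    qed
    have W_norm: "vnorm (W *\<^sub>v a) = sqrt l * vnorm a" if a: "a \<in> carrier_vec d" for a
    proof -
      have "(W *\<^sub>v a) \<bullet> (W *\<^sub>v a) = (transpose_mat W *\<^sub>v (W *\<^sub>v a)) \<bullet> a"
        using transpose_mult_scalar[of W p d "W *\<^sub>v a" a] W a mult_mat_vec_carrier[OF W a] by simp
      also have "transpose_mat W *\<^sub>v (W *\<^sub>v a) = (transpose_mat W * W) *\<^sub>v a"
        using W a by (intro assoc_mult_mat_vec[symmetric, of _ d p _ d]) auto
      also have "\<dots> = l \<cdot>\<^sub>v a" unfolding WW using a by (intro eq_vecI) auto
      finally show ?thesis using a by (simp add: vnorm_def real_sqrt_mult)
    qed
    have WT: "transpose_mat W *\<^sub>v v \<in> carrier_vec d" if "v \<in> carrier_vec p" for v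
      using W that by (intro mult_mat_vec_carrier[of _ d p]) auto
    have WT_self: "(vnorm (transpose_mat W *\<^sub>v v))\<^sup>2 = (W *\<^sub>v (transpose_mat W *\<^sub>v v)) \<bullet> v" if v: "v \<in> carrier_vec p" for v
      using transpose_mult_scalar[of "transpose_mat W" d p "transpose_mat W *\<^sub>v v" v] W v WT[OF v] by (simp add: vnorm_power2)
    \<comment> \<open>The squared length of \<open>W^T v\<close> is the inner product of
      \<open>W W^T v\<close> with \<open>v\<close>; a bound on it that is linear in the length of
      \<open>W^T v\<close> can be divided by that length.\<close>
    have WT_le: "vnorm (transpose_mat W *\<^sub>v v) \<le> k" if v: "v \<in> carrier_vec p" and k: "0 \<le> k"
      and le: "(W *\<^sub>v (transpose_mat W *\<^sub>v v)) \<bullet> v \<le> vnorm (transpose_mat W *\<^sub>v v) * k" for v k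
    proof (cases "vnorm (transpose_mat W *\<^sub>v v) = 0")
      case True then show ?thesis using k by simp
    next
      case False
      then have "0 < vnorm (transpose_mat W *\<^sub>v v)" using vnorm_nonneg[of "transpose_mat W *\<^sub>v v"] by linarith
      moreover have "vnorm (transpose_mat W *\<^sub>v v) * vnorm (transpose_mat W *\<^sub>v v) \<le> vnorm (transpose_mat W *\<^sub>v v) * k"
        using le unfolding WT_self[OF v, symmetric] power2_eq_square .
      ultimately show ?thesis by (simp only: mult_le_cancel_left_pos)
    qed
    have WT_norm: "vnorm (transpose_mat W *\<^sub>v v) \<le> sqrt l * vnorm v" if v: "v \<in> carrier_vec p" for v
      using l scalar_prod_le[OF mult_mat_vec_carrier[OF W WT[OF v]] v]
      by (intro WT_le[OF v]) (auto simp: W_norm[OF WT[OF v]] mult_ac)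
    have \<kappa>0: "0 \<le> \<kappa>" by (simp add: \<kappa>_def)
    have WOb: "vnorm (transpose_mat W *\<^sub>v (R *\<^sub>v b)) \<le> \<kappa> * (sqrt l * vnorm b)"
      using l \<kappa>0 H3'[OF WT[OF Ob(1)]] by (intro WT_le[OF Ob(1)]) (auto simp: W_norm[OF WT[OF Ob(1)]] mult_ac)
    \<comment> \<open>Normal equations for the projection of \<open>b\<close> onto the row space of
      \<open>XB\<close>, whose Gram matrix is again \<open>A\<close>.\<close>
    define c1 where "c1 = minv A *\<^sub>v (XB *\<^sub>v b)"
    have XBb: "XB *\<^sub>v b \<in> carrier_vec n" using XB b by (rule mult_mat_vec_carrier)
    have c1: "c1 \<in> carrier_vec n" unfolding c1_def using inv(1) XBb by (rule mult_mat_vec_carrier)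
    define q where "q = transpose_mat XB *\<^sub>v c1"
    have q: "q \<in> carrier_vec p" unfolding q_def using XBT c1 by (rule mult_mat_vec_carrier)
    have XBq: "XB *\<^sub>v q = XB *\<^sub>v b"
    proof -
      have "XB *\<^sub>v q = A *\<^sub>v c1" unfolding q_def XXB[symmetric] using XB XBT c1 by (intro assoc_mult_mat_vec[symmetric, of _ n p _ n]) auto
      also have "\<dots> = (A * minv A) *\<^sub>v (XB *\<^sub>v b)" unfolding c1_def using A inv(1) XBb by (intro assoc_mult_mat_vec[symmetric, of _ n n _ n]) auto
      finally show ?thesis using inv(2) XBb by simp
    qed
    have orth: "(b - q) \<bullet> (transpose_mat XB *\<^sub>v c) = 0" if c: "c \<in> carrier_vec n" for c
    proof -
      have "(b - q) \<bullet> (transpose_mat XB *\<^sub>v c) = (XB *\<^sub>v (b - q)) \<bullet> c"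
        using transpose_mult_scalar[of "transpose_mat XB" p n "b - q" c] XB b q c by simp
      also have "XB *\<^sub>v (b - q) = XB *\<^sub>v b - XB *\<^sub>v q" using XB b q by (rule mult_minus_distrib_mat_vec)
      also have "\<dots> = 0\<^sub>v n" using XBq XBb by simp
      finally show ?thesis using c by simp
    qed
    have proj: "proj_range (transpose_mat XB) b = q"
      using b XBT _ orth by (rule proj_range_eqI) (use c1 XBT in \<open>auto simp: colsp_def q_def\<close>)
    have qb: "(vnorm q)\<^sup>2 = q \<bullet> b"
    proof -
      have "(b - q) \<bullet> q = 0" using orth[OF c1] by (simp add: q_def)
      then show ?thesis using b q comm_scalar_prod[OF b q] by (simp add: minus_scalar_prod_distrib[of _ p] vnorm_power2)
    qed
    \<comment> \<open>The squared length of \<open>q\<close> equals its inner product with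
      \<open>b\<close>. Moving the rotation onto \<open>b\<close> shows this to be a correlation of
      \<open>O^T b\<close> with the row space of \<open>X\<close>.\<close>
    have q_le: "vnorm q \<le> \<kappa> * vnorm b"
    proof (cases "vnorm q = 0")
      case True then show ?thesis using \<kappa>0 by simp
    next
      case False
      then have q0: "0 < vnorm q" using vnorm_nonneg[of q] by linarith
      have qX: "q = R *\<^sub>v (transpose_mat X *\<^sub>v c1)" unfolding q_def by (rule XBv[OF c1])
      then have "q \<bullet> b = (transpose_mat X *\<^sub>v c1) \<bullet> (transpose_mat R *\<^sub>v b)"
        using transpose_mult_scalar[of "transpose_mat R" p p "transpose_mat X *\<^sub>v c1" b] Oc Xv[OF c1] b by simp
      also have "\<dots> \<le> \<kappa> * vnorm (transpose_mat X *\<^sub>v c1) * vnorm b" by (rule H2'[OF c1])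
      also have "vnorm (transpose_mat X *\<^sub>v c1) = vnorm q" unfolding qX by (rule vnorm_orth_mat[OF Oo Xv[OF c1], symmetric])
      finally have "vnorm q * vnorm q \<le> vnorm q * (\<kappa> * vnorm b)" using qb by (simp add: power2_eq_square mult_ac)
      then show ?thesis using q0 by simp
    qed
    have B: "transpose_mat XB *\<^sub>v c0 = R *\<^sub>v b" unfolding b_def by (rule XBv[OF c0])
    have bBA': "beta_BA d n p W \<theta> Z U Om = (b - q) + R *\<^sub>v b"
      unfolding bBA B proj using b q Ob Oc by (intro eq_vecI) (auto simp del: index_mult_mat_vec)
    have bq: "b - q \<in> carrier_vec p" using b q by simp
    \<comment> \<open>By Pythagoras the squared length is exactly
      \<open>2 |b|^2 - |q|^2\<close>.\<close>
    have norm_BA: "(vnorm ((b - q) + R *\<^sub>v b))\<^sup>2 \<le> 2 * (vnorm b)\<^sup>2"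
    proof -
      have "(b - q) \<bullet> (R *\<^sub>v b) = 0" using orth[OF c0] by (simp add: B)
      then have "(vnorm ((b - q) + R *\<^sub>v b))\<^sup>2 = (vnorm (b - q))\<^sup>2 + (vnorm (R *\<^sub>v b))\<^sup>2"
        using scalar_prod_self_add[OF bq Ob(1)] by (simp add: vnorm_power2)
      moreover have "(vnorm (b - q))\<^sup>2 = (vnorm b)\<^sup>2 - (vnorm q)\<^sup>2"
        using scalar_prod_self_diff[OF b q] comm_scalar_prod[OF b q] qb by (simp add: vnorm_power2)
      ultimately show ?thesis using vnorm_orth_mat[OF Oo b] by simp
    qed
    have b_le: "l * (vnorm b)\<^sup>2 \<le> 17 / 9 * (vnorm \<theta>)\<^sup>2"
    proof (cases "vnorm b = 0")
      case True then show ?thesis by simp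
    next
      case False
      define N where "N = b \<bullet> b"
      have N: "0 < N" using False by (simp add: N_def vnorm_power2[symmetric])
      define Zm where "Zm = fmat n d Z"
      have Zm: "Zm \<in> carrier_mat n d" by (simp add: Zm_def)
      define g where "g = transpose_mat Zm *\<^sub>v c0"
      have g: "g \<in> carrier_vec d" unfolding g_def using Zm c0 by (intro mult_mat_vec_carrier[of _ d n]) auto
      \<comment> \<open>The interpolation property enters here: \<open>N\<close> equals
        \<open>c0 \<bullet> y\<close>, and \<open>y = Z \<theta>\<close>.\<close>
      have Nb: "N = \<theta> \<bullet> g"
      proof -
        have "N = (X *\<^sub>v b) \<bullet> c0"
          using transpose_mult_scalar[of "transpose_mat X" p n b c0] X b c0 by (simp add: N_def b_def)
        also have "\<dots> = c0 \<bullet> (Zm *\<^sub>v \<theta>)" unfolding Xb using comm_scalar_prod[OF y c0] by (simp add: y_def yA_def Zm_def)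
        also have "\<dots> = g \<bullet> \<theta>" unfolding g_def using Zm c0 \<theta> by (intro transpose_mult_scalar) auto
        finally show ?thesis using comm_scalar_prod[OF g \<theta>] by simp
      qed
      define T where "T = \<theta> \<bullet> \<theta>"
      have T: "0 < T"
      proof -
        have "\<theta> \<noteq> 0\<^sub>v d" using Nb N g by auto
        then have "T \<noteq> 0" using scalar_prod_self_eq_0[OF \<theta>] by (simp add: T_def)
        then show ?thesis using scalar_prod_self_nonneg[of \<theta>] unfolding T_def by (rule le_neq_trans[rotated, OF not_sym])
      qed
      define U' where "U' = transpose_mat (fmat n p U)"
      have U': "U' \<in> carrier_mat p n" by (simp add: U'_def)
      have bWU: "b = W *\<^sub>v g + U' *\<^sub>v c0"
      proof -
        have "transpose_mat X = W * transpose_mat Zm + U'"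
          unfolding X_def XA_def U'_def Zm_def[symmetric]
          using transpose_add[of "Zm * transpose_mat W" n p "fmat n p U"] transpose_mult[of Zm n d "transpose_mat W" p] W Zm
          by (simp add: mult_carrier_mat[of _ n d])
        then have "b = (W * transpose_mat Zm) *\<^sub>v c0 + U' *\<^sub>v c0"
          unfolding b_def using W Zm U' c0 by (simp add: add_mult_distrib_mat_vec[of _ p n])
        also have "(W * transpose_mat Zm) *\<^sub>v c0 = W *\<^sub>v g"
          unfolding g_def using W Zm c0 by (intro assoc_mult_mat_vec[of _ p d _ n]) auto
        finally show ?thesis .
      qed
      \<comment> \<open>This scaling makes \<open>\<theta> - r g\<close> orthogonal to
        \<open>\<theta>\<close>, so \<open>r b\<close> is the difference of
        \<open>W \<theta>\<close> and a point of the span in \<open>H1\<close>. As \<open>r\<close>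
        is inversely proportional to \<open>N\<close>, the lower bound on the distance becomes an
        upper bound on \<open>N\<close>.\<close>
      define r where "r = T / N"
      have r: "0 < r" using T N by (simp add: r_def)
      define a where "a = \<theta> - r \<cdot>\<^sub>v g"
      have a: "a \<in> carrier_vec d" using g \<theta> by (simp add: a_def)
      have "a \<bullet> \<theta> = T - r * (\<theta> \<bullet> g)"
        using g \<theta> comm_scalar_prod[OF g \<theta>] by (simp add: a_def T_def minus_scalar_prod_distrib[of _ d])
      then have a\<theta>: "a \<bullet> \<theta> = 0" using N by (simp add: Nb[symmetric] r_def)
      have cr: "(- r) \<cdot>\<^sub>v c0 \<in> carrier_vec n" using c0 by simp
      have eq: "W *\<^sub>v \<theta> - (W *\<^sub>v a + U' *\<^sub>v ((- r) \<cdot>\<^sub>v c0)) = r \<cdot>\<^sub>v b"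
      proof -
        have W\<theta>: "W *\<^sub>v \<theta> \<in> carrier_vec p" "W *\<^sub>v g \<in> carrier_vec p" "U' *\<^sub>v c0 \<in> carrier_vec p"
          using W \<theta> g U' c0 by (auto intro: mult_mat_vec_carrier[of _ p d] mult_mat_vec_carrier[of _ p n])
        have e1: "W *\<^sub>v a = W *\<^sub>v \<theta> - r \<cdot>\<^sub>v (W *\<^sub>v g)"
          unfolding a_def using W \<theta> g by (simp add: mult_minus_distrib_mat_vec[of _ p d] mult_mat_vec[of _ p d])
        have e2: "U' *\<^sub>v ((- r) \<cdot>\<^sub>v c0) = (- r) \<cdot>\<^sub>v (U' *\<^sub>v c0)" using U' c0 by (rule mult_mat_vec)
        show ?thesis unfolding e1 e2 bWU using W\<theta> W U'
          by (intro eq_vecI) (auto simp: algebra_simps simp del: index_mult_mat_vec)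
      qed
      have "\<theta> \<bullet> \<theta> \<noteq> 0" using T by (simp add: T_def)
      then have "9 / 17 * (vnorm (W *\<^sub>v \<theta>))\<^sup>2 \<le> (vnorm (r \<cdot>\<^sub>v b))\<^sup>2"
        using H1[OF cr a a\<theta>] unfolding U'_def[symmetric] eq by simp
      then have "9 / 17 * (l * T) \<le> r\<^sup>2 * N"
        using l by (simp add: W_norm[OF \<theta>] vnorm_smult power_mult_distrib vnorm_power2 T_def N_def)
      also have "r\<^sup>2 * N = T * (T / N)" using N by (simp add: r_def power2_eq_square)
      finally have "T * (9 / 17 * l) \<le> T * (T / N)" by (simp add: mult_ac)
      then have "9 / 17 * l \<le> T / N" using T by (simp only: mult_le_cancel_left_pos)
      then show ?thesis using N by (simp add: vnorm_power2 T_def[symmetric] N_def[symmetric] field_simps)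
    qed
    define u where "u = transpose_mat W *\<^sub>v b - \<theta>"
    define v where "v = transpose_mat W *\<^sub>v (R *\<^sub>v b) - transpose_mat W *\<^sub>v q"
    have uv: "u \<in> carrier_vec d" "v \<in> carrier_vec d" using WT b Ob q \<theta> by (auto simp: u_def v_def)
    have WTBA: "transpose_mat W *\<^sub>v ((b - q) + R *\<^sub>v b) - \<theta> = u + v"
    proof -
      have Wt: "transpose_mat W \<in> carrier_mat d p" using W by simp
      have "transpose_mat W *\<^sub>v ((b - q) + R *\<^sub>v b) = (transpose_mat W *\<^sub>v b - transpose_mat W *\<^sub>v q) + transpose_mat W *\<^sub>v (R *\<^sub>v b)"
        using mult_add_distrib_mat_vec[OF Wt bq Ob(1)] mult_minus_distrib_mat_vec[OF Wt b q] by simp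
      then show ?thesis unfolding u_def v_def using WT[OF b] WT[OF q] WT[OF Ob(1)] \<theta> W
        by (intro eq_vecI) (auto simp del: index_mult_mat_vec)
    qed
    have v_le: "vnorm v \<le> 4 * sqrt (real n / real p) * (sqrt l * vnorm b)"
    proof -
      have "vnorm v \<le> vnorm (transpose_mat W *\<^sub>v (R *\<^sub>v b)) + vnorm (transpose_mat W *\<^sub>v q)"
        unfolding v_def by (rule vnorm_minus_le[OF WT[OF Ob(1)] WT[OF q]])
      also have "\<dots> \<le> \<kappa> * (sqrt l * vnorm b) + sqrt l * (\<kappa> * vnorm b)"
        using l order_trans[OF WT_norm[OF q] mult_left_mono[OF q_le]] by (intro add_mono WOb) auto
      finally show ?thesis by (simp add: \<kappa>_def mult_ac)
    qed
    have u_le: "vnorm u \<le> sqrt l * vnorm b + vnorm \<theta>"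
      unfolding u_def using vnorm_minus_le[OF WT[OF b] \<theta>] WT_norm[OF b] by linarith
    have s: "sqrt (real n / real p) \<le> 1 / 4"
    proof (rule real_le_lsqrt)
      show "real n / real p \<le> (1 / 4)\<^sup>2" using dnp by (simp add: power2_eq_square field_simps)
    qed simp
    have "(vnorm (u + v))\<^sup>2 = (vnorm u)\<^sup>2 + 2 * (u \<bullet> v) + (vnorm v)\<^sup>2"
      using scalar_prod_self_add[OF uv] by (simp add: vnorm_power2)
    moreover have "u \<bullet> v \<le> vnorm u * vnorm v" by (rule scalar_prod_le[OF uv])
    moreover have "risk d p W \<theta> (beta_BA d n p W \<theta> Z U Om) = (vnorm (u + v))\<^sup>2 + (vnorm ((b - q) + R *\<^sub>v b))\<^sup>2"
      unfolding bBA' using risk_eq[OF W \<theta>, of "(b - q) + R *\<^sub>v b"] bq Ob by (simp add: WTBA)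
    moreover have "risk d p W \<theta> (beta_A d n p W \<theta> Z U) = (vnorm u)\<^sup>2 + (vnorm b)\<^sup>2"
      unfolding bA using risk_eq[OF W \<theta> b] by (simp add: u_def)
    moreover have "2 * vnorm u * vnorm v + (vnorm v)\<^sup>2 + (vnorm ((b - q) + R *\<^sub>v b))\<^sup>2 - (vnorm b)\<^sup>2 \<le>
        (66 * sqrt (real n / real p) + 12 / l) * (vnorm \<theta>)\<^sup>2"
      using s l b_le v_le u_le norm_BA by (intro risk_increment_numeric) auto
    ultimately show ?thesis by (simp add: vnorm_power2)
  qed
qed

section \<open>Probability of the exceptional set\<close>

text \<open>The first summand decays at rate \<open>(1 - ln 2) / 2\<close> in \<open>r\<close>,
  hence at least that fast in \<open>d\<close>. For the second the rate in \<open>p\<close> is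
  \<open>(ln 2 - 1 / 2) / 2\<close>; with \<open>p \<ge> 17 d\<close> and
  \<open>ln 2 \<ge> 2 / 3\<close> this is the faster decay, as 17/6 exceeds 1/3.\<close>

lemma tail_bound_le:
  assumes "d \<le> r" "17 * real d \<le> real p"
  shows "tail_bound r p \<le> 2 * exp (- ((1 - ln 2) / 2) * real d)"
proof -
  have "(2 / exp 1) powr (real r / 2) = exp (real r / 2 * (ln 2 - 1))"
    by (simp add: powr_def ln_div)
  also have "\<dots> \<le> exp (- ((1 - ln 2) / 2) * real d)"
  proof -
    have "(1 - ln 2) * real d \<le> (1 - ln 2) * real r"
      using assms ln_2_less_1 by (intro mult_left_mono) auto
    then show ?thesis by (simp add: field_simps)
  qed
  finally have 1: "(2 / exp 1) powr (real r / 2) \<le> exp (- ((1 - ln 2) / 2) * real d)" .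
  have "(sqrt (exp 1) / 2) powr (real p / 2) = exp (real p / 2 * (1 / 2 - ln 2))"
    by (simp add: powr_def ln_div ln_sqrt)
  also have "\<dots> \<le> exp (- ((1 - ln 2) / 2) * real d)"
  proof -
    have l: "2 / 3 \<le> ln (2::real)" by (rule ln2_ge_two_thirds)
    have "17 * real d * (ln 2 - 1 / 2) \<le> real p * (ln 2 - 1 / 2)"
      using assms l by (intro mult_right_mono) auto
    moreover have "real d * (1 - ln 2) \<le> real d * (17 * (ln 2 - 1 / 2))"
      using l by (intro mult_left_mono) auto
    ultimately show ?thesis by (simp add: field_simps)
  qed
  finally show ?thesis using 1 by (simp add: tail_bound_def)
qed

section \<open>Measurability of the rescaled interpolator, and the union bound\<close>

lemma borel_measurable_det:
  assumes F: "\<And>x. F x \<in> carrier_mat n n"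
    and m: "\<And>i j. i < n \<Longrightarrow> j < n \<Longrightarrow> (\<lambda>x. F x $$ (i, j)) \<in> borel_measurable M"
  shows "(\<lambda>x. det (F x) :: real) \<in> borel_measurable M"
  unfolding det_def'[OF F]
proof (intro borel_measurable_sum borel_measurable_times borel_measurable_const borel_measurable_prod)
  fix q i assume "q \<in> {q. q permutes {0..<n}}" "i \<in> {0..<n}"
  then have "i < n" "q i < n" using permutes_in_image[of q "{0..<n}" i] by auto
  then show "(\<lambda>x. F x $$ (i, q i)) \<in> borel_measurable M" by (rule m)
qed

text \<open>Entries of the adjugate are signed minors and so polynomials in the entries of the
  matrix; no case split on singularity arises.\<close>

lemma borel_measurable_adj_mat:
  assumes F: "\<And>x. F x \<in> carrier_mat n n"
    and m: "\<And>i j. i < n \<Longrightarrow> j < n \<Longrightarrow> (\<lambda>x. F x $$ (i, j)) \<in> borel_measurable M"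
    and ij: "i < n" "j < n"
  shows "(\<lambda>x. adj_mat (F x) $$ (i, j) :: real) \<in> borel_measurable M"
proof -
  have dims: "dim_row (F x) = n" "dim_col (F x) = n" for x using F[of x] by auto
  have "adj_mat (F x) $$ (i, j) = (- 1) ^ (j + i) * det (mat_delete (F x) j i)" for x
    using ij by (simp add: adj_mat_def cofactor_def dims)
  moreover have "(\<lambda>x. det (mat_delete (F x) j i)) \<in> borel_measurable M"
  proof (rule borel_measurable_det[where n = "n - 1"])
    show "mat_delete (F x) j i \<in> carrier_mat (n - 1) (n - 1)" for x using F by (rule mat_delete_carrier)
    fix i' j' assume "i' < n - 1" "j' < n - 1"
    then show "(\<lambda>x. mat_delete (F x) j i $$ (i', j')) \<in> borel_measurable M"
      by (auto simp: mat_delete_def dims intro!: m)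
  qed
  ultimately show ?thesis by simp
qed

text \<open>Conditioning on the data: a bound valid for every fixed data point, with only the
  rotation random, holds for the joint law.\<close>

lemma (in prob_space) emeasure_pair_le:
  assumes N: "prob_space N" and B: "B \<in> sets (M \<Otimes>\<^sub>M N)"
    and le: "\<And>x. x \<in> space M \<Longrightarrow> emeasure N (Pair x -` B) \<le> \<epsilon>"
  shows "emeasure (M \<Otimes>\<^sub>M N) B \<le> \<epsilon>"
proof -
  interpret N: prob_space N by fact
  have "emeasure (M \<Otimes>\<^sub>M N) B = (\<integral>\<^sup>+x. emeasure N (Pair x -` B) \<partial>M)"
    by (rule N.emeasure_pair_measure_alt[OF B])
  also have "\<dots> \<le> (\<integral>\<^sup>+x. \<epsilon> \<partial>M)" by (intro nn_integral_mono le)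
  also have "\<dots> = \<epsilon>" by (simp add: emeasure_space_1)
  finally show ?thesis .
qed

theorem theorem1:
  shows "\<exists>c>0. \<forall>(d::nat) (n::nat) (p::nat) (\<gamma>::real) (\<theta>::real vec) (W::real mat) H.
    0 < d \<longrightarrow> d \<le> n \<longrightarrow> 0 < \<gamma> \<longrightarrow>
    real p \<ge> 17 * real n \<longrightarrow> real p \<ge> 1 / \<gamma> \<longrightarrow>
    \<theta> \<in> carrier_vec d \<longrightarrow> W \<in> carrier_mat p d \<longrightarrow>
    transpose_mat W * W = (real p * \<gamma>) \<cdot>\<^sub>m 1\<^sub>m d \<longrightarrow>
    haar_orth p H \<longrightarrow>
    (\<exists>E \<in> sets (data_space d n p H).
       E \<subseteq> {((Z, U), Om). risk d p W \<theta> (beta_BA d n p W \<theta> Z U Om) - risk d p W \<theta> (beta_A d n p W \<theta> Z U)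
              \<le> (66 * sqrt (real n / real p) + 12 / (real p * \<gamma>)) * (\<theta> \<bullet> \<theta>)} \<and>
       measure (data_space d n p H) E \<ge> 1 - 10 * exp (- c * real d))"
proof (intro exI[of _ "(1 - ln 2) / 2 :: real"] conjI allI impI)
  \<comment> \<open>The witness for \<open>c\<close> is the decay rate of the first Chernoff term in
    \<open>tail_bound\<close>.\<close>
  show "0 < (1 - ln 2) / (2 :: real)" using ln_2_less_1 by simp
next
  fix d n p :: nat and \<gamma> :: real and \<theta> :: "real vec" and W :: "real mat" and H
  assume d: "0 < d" and dn: "d \<le> n" and \<gamma>: "0 < \<gamma>" and np: "17 * real n \<le> real p"
    and \<theta>: "\<theta> \<in> carrier_vec d" and W: "W \<in> carrier_mat p d"
    and WW: "transpose_mat W * W = (real p * \<gamma>) \<cdot>\<^sub>m 1\<^sub>m d" and H: "haar_orth p H"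
  let ?M1 = "gauss_fn ({..<n} \<times> {..<d}) :: (nat \<times> nat \<Rightarrow> real) measure"
  let ?M2 = "gauss_fn ({..<n} \<times> {..<p}) :: (nat \<times> nat \<Rightarrow> real) measure"
  let ?M = "?M1 \<Otimes>\<^sub>M ?M2"
  let ?D = "data_space d n p H"
  have D: "?D = ?M \<Otimes>\<^sub>M H" by (simp add: data_space_def)
  interpret M1: prob_space ?M1 by (rule prob_space_gauss_fn)
  interpret M2: prob_space ?M2 by (rule prob_space_gauss_fn)
  interpret H: prob_space H by (rule haar_orthD(1)[OF H])
  interpret M12: pair_prob_space ?M1 ?M2 ..
  interpret MH: pair_prob_space ?M H ..
  interpret D: prob_space ?D unfolding D by (rule MH.prob_space_axioms)
  have sH[measurable_cong]: "sets H = sets (lebesgue_fn ({..<p} \<times> {..<p}))" by (rule haar_orthD(2)[OF H])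
  define \<epsilon> where "\<epsilon> = 2 * exp (- ((1 - ln 2) / 2) * real d)"
  have p: "0 < p" using np d dn by (cases p) auto
  have pd: "17 * real d \<le> real p" using np dn by linarith
  have l: "0 < real p * \<gamma>" using p \<gamma> by simp
  \<comment> \<open>Padding by 0 outside the index range makes every coordinate measurable without
    changing the matrix that is read off.\<close>
  define Xf where "Xf x = (\<lambda>(i, j). if i < n \<and> j < p then XA d n p W (fst x) (snd x) $$ (i, j) else 0)" for x
  define bv where "bv x = transpose_mat (XA d n p W (fst x) (snd x)) *\<^sub>v
     (adj_mat (XA d n p W (fst x) (snd x) * transpose_mat (XA d n p W (fst x) (snd x))) *\<^sub>v yA d n \<theta> (fst x))" for x
  define bf where "bf x j = (if j < p then bv x $ j else 0)" for x j
  have XAc: "XA d n p W Z U \<in> carrier_mat n p" for Z U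
    unfolding XA_def using W by (intro add_carrier_mat mult_carrier_mat[of _ n d]) auto
  have XA_index: "XA d n p W Z U $$ (i, j) = (\<Sum>k<d. Z (i, k) * W $$ (j, k)) + U (i, j)" if "i < n" "j < p" for Z U i j
    using that W by (simp add: XA_def scalar_prod_def atLeast0LessThan)
  have fX: "fmat n p (Xf x) = XA d n p W (fst x) (snd x)" for x
    using XAc[of "fst x" "snd x"] by (intro eq_matI) (auto simp: Xf_def)
  have fb: "vec p (bf x) = bv x" for x
    using XAc[of "fst x" "snd x"] by (intro eq_vecI) (auto simp: bf_def bv_def)
  have X_meas: "(\<lambda>x. XA d n p W (fst x) (snd x) $$ (i, j)) \<in> borel_measurable ?M" if "i < n" "j < p" for i j
    unfolding XA_index[OF that] by measurable
  have Xf_meas: "(\<lambda>x. Xf x ij) \<in> borel_measurable ?M" for ij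
    using X_meas[of "fst ij" "snd ij"] by (cases "fst ij < n \<and> snd ij < p") (auto simp: Xf_def split_beta)
  have bf_meas: "(\<lambda>x. bf x j) \<in> borel_measurable ?M" for j
  proof (cases "j < p")
    case True
    define G where "G x = XA d n p W (fst x) (snd x) * transpose_mat (XA d n p W (fst x) (snd x))" for x
    have Gc: "G x \<in> carrier_mat n n" for x
      unfolding G_def using XAc[of "fst x" "snd x"] by (intro mult_carrier_mat[of _ n p]) auto
    have G_meas: "(\<lambda>x. G x $$ (i, k)) \<in> borel_measurable ?M" if "i < n" "k < n" for i k
    proof -
      have "G x $$ (i, k) = (\<Sum>m<p. XA d n p W (fst x) (snd x) $$ (i, m) * XA d n p W (fst x) (snd x) $$ (k, m))" for x
        using that XAc[of "fst x" "snd x"] by (simp add: G_def scalar_prod_def atLeast0LessThan)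
      then show ?thesis using that by (auto intro!: borel_measurable_sum borel_measurable_times X_meas)
    qed
    note adj = borel_measurable_adj_mat[OF Gc G_meas]
    have "bf x j = (\<Sum>i<n. XA d n p W (fst x) (snd x) $$ (i, j) *
       (\<Sum>k<n. adj_mat (G x) $$ (i, k) * (\<Sum>m<d. fst x (k, m) * \<theta> $ m)))" for x
    proof -
      have y: "yA d n \<theta> (fst x) $ k = (\<Sum>m<d. fst x (k, m) * \<theta> $ m)" if "k < n" for k
        using that \<theta> by (simp add: yA_def scalar_prod_def atLeast0LessThan)
      have "(adj_mat (G x) *\<^sub>v yA d n \<theta> (fst x)) $ i =
          (\<Sum>k<n. adj_mat (G x) $$ (i, k) * (\<Sum>m<d. fst x (k, m) * \<theta> $ m))" if "i < n" for i
      proof -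
        have "(adj_mat (G x) *\<^sub>v yA d n \<theta> (fst x)) $ i = (\<Sum>k<n. adj_mat (G x) $$ (i, k) * yA d n \<theta> (fst x) $ k)"
          using that adj_mat(1)[OF Gc[of x]] \<theta> by (simp add: scalar_prod_def atLeast0LessThan yA_def)
        then show ?thesis by (simp add: y)
      qed
      moreover have "bf x j = (\<Sum>i<n. XA d n p W (fst x) (snd x) $$ (i, j) * (adj_mat (G x) *\<^sub>v yA d n \<theta> (fst x)) $ i)"
        using True XAc[of "fst x" "snd x"] adj_mat(1)[OF Gc[of x]]
        by (simp add: bf_def bv_def G_def[symmetric] scalar_prod_def[of "col _ _"] atLeast0LessThan del: index_mult_mat_vec(1) cong: sum.cong)
           (simp add: scalar_prod_def atLeast0LessThan)
      ultimately show ?thesis by simp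
    qed
    moreover have "(\<lambda>x. fst x (k, m)) \<in> borel_measurable ?M" for k m by measurable
    ultimately show ?thesis
      using True by (auto intro!: borel_measurable_sum borel_measurable_times X_meas adj)
  qed (simp add: bf_def)
  define w where "w j = (W *\<^sub>v \<theta>) $ j" for j
  have w: "vec p w = W *\<^sub>v \<theta>" using W by (intro eq_vecI) (auto simp: w_def)
  \<comment> \<open>The columns of \<open>W\<close> become rows, so that the row-space event
    \<open>correlated\<close> tests the vectors \<open>W c\<close>.\<close>
  define WT where "WT = (\<lambda>(i, j). W $$ (j, i))"
  have fW: "fmat d p WT = transpose_mat W" using W by (intro eq_matI) (auto simp: WT_def)
  \<comment> \<open>The reflection argument divides by \<open>\<theta> \<bullet> \<theta>\<close>;
    for vanishing \<open>\<theta>\<close> the distance hypothesis is vacuous, and the empty set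
    suffices.\<close>
  define K where "K = (if \<theta> \<bullet> \<theta> = 0 then {} else {U \<in> space ?M2. (U, w) \<in> near_span d n p W \<theta> (9 / 17)})"
  have K: "K \<in> sets ?M2" unfolding K_def
    by (auto intro!: measurable_near_span[OF W]) measurable
  have K_le: "emeasure ?M2 K \<le> ennreal \<epsilon>"
  proof (cases "\<theta> \<bullet> \<theta> = 0")
    case False
    \<comment> \<open>Origin of 9/17: from \<open>d \<le> n\<close> and \<open>17 n \<le> p\<close>
      the left side is at most 8/17.\<close>
    have "4 * real (n + d) / real p \<le> 1 - 9 / 17" using np dn p by (simp add: field_simps)
    then have "emeasure ?M2 K \<le> ennreal (tail_bound (n + d) p)"
      unfolding K_def using False gauss_fn_near_span_tail[OF W \<theta> False l WW p _ _ w, of "9 / 17" n] by simp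
    also have "\<dots> \<le> ennreal \<epsilon>" unfolding \<epsilon>_def by (intro ennreal_leI tail_bound_le pd) simp
    finally show ?thesis .
  qed (simp add: K_def)
  obtain N where N: "{Om \<in> space H. \<not> orth_mat p (fmat p p Om)} \<subseteq> N" "emeasure H N = 0" "N \<in> sets H"
    using haar_orthD(4)[OF H] by (rule AE_E)
  define B0 where "B0 = space ?M \<times> N"
  define B1 where "B1 = (space ?M1 \<times> K) \<times> space H"
  define B2 where "B2 = {x \<in> space ?D. (Xf (fst x), bf (fst x), snd x) \<in> correlated n p (sqrt (4 * real n / real p))}"
  define B3 where "B3 = {x \<in> space ?D. (WT, bf (fst x), swap_ix (snd x)) \<in> correlated d p (sqrt (4 * real d / real p))}"
  have [measurable]: "(\<lambda>x. Xf (fst x) i) \<in> borel_measurable (?M \<Otimes>\<^sub>M H)" for i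
    by (rule measurable_compose[OF measurable_fst Xf_meas])
  have [measurable]: "(\<lambda>x. bf (fst x) i) \<in> borel_measurable (?M \<Otimes>\<^sub>M H)" for i
    by (rule measurable_compose[OF measurable_fst bf_meas])
  have B0: "B0 \<in> sets ?D" "emeasure ?D B0 = 0"
    using N H.emeasure_pair_measure_Times[of "space ?M" ?M N] by (auto simp: B0_def D)
  have B1: "B1 \<in> sets ?D" "emeasure ?D B1 \<le> ennreal \<epsilon>"
  proof -
    show "B1 \<in> sets ?D" using K by (auto simp: B1_def D)
    have "emeasure ?D B1 = emeasure ?M2 K"
      using K by (simp add: B1_def D H.emeasure_pair_measure_Times M2.emeasure_pair_measure_Times H.emeasure_space_1 M1.emeasure_space_1)
    then show "emeasure ?D B1 \<le> ennreal \<epsilon>" using K_le by simp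
  qed
  have B2: "B2 \<in> sets ?D" unfolding B2_def D by (rule measurable_correlated) measurable
  have B2_le: "emeasure ?D B2 \<le> ennreal \<epsilon>"
    unfolding D
  proof (rule prob_space.emeasure_pair_le[OF M12.prob_space_axioms H.prob_space_axioms B2[unfolded D]])
    fix x assume "x \<in> space ?M"
    then have "Pair x -` B2 = {Om \<in> space H. (Xf x, bf x, Om) \<in> correlated n p (sqrt (4 * real n / real p))}"
      by (auto simp: B2_def D space_pair_measure)
    then have "emeasure H (Pair x -` B2) \<le> ennreal (tail_bound n p)"
      using haar_correlation_tail[OF H p] by simp
    also have "\<dots> \<le> ennreal \<epsilon>" unfolding \<epsilon>_def by (intro ennreal_leI tail_bound_le pd dn)
    finally show "emeasure H (Pair x -` B2) \<le> ennreal \<epsilon>" .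
  qed
  have B3: "B3 \<in> sets ?D" unfolding B3_def D
    by (rule measurable_correlated) (simp_all add: swap_ix_def split_beta, measurable)
  have B3_le: "emeasure ?D B3 \<le> ennreal \<epsilon>"
    unfolding D
  proof (rule prob_space.emeasure_pair_le[OF M12.prob_space_axioms H.prob_space_axioms B3[unfolded D]])
    fix x assume "x \<in> space ?M"
    then have "Pair x -` B3 = {Om \<in> space H. (WT, bf x, swap_ix Om) \<in> correlated d p (sqrt (4 * real d / real p))}"
      by (auto simp: B3_def D space_pair_measure)
    then have "emeasure H (Pair x -` B3) \<le> ennreal (tail_bound d p)"
      using haar_correlation_tail_transpose[OF H p] by simp
    also have "\<dots> \<le> ennreal \<epsilon>" unfolding \<epsilon>_def by (intro ennreal_leI tail_bound_le pd) simp
    finally show "emeasure H (Pair x -` B3) \<le> ennreal \<epsilon>" .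
  qed
  define B where "B = B0 \<union> B1 \<union> B2 \<union> B3"
  have B: "B \<in> sets ?D" using B0 B1 B2 B3 by (simp add: B_def)
  have meas_le: "measure ?D A \<le> \<epsilon>" if "emeasure ?D A \<le> ennreal \<epsilon>" for A
    using that by (simp add: D.emeasure_eq_measure \<epsilon>_def)
  have "measure ?D B \<le> measure ?D B0 + measure ?D B1 + measure ?D B2 + measure ?D B3"
    unfolding B_def using B0 B1 B2 B3
      measure_Un_le[of "B0 \<union> B1 \<union> B2" ?D B3] measure_Un_le[of "B0 \<union> B1" ?D B2] measure_Un_le[of B0 ?D B1] by simp
  also have "\<dots> \<le> 0 + \<epsilon> + \<epsilon> + \<epsilon>"
    \<comment> \<open>Three events of probability at most \<open>2 * exp (- c * d)\<close> and one
      null set: 6 in place of the 10 allowed.\<close>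
    using B0 B1 B2_le B3_le by (intro add_mono meas_le) (auto simp: measure_def)
  finally have B_le: "measure ?D B \<le> 6 * exp (- ((1 - ln 2) / 2) * real d)" by (simp add: \<epsilon>_def)
  show "\<exists>E \<in> sets ?D.
       E \<subseteq> {((Z, U), Om). risk d p W \<theta> (beta_BA d n p W \<theta> Z U Om) - risk d p W \<theta> (beta_A d n p W \<theta> Z U)
              \<le> (66 * sqrt (real n / real p) + 12 / (real p * \<gamma>)) * (\<theta> \<bullet> \<theta>)} \<and>
       measure ?D E \<ge> 1 - 10 * exp (- ((1 - ln 2) / 2) * real d)"
  proof (intro bexI[of _ "space ?D - B"] conjI)
    show "space ?D - B \<in> sets ?D" using B by auto
    have "measure ?D (space ?D - B) = 1 - measure ?D B" by (rule D.prob_compl[OF B])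
    then show "measure ?D (space ?D - B) \<ge> 1 - 10 * exp (- ((1 - ln 2) / 2) * real d)"
      using B_le exp_gt_zero[of "- ((1 - ln 2) / 2) * real d"] by linarith
    show "space ?D - B \<subseteq> {((Z, U), Om). risk d p W \<theta> (beta_BA d n p W \<theta> Z U Om) - risk d p W \<theta> (beta_A d n p W \<theta> Z U)
              \<le> (66 * sqrt (real n / real p) + 12 / (real p * \<gamma>)) * (\<theta> \<bullet> \<theta>)}"
    proof (clarify)
      fix Z U Om assume sp: "((Z, U), Om) \<in> space ?D" and nB: "((Z, U), Om) \<notin> B"
      have ZU: "Z \<in> space ?M1" "U \<in> space ?M2" "Om \<in> space H" "(Z, U) \<in> space ?M"
        using sp by (auto simp: D space_pair_measure)
      have R: "orth_mat p (fmat p p Om)" using nB N(1) ZU by (auto simp: B_def B0_def)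
      have \<kappa>: "sqrt (4 * real n / real p) = 2 * sqrt (real n / real p)"
        by (simp add: real_sqrt_mult real_sqrt_divide)
      \<comment> \<open>The column space of \<open>W\<close> has its own level with \<open>d\<close>
        for \<open>n\<close>; since \<open>d \<le> n\<close>, one common level serves for both
        correlation hypotheses.\<close>
      have \<kappa>d: "sqrt (4 * real d / real p) \<le> 2 * sqrt (real n / real p)"
        unfolding \<kappa>[symmetric] using dn p by (intro real_sqrt_le_mono divide_right_mono) auto
      have XAx: "XA d n p W (fst (Z, U)) (snd (Z, U)) = XA d n p W Z U" by simp
      show "risk d p W \<theta> (beta_BA d n p W \<theta> Z U Om) - risk d p W \<theta> (beta_A d n p W \<theta> Z U)
              \<le> (66 * sqrt (real n / real p) + 12 / (real p * \<gamma>)) * (\<theta> \<bullet> \<theta>)"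
      proof (rule risk_increment_le[OF _ np l \<theta> W WW R])
        show "0 < n" using d dn by simp
      next
        fix c a :: "real vec" assume ca: "c \<in> carrier_vec n" "a \<in> carrier_vec d" "a \<bullet> \<theta> = 0" and \<theta>0: "\<theta> \<bullet> \<theta> \<noteq> 0"
        have "(U, w) \<notin> near_span d n p W \<theta> (9 / 17)"
          using nB ZU \<theta>0 by (auto simp: B_def B1_def K_def)
        then show "9 / 17 * (vnorm (W *\<^sub>v \<theta>))\<^sup>2 \<le> (vnorm (W *\<^sub>v \<theta> - (W *\<^sub>v a + transpose_mat (fmat n p U) *\<^sub>v c)))\<^sup>2"
          using near_spanI[OF ca, where p = p and x = w and W = W and U = U and t = "9 / 17"] unfolding w by (meson not_le)
      next
        fix c :: "real vec" assume c: "c \<in> carrier_vec n"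
        have "(Xf (Z, U), bf (Z, U), Om) \<notin> correlated n p (sqrt (4 * real n / real p))"
          using nB sp by (simp add: B_def B2_def)
        then show "(transpose_mat (XA d n p W Z U) *\<^sub>v c) \<bullet> (transpose_mat (fmat p p Om) *\<^sub>v
            (transpose_mat (XA d n p W Z U) *\<^sub>v (adj_mat (XA d n p W Z U * transpose_mat (XA d n p W Z U)) *\<^sub>v yA d n \<theta> Z)))
          \<le> 2 * sqrt (real n / real p) * vnorm (transpose_mat (XA d n p W Z U) *\<^sub>v c) *
            vnorm (transpose_mat (XA d n p W Z U) *\<^sub>v (adj_mat (XA d n p W Z U * transpose_mat (XA d n p W Z U)) *\<^sub>v yA d n \<theta> Z))"
          using c unfolding \<kappa> by (auto simp: correlated_def fX fb bv_def not_less)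
      next
        fix c :: "real vec" assume c: "c \<in> carrier_vec d"
        have "(WT, bf (Z, U), swap_ix Om) \<notin> correlated d p (sqrt (4 * real d / real p))"
          using nB sp by (simp add: B_def B3_def)
        then have "(W *\<^sub>v c) \<bullet> (fmat p p Om *\<^sub>v bv (Z, U)) \<le> sqrt (4 * real d / real p) * vnorm (W *\<^sub>v c) * vnorm (bv (Z, U))"
          using c by (auto simp: correlated_def fW fb fmat_swap_ix not_less)
        also have "\<dots> \<le> 2 * sqrt (real n / real p) * vnorm (W *\<^sub>v c) * vnorm (bv (Z, U))"
          using \<kappa>d by (intro mult_right_mono) auto
        finally show "(W *\<^sub>v c) \<bullet> (fmat p p Om *\<^sub>v
            (transpose_mat (XA d n p W Z U) *\<^sub>v (adj_mat (XA d n p W Z U * transpose_mat (XA d n p W Z U)) *\<^sub>v yA d n \<theta> Z)))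
          \<le> 2 * sqrt (real n / real p) * vnorm (W *\<^sub>v c) *
            vnorm (transpose_mat (XA d n p W Z U) *\<^sub>v (adj_mat (XA d n p W Z U * transpose_mat (XA d n p W Z U)) *\<^sub>v yA d n \<theta> Z))"
          by (simp add: bv_def)
      qed
    qed
  qed
qed

end
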